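(* Let $K\ge1$, $n_1,\ldots,n_K\ge2$, $n=\sum_kn_k$, and let $C=QDQ'$ be a nonsingular $n\times n$ block correlation matrix with canonical $K\times K$ block $A$ and $\lambda_k=(n_k-A_{kk})/(n_k-1)$ (see context). Let $V_0\sim t^{\mathrm{std}}_{\nu_0}(0,I_K)$ and $V_k\sim t^{\mathrm{std}}_{\nu_k}(0,I_{n_k-1})$, $k=1,\ldots,K$, be independent with $\nu_0,\ldots,\nu_K>2$, $V=(V_0',V_1',\ldots,V_K')'$, and $Z=C^{1/2}QV$ (i.e. $Z\sim\mathrm{CT}^{\mathrm{std}}_{\boldsymbol m,\boldsymbol\nu}(0,C^{1/2}Q)$ with $\boldsymbol m=(K,n_1-1,\ldots,n_K-1)'$). Let $\ell$ be the log-density of $Z$ viewed as a function of $A$, $\nabla_A=\partial\ell/\partial\mathrm{vec}(A)$, $\mathcal I_A=\mathbb E[\nabla_A\nabla_A']$. Then $$\nabla_A=\tfrac12A_\otimes^{-1/2}\big[W_0\mathrm{vec}(X_0X_0')-\mathrm{vec}(I_K)\big]+\tfrac12E_d'S,$$ $$\mathcal I_A=\tfrac14\big[\phi_0A_\otimes^{-1}H_K+(\phi_0-1)\mathrm{vec}(A^{-1})\mathrm{vec}(A^{-1})'+E_d'\Xi E_d\big],$$ where $S\in\mathbb R^K$ has entries $S_k=\frac1{\lambda_k}-\frac{W_kX_k'X_k}{\lambda_k(n_k-1)}$, $\Xi$ is diagonal with $\Xi_{kk}=\frac{\phi_k-1}{\lambda_k^2}+\frac{2\phi_k}{\lambda_k^2(n_k-1)}$,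 and $$W_0=\frac{\nu_0+K}{\nu_0-2+X_0'X_0},\quad W_k=\frac{\nu_k+n_k-1}{\nu_k-2+X_k'X_k},\quad \phi_0=\frac{\nu_0+K}{\nu_0+K+2},\quad\phi_k=\frac{\nu_k+n_k-1}{\nu_k+n_k+1}.$$
   Context: For $\nu>2$ and positive definite $\Sigma$ ($m\times m$), $t^{\mathrm{std}}_\nu(0,\Sigma)$ has density $\frac{\Gamma((\nu+m)/2)}{\Gamma(\nu/2)}[(\nu-2)\pi]^{-m/2}|\Sigma|^{-1/2}[1+\tfrac1{\nu-2}y'\Sigma^{-1}y]^{-(\nu+m)/2}$. Block setting: $v_m=m^{-1/2}(1,\ldots,1)'\in\mathbb R^m$, $v_m^\perp$ an $m\times(m-1)$ matrix with orthonormal columns orthogonal to $v_m$; $Q=[\mathrm{blockdiag}(v_{n_1},\ldots,v_{n_K}),\ \mathrm{blockdiag}(v_{n_1}^\perp,\ldots,v_{n_K}^\perp)]$. A block correlation matrix $C$ (consecutive groups of sizes $n_k$, $(k,l)$ block constant $\rho_{kl}$ off the unit diagonal) satisfies $C=QDQ'$, $D=\mathrm{blockdiag}(A,\lambda_1I_{n_1-1},\ldots,\lambda_KI_{n_K-1})$, $A$ symmetric positive definite with $A_{kl}=\rho_{kl}\sqrt{n_kn_l}$ ($k\ne l$), $A_{kk}=1+(n_k-1)\rho_{kk}$, $\lambda_k=(n_k-A_{kk})/(n_k-1)>0$; $C$ is thereby a function of $A$. Square roots are symmetric positive definite. With $Y=Q'Z=(Y_0',Y_1',\ldots,Y_K')'$,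 $Y_0\in\mathbb R^K$, $Y_k\in\mathbb R^{n_k-1}$: $X_0=A^{-1/2}Y_0$, $X_k=\lambda_k^{-1/2}Y_k$. Notation: $B_\otimes=B\otimes B$; $K_K$ is the $K^2\times K^2$ commutation matrix, $H_K=I_{K^2}+K_K$; $E_d$ is the $K\times K^2$ matrix with $E_d\mathrm{vec}(B)=\mathrm{diag}(B)$. *)

theory Defs
  imports "HOL-Probability.Probability"
begin

section \<open>Matrices as functions nat => nat => real with explicit dimension (0-based indices)\<close>

type_synonym rmat = "nat \<Rightarrow> nat \<Rightarrow> real"

definition mat_on :: "nat \<Rightarrow> rmat \<Rightarrow> bool" where
  "mat_on m M \<longleftrightarrow> (\<forall>i j. (m \<le> i \<or> m \<le> j) \<longrightarrow> M i j = 0)"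

definition mid :: "nat \<Rightarrow> rmat" where
  "mid m = (\<lambda>i j. if i < m \<and> i = j then 1 else 0)"

definition mmult :: "nat \<Rightarrow> rmat \<Rightarrow> rmat \<Rightarrow> rmat" where
  "mmult m M N = (\<lambda>i j. \<Sum>l<m. M i l * N l j)"

definition msym :: "nat \<Rightarrow> rmat \<Rightarrow> bool" where
  "msym m M \<longleftrightarrow> (\<forall>i<m. \<forall>j<m. M i j = M j i)"

definition mpd :: "nat \<Rightarrow> rmat \<Rightarrow> bool" where
  "mpd m M \<longleftrightarrow> (\<forall>x::nat\<Rightarrow>real. (\<exists>i<m. x i \<noteq> 0) \<longrightarrow>
                    (\<Sum>i<m. \<Sum>j<m. x i * M i j * x j) > 0)"

definition mdet :: "nat \<Rightarrow> rmat \<Rightarrow> real" where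
  "mdet m M = (\<Sum>p\<in>{p. p permutes {..<m}}. of_int (sign p) * (\<Prod>i<m. M i (p i)))"

definition minv :: "nat \<Rightarrow> rmat \<Rightarrow> rmat" where
  "minv m M = (THE N. mat_on m N \<and> (\<forall>i<m. \<forall>j<m. mmult m M N i j = mid m i j))"

definition msqrt :: "nat \<Rightarrow> rmat \<Rightarrow> rmat" where
  "msqrt m M = (THE R. mat_on m R \<and> msym m R \<and> mpd m R \<and>
                      (\<forall>i<m. \<forall>j<m. mmult m R R i j = M i j))"

text \<open>Kronecker product of two K x K matrices, compatible with vec stacking columns:
  vec(B) at index i + K*j is B i j (row i, column j).\<close>
definition kron :: "nat \<Rightarrow> rmat \<Rightarrow> rmat \<Rightarrow> rmat" where
  "kron K B C = (\<lambda>a b. if a < K*K \<and> b < K*K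
       then B (a div K) (b div K) * C (a mod K) (b mod K) else 0)"

definition vecm :: "nat \<Rightarrow> rmat \<Rightarrow> nat \<Rightarrow> real" where
  "vecm K B = (\<lambda>p. if p < K*K then B (p mod K) (p div K) else 0)"

text \<open>Commutation matrix K_K: K_K vec(B) = vec(B').\<close>
definition commK :: "nat \<Rightarrow> rmat" where
  "commK K = (\<lambda>p q. if p < K*K \<and> q < K*K \<and> q = p div K + K * (p mod K) then 1 else 0)"

definition HK :: "nat \<Rightarrow> rmat" where
  "HK K = (\<lambda>p q. mid (K*K) p q + commK K p q)"

text \<open>E_d: K x K^2 with E_d vec(B) = diag(B).\<close>
definition Ed :: "nat \<Rightarrow> rmat" where
  "Ed K = (\<lambda>k p. if k < K \<and> p = k + K*k then 1 else 0)"

definition fro :: "nat \<Rightarrow> rmat \<Rightarrow> real" where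
  "fro m M = sqrt (\<Sum>i<m. \<Sum>j<m. (M i j)\<^sup>2)"

definition tstd_density :: "real \<Rightarrow> nat \<Rightarrow> rmat \<Rightarrow> (nat \<Rightarrow> real) \<Rightarrow> real" where
  "tstd_density \<nu> m \<Sigma> y =
     Gamma ((\<nu> + real m) / 2) / Gamma (\<nu> / 2) * ((\<nu> - 2) * pi) powr (- real m / 2)
     * mdet m \<Sigma> powr (-1/2)
     * (1 + (\<Sum>i<m. \<Sum>j<m. y i * minv m \<Sigma> i j * y j) / (\<nu> - 2)) powr (- (\<nu> + real m) / 2)"

text \<open>K blocks of sizes nb 0, ..., nb (K-1) (consecutive); total dimension and offsets.\<close>
definition ntot :: "nat \<Rightarrow> (nat \<Rightarrow> nat) \<Rightarrow> nat" where
  "ntot K nb = (\<Sum>k<K. nb k)"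

definition roff :: "(nat \<Rightarrow> nat) \<Rightarrow> nat \<Rightarrow> nat" where
  "roff nb k = (\<Sum>j<k. nb j)"

text \<open>offset (within the last n-K coordinates) of the (n_k - 1)-block\<close>
definition coff :: "(nat \<Rightarrow> nat) \<Rightarrow> nat \<Rightarrow> nat" where
  "coff nb k = (\<Sum>j<k. nb j - 1)"

definition inblk :: "(nat \<Rightarrow> nat) \<Rightarrow> nat \<Rightarrow> nat \<Rightarrow> bool" where
  "inblk nb k r \<longleftrightarrow> roff nb k \<le> r \<and> r < roff nb k + nb k"

text \<open>U k is the chosen n_k x (n_k - 1) matrix v_{n_k}^perp (orthonormal columns orthogonal to
  the vector of ones).\<close>
definition is_vperp :: "nat \<Rightarrow> rmat \<Rightarrow> bool" where
  "is_vperp m U \<longleftrightarrow>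
     (\<forall>i<m-1. \<forall>j<m-1. (\<Sum>r<m. U r i * U r j) = (if i = j then 1 else 0)) \<and>
     (\<forall>i<m-1. (\<Sum>r<m. U r i) = 0)"

text \<open>Q = [blockdiag(v_{n_1},...,v_{n_K}), blockdiag(v_{n_1}^perp,...,v_{n_K}^perp)].\<close>
definition Qmat :: "nat \<Rightarrow> (nat \<Rightarrow> nat) \<Rightarrow> (nat \<Rightarrow> rmat) \<Rightarrow> rmat" where
  "Qmat K nb U = (\<lambda>r c. if r < ntot K nb \<and> c < ntot K nb then
      (\<Sum>k<K. if inblk nb k r then
          (if c = k then 1 / sqrt (real (nb k))
           else if K + coff nb k \<le> c \<and> c < K + coff nb k + (nb k - 1)
                then U k (r - roff nb k) (c - K - coff nb k) else 0)
        else 0)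
      else 0)"

definition lam :: "(nat \<Rightarrow> nat) \<Rightarrow> rmat \<Rightarrow> nat \<Rightarrow> real" where
  "lam nb A k = (real (nb k) - A k k) / (real (nb k) - 1)"

text \<open>Block correlation parameters rho_{kl} recovered from A.\<close>
definition rho :: "(nat \<Rightarrow> nat) \<Rightarrow> rmat \<Rightarrow> nat \<Rightarrow> nat \<Rightarrow> real" where
  "rho nb A k l = (if k = l then (A k k - 1) / (real (nb k) - 1)
                   else A k l / sqrt (real (nb k) * real (nb l)))"

definition Cmat :: "nat \<Rightarrow> (nat \<Rightarrow> nat) \<Rightarrow> rmat \<Rightarrow> rmat" where
  "Cmat K nb A = (\<lambda>r s. if r < ntot K nb \<and> s < ntot K nb then
      (if r = s then 1 else
        (\<Sum>k<K. \<Sum>l<K. if inblk nb k r \<and> inblk nb l s then rho nb A k l else 0))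
      else 0)"

definition Lmat :: "nat \<Rightarrow> (nat \<Rightarrow> nat) \<Rightarrow> (nat \<Rightarrow> rmat) \<Rightarrow> rmat \<Rightarrow> rmat" where
  "Lmat K nb U A = mmult (ntot K nb) (msqrt (ntot K nb) (Cmat K nb A)) (Qmat K nb U)"

definition mapply :: "nat \<Rightarrow> rmat \<Rightarrow> (nat \<Rightarrow> real) \<Rightarrow> nat \<Rightarrow> real" where
  "mapply m M v = (\<lambda>i. \<Sum>j<m. M i j * v j)"

definition fV :: "nat \<Rightarrow> (nat \<Rightarrow> nat) \<Rightarrow> real \<Rightarrow> (nat \<Rightarrow> real) \<Rightarrow> (nat \<Rightarrow> real) \<Rightarrow> real" where
  "fV K nb \<nu>0 \<nu> v =
     tstd_density \<nu>0 K (mid K) (\<lambda>i. if i < K then v i else 0) *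
     (\<Prod>k<K. tstd_density (\<nu> k) (nb k - 1) (mid (nb k - 1))
                 (\<lambda>i. if i < nb k - 1 then v (K + coff nb k + i) else 0))"

text \<open>Density of Z = L V (change of variables) and its logarithm, as functions of A.\<close>
definition fZ :: "nat \<Rightarrow> (nat \<Rightarrow> nat) \<Rightarrow> (nat \<Rightarrow> rmat) \<Rightarrow> real \<Rightarrow> (nat \<Rightarrow> real) \<Rightarrow> rmat \<Rightarrow> (nat \<Rightarrow> real) \<Rightarrow> real" where
  "fZ K nb U \<nu>0 \<nu> A z =
     fV K nb \<nu>0 \<nu> (mapply (ntot K nb) (minv (ntot K nb) (Lmat K nb U A)) z)
     / \<bar>mdet (ntot K nb) (Lmat K nb U A)\<bar>"

definition loglik :: "nat \<Rightarrow> (nat \<Rightarrow> nat) \<Rightarrow> (nat \<Rightarrow> rmat) \<Rightarrow> real \<Rightarrow> (nat \<Rightarrow> real) \<Rightarrow> rmat \<Rightarrow> (nat \<Rightarrow> real) \<Rightarrow> real" where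
  "loglik K nb U \<nu>0 \<nu> A z = ln (fZ K nb U \<nu>0 \<nu> A z)"

text \<open>g (a vector of length K^2) is the gradient of f at A w.r.t. vec(A), where f is viewed as a
  function of symmetric K x K matrices (Frechet derivative within the symmetric matrices).\<close>
definition has_sym_grad :: "nat \<Rightarrow> (rmat \<Rightarrow> real) \<Rightarrow> rmat \<Rightarrow> (nat \<Rightarrow> real) \<Rightarrow> bool" where
  "has_sym_grad K f A g \<longleftrightarrow>
     (\<forall>e>0. \<exists>d>0. \<forall>B. msym K B \<and> fro K (\<lambda>i j. B i j - A i j) < d \<longrightarrow>
        \<bar>f B - f A - (\<Sum>p<K*K. g p * (vecm K B p - vecm K A p))\<bar>
          \<le> e * fro K (\<lambda>i j. B i j - A i j))"

definition Yv :: "nat \<Rightarrow> (nat \<Rightarrow> nat) \<Rightarrow> (nat \<Rightarrow> rmat) \<Rightarrow> (nat \<Rightarrow> real) \<Rightarrow> nat \<Rightarrow> real" where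
  "Yv K nb U z = (\<lambda>c. \<Sum>r<ntot K nb. Qmat K nb U r c * z r)"

definition X0 :: "nat \<Rightarrow> (nat \<Rightarrow> nat) \<Rightarrow> (nat \<Rightarrow> rmat) \<Rightarrow> rmat \<Rightarrow> (nat \<Rightarrow> real) \<Rightarrow> nat \<Rightarrow> real" where
  "X0 K nb U A z = (\<lambda>i. \<Sum>j<K. minv K (msqrt K A) i j * Yv K nb U z j)"

definition Xk :: "nat \<Rightarrow> (nat \<Rightarrow> nat) \<Rightarrow> (nat \<Rightarrow> rmat) \<Rightarrow> rmat \<Rightarrow> (nat \<Rightarrow> real) \<Rightarrow> nat \<Rightarrow> nat \<Rightarrow> real" where
  "Xk K nb U A z k = (\<lambda>i. lam nb A k powr (-1/2) * Yv K nb U z (K + coff nb k + i))"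

definition X0sq where
  "X0sq K nb U A z = (\<Sum>i<K. (X0 K nb U A z i)\<^sup>2)"

definition Xksq where
  "Xksq K nb U A z k = (\<Sum>i<nb k - 1. (Xk K nb U A z k i)\<^sup>2)"

definition W0 :: "nat \<Rightarrow> (nat \<Rightarrow> nat) \<Rightarrow> (nat \<Rightarrow> rmat) \<Rightarrow> real \<Rightarrow> rmat \<Rightarrow> (nat \<Rightarrow> real) \<Rightarrow> real" where
  "W0 K nb U \<nu>0 A z = (\<nu>0 + real K) / (\<nu>0 - 2 + X0sq K nb U A z)"

definition Wk :: "nat \<Rightarrow> (nat \<Rightarrow> nat) \<Rightarrow> (nat \<Rightarrow> rmat) \<Rightarrow> (nat \<Rightarrow> real) \<Rightarrow> rmat \<Rightarrow> (nat \<Rightarrow> real) \<Rightarrow> nat \<Rightarrow> real" where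
  "Wk K nb U \<nu> A z k = (\<nu> k + real (nb k) - 1) / (\<nu> k - 2 + Xksq K nb U A z k)"

definition phi0 :: "nat \<Rightarrow> real \<Rightarrow> real" where
  "phi0 K \<nu>0 = (\<nu>0 + real K) / (\<nu>0 + real K + 2)"

definition phik :: "(nat \<Rightarrow> nat) \<Rightarrow> (nat \<Rightarrow> real) \<Rightarrow> nat \<Rightarrow> real" where
  "phik nb \<nu> k = (\<nu> k + real (nb k) - 1) / (\<nu> k + real (nb k) + 1)"

definition Svec where
  "Svec K nb U \<nu> A z k = 1 / lam nb A k
      - Wk K nb U \<nu> A z k * Xksq K nb U A z k / (lam nb A k * (real (nb k) - 1))"

definition Xi :: "(nat \<Rightarrow> nat) \<Rightarrow> (nat \<Rightarrow> real) \<Rightarrow> rmat \<Rightarrow> rmat" where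
  "Xi nb \<nu> A = (\<lambda>k l. if k = l then
      (phik nb \<nu> k - 1) / (lam nb A k)\<^sup>2 + 2 * phik nb \<nu> k / ((lam nb A k)\<^sup>2 * (real (nb k) - 1))
      else 0)"

definition Aot_invsqrt :: "nat \<Rightarrow> rmat \<Rightarrow> rmat" where
  "Aot_invsqrt K A = minv (K*K) (msqrt (K*K) (kron K A A))"

definition Aot_inv :: "nat \<Rightarrow> rmat \<Rightarrow> rmat" where
  "Aot_inv K A = minv (K*K) (kron K A A)"

definition score :: "nat \<Rightarrow> (nat \<Rightarrow> nat) \<Rightarrow> (nat \<Rightarrow> rmat) \<Rightarrow> real \<Rightarrow> (nat \<Rightarrow> real) \<Rightarrow> rmat \<Rightarrow> (nat \<Rightarrow> real) \<Rightarrow> nat \<Rightarrow> real" where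
  "score K nb U \<nu>0 \<nu> A z = (\<lambda>p.
     1/2 * (\<Sum>q<K*K. Aot_invsqrt K A p q *
        (W0 K nb U \<nu>0 A z * vecm K (\<lambda>i j. X0 K nb U A z i * X0 K nb U A z j) q - vecm K (mid K) q))
     + 1/2 * (\<Sum>k<K. Ed K k p * Svec K nb U \<nu> A z k))"

definition info :: "nat \<Rightarrow> (nat \<Rightarrow> nat) \<Rightarrow> real \<Rightarrow> (nat \<Rightarrow> real) \<Rightarrow> rmat \<Rightarrow> rmat" where
  "info K nb \<nu>0 \<nu> A = (\<lambda>p q. 1/4 * (
      phi0 K \<nu>0 * mmult (K*K) (Aot_inv K A) (HK K) p q
      + (phi0 K \<nu>0 - 1) * vecm K (minv K A) p * vecm K (minv K A) q
      + (\<Sum>k<K. \<Sum>l<K. Ed K k p * Xi nb \<nu> A k l * Ed K l q)))"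

end

theory Submission
  imports Defs "Jordan_Normal_Form.Determinant"
begin

text \<open>
  Conjugation by the orthogonal matrix \<open>Q\<close> turns \<open>C\<^sup>1\<^sup>/\<^sup>2\<close> into the block diagonal matrix \<open>D\<^sup>1\<^sup>/\<^sup>2\<close>,
  so the density of \<open>Z\<close> is the product of the t density with scale \<open>A\<close> at \<open>Y\<^sub>0\<close> and the t densities with
  scales \<open>\<lambda>\<^sub>k I\<close> at \<open>Y\<^sub>k\<close>, where \<open>\<lambda>\<^sub>k\<close> is affine in \<open>A\<^sub>k\<^sub>k\<close>. One formula for the derivative of the logarithm
  of a t density with respect to its scale matrix gives all directional derivatives. They depend
  continuously on \<open>A\<close>, which by the mean value theorem gives the gradient.

  At the true parameter \<open>X\<^sub>0 = V\<^sub>0\<close> and \<open>X\<^sub>k = V\<^sub>k\<close>, so the score is a linear combination of the centred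
  variables \<open>W V\<^sub>a V\<^sub>b - \<delta>\<^sub>a\<^sub>b\<close> of the independent blocks. A t density is a Gamma mixture of Gaussian ones, and
  the factors \<open>W\<close> only shift the Gamma exponent; the second and fourth moments of the weighted variables
  are therefore Gaussian moments, up to the factor \<open>\<phi>\<close>.
\<close>

section \<open>Square matrices of a fixed dimension\<close>

definition mat_eq :: "rmat \<Rightarrow> nat \<Rightarrow> rmat \<Rightarrow> bool" (\<open>(_/ =\<^bsub>_\<^esub> _)\<close> [51, 0, 51] 50) where
  "M =\<^bsub>m\<^esub> N \<longleftrightarrow> (\<forall>i<m. \<forall>j<m. M i j = N i j)"

lemma mat_eqI: "(\<And>i j. i < m \<Longrightarrow> j < m \<Longrightarrow> M i j = N i j) \<Longrightarrow> M =\<^bsub>m\<^esub> N"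
  by (simp add: mat_eq_def)

lemma mat_eqD: "M =\<^bsub>m\<^esub> N \<Longrightarrow> i < m \<Longrightarrow> j < m \<Longrightarrow> M i j = N i j"
  by (simp add: mat_eq_def)

lemma mat_eq_refl [simp]: "M =\<^bsub>m\<^esub> M"
  by (simp add: mat_eq_def)

lemma mat_eq_sym: "M =\<^bsub>m\<^esub> N \<Longrightarrow> N =\<^bsub>m\<^esub> M"
  by (simp add: mat_eq_def)

lemma mat_eq_trans [trans]: "M =\<^bsub>m\<^esub> N \<Longrightarrow> N =\<^bsub>m\<^esub> P \<Longrightarrow> M =\<^bsub>m\<^esub> P"
  by (simp add: mat_eq_def)

lemma eq_mat_eq_trans [trans]: "M = N \<Longrightarrow> N =\<^bsub>m\<^esub> P \<Longrightarrow> M =\<^bsub>m\<^esub> P"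
  by simp

lemma mat_eq_eq_trans [trans]: "M =\<^bsub>m\<^esub> N \<Longrightarrow> N = P \<Longrightarrow> M =\<^bsub>m\<^esub> P"
  by simp

lemma mmult_cong: "M =\<^bsub>m\<^esub> M' \<Longrightarrow> N =\<^bsub>m\<^esub> N' \<Longrightarrow> mmult m M N =\<^bsub>m\<^esub> mmult m M' N'"
  by (simp add: mat_eq_def mmult_def)

lemma mapply_cong:
  "M =\<^bsub>m\<^esub> M' \<Longrightarrow> (\<And>j. j < m \<Longrightarrow> x j = x' j) \<Longrightarrow> i < m \<Longrightarrow> mapply m M x i = mapply m M' x' i"
  by (simp add: mat_eq_def mapply_def)

lemma mmult_assoc: "mmult m (mmult m M N) P = mmult m M (mmult m N P)"
  unfolding mmult_def
  by (intro ext, simp add: sum_distrib_left sum_distrib_right mult.assoc, rule sum.swap)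

lemma mapply_mmult: "mapply m (mmult m M N) x = mapply m M (mapply m N x)"
  unfolding mapply_def mmult_def
  by (intro ext, simp add: sum_distrib_left sum_distrib_right mult.assoc, rule sum.swap)

lemma sum_mid_mult: "i < m \<Longrightarrow> (\<Sum>l<m. mid m i l * f l) = f i"
  by (simp add: mid_def if_distrib[of "\<lambda>x. x * _"] cong: if_cong)

lemma sum_mult_mid: "i < m \<Longrightarrow> (\<Sum>l<m. f l * mid m l i) = f i"
  by (simp add: mid_def if_distrib[of "\<lambda>x. _ * x"] cong: if_cong)

lemma mmult_mid_left: "mmult m (mid m) M =\<^bsub>m\<^esub> M"
  by (simp add: mat_eq_def mmult_def sum_mid_mult)

lemma mmult_mid_right: "mmult m M (mid m) =\<^bsub>m\<^esub> M"
  by (simp add: mat_eq_def mmult_def sum_mult_mid)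

lemma mapply_mid: "i < m \<Longrightarrow> mapply m (mid m) x i = x i"
  by (simp add: mapply_def sum_mid_mult)

lemma mid_sym: "mid m i j = mid m j i"
  by (auto simp: mid_def)

definition mtranspose :: "rmat \<Rightarrow> rmat" where
  "mtranspose M = (\<lambda>i j. M j i)"

lemma mtranspose_mtranspose [simp]: "mtranspose (mtranspose M) = M"
  by (simp add: mtranspose_def)

lemma mtranspose_mid [simp]: "mtranspose (mid m) = mid m"
  by (simp add: mtranspose_def fun_eq_iff mid_sym[of m])

lemma mtranspose_mmult: "mtranspose (mmult m M N) = mmult m (mtranspose N) (mtranspose M)"
  by (simp add: mtranspose_def mmult_def mult.commute)

lemma mtranspose_cong: "M =\<^bsub>m\<^esub> N \<Longrightarrow> mtranspose M =\<^bsub>m\<^esub> mtranspose N"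
  by (simp add: mat_eq_def mtranspose_def)

lemma msym_iff_mtranspose: "msym m M \<longleftrightarrow> mtranspose M =\<^bsub>m\<^esub> M"
  by (auto simp: msym_def mat_eq_def mtranspose_def)

lemma msym_cong: "M =\<^bsub>m\<^esub> N \<Longrightarrow> msym m M \<longleftrightarrow> msym m N"
  by (simp add: msym_def mat_eq_def)

lemma msymD: "msym m M \<Longrightarrow> i < m \<Longrightarrow> j < m \<Longrightarrow> M i j = M j i"
  by (simp add: msym_def)

definition scaled_mid :: "nat \<Rightarrow> real \<Rightarrow> rmat" where
  "scaled_mid m c = (\<lambda>i j. c * mid m i j)"

lemma mapply_scaled_mid: "i < m \<Longrightarrow> mapply m (scaled_mid m c) x i = c * x i"
  by (simp add: scaled_mid_def mapply_def mult.assoc sum_mid_mult flip: sum_distrib_left)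

lemma mmult_scaled_mid: "mmult m (scaled_mid m c) (scaled_mid m d) =\<^bsub>m\<^esub> scaled_mid m (c * d)"
  by (rule mat_eqI)
     (simp add: scaled_mid_def mmult_def mult_ac sum_mid_mult flip: sum_distrib_left)

subsection \<open>Determinants and inverses\<close>

definition mat_of :: "nat \<Rightarrow> rmat \<Rightarrow> real mat" where
  "mat_of m M = mat m m (\<lambda>(i, j). M i j)"

lemma mat_of_carrier [simp]: "mat_of m M \<in> carrier_mat m m"
  by (simp add: mat_of_def)

lemma mat_of_dim [simp]: "dim_row (mat_of m M) = m" "dim_col (mat_of m M) = m"
  by (simp_all add: mat_of_def)

lemma mat_of_index [simp]: "i < m \<Longrightarrow> j < m \<Longrightarrow> mat_of m M $$ (i, j) = M i j"
  by (simp add: mat_of_def)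

lemma mat_of_mmult: "mat_of m (mmult m M N) = mat_of m M * mat_of m N"
  by (rule eq_matI) (auto simp: mmult_def scalar_prod_def lessThan_atLeast0)

lemma mat_of_mid: "mat_of m (mid m) = 1\<^sub>m m"
  by (rule eq_matI) (auto simp: mid_def)

lemma mat_of_eq_iff: "mat_of m M = mat_of m N \<longleftrightarrow> M =\<^bsub>m\<^esub> N"
  unfolding mat_eq_def by (metis mat_of_index eq_matI mat_of_dim)

lemma mdet_eq_det: "mdet m M = det (mat_of m M)"
  by (simp add: mdet_def det_def lessThan_atLeast0 permutes_in_image)

lemma mdet_cong: "M =\<^bsub>m\<^esub> N \<Longrightarrow> mdet m M = mdet m N"
  by (simp add: mdet_eq_det flip: mat_of_eq_iff)

lemma mdet_mmult: "mdet m (mmult m M N) = mdet m M * mdet m N"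
  by (simp add: mdet_eq_det mat_of_mmult det_mult[of _ m])

lemma mdet_mid [simp]: "mdet m (mid m) = 1"
  by (simp add: mdet_eq_det mat_of_mid)

lemma mdet_mtranspose: "mdet m (mtranspose M) = mdet m M"
proof -
  have "mat_of m (mtranspose M) = transpose_mat (mat_of m M)"
    by (rule eq_matI) (auto simp: mtranspose_def)
  then show ?thesis by (simp add: mdet_eq_det det_transpose[of _ m])
qed

lemma mdet_scaled_mid: "mdet m (scaled_mid m c) = c ^ m"
proof -
  have "mat_of m (scaled_mid m c) = c \<cdot>\<^sub>m 1\<^sub>m m"
    by (rule eq_matI) (auto simp: scaled_mid_def mid_def)
  then show ?thesis by (simp add: mdet_eq_det)
qed

definition inverts :: "nat \<Rightarrow> rmat \<Rightarrow> rmat \<Rightarrow> bool" where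
  "inverts m M N \<longleftrightarrow> mmult m M N =\<^bsub>m\<^esub> mid m"

lemma inverts_iff_mat_of: "inverts m M N \<longleftrightarrow> mat_of m M * mat_of m N = 1\<^sub>m m"
  by (simp add: inverts_def flip: mat_of_mmult mat_of_mid mat_of_eq_iff)

lemma inverts_commute: "inverts m M N \<Longrightarrow> inverts m N M"
  unfolding inverts_iff_mat_of by (rule mat_mult_left_right_inverse[of _ m]) auto

lemma inverts_cong: "M =\<^bsub>m\<^esub> M' \<Longrightarrow> N =\<^bsub>m\<^esub> N' \<Longrightarrow> inverts m M N \<longleftrightarrow> inverts m M' N'"
  using mmult_cong[of M m M' N N'] by (simp add: inverts_def mat_eq_def)

lemma mdet_mult_inverse:
  assumes "inverts m M N" shows "mdet m M * mdet m N = 1"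
  using mdet_cong[OF assms[unfolded inverts_def]] by (simp add: mdet_mmult)

lemma mdet_nonzero_if_inverts: "inverts m M N \<Longrightarrow> mdet m M \<noteq> 0"
  using mdet_mult_inverse by fastforce

lemma mmult_inverts_cancel: "inverts m M N \<Longrightarrow> mmult m (mmult m M N) P =\<^bsub>m\<^esub> P"
  unfolding inverts_def
  by (rule mat_eq_trans[OF mmult_cong[OF _ mat_eq_refl] mmult_mid_left])

lemma mapply_inverts_cancel:
  "inverts m M N \<Longrightarrow> i < m \<Longrightarrow> mapply m M (mapply m N x) i = x i"
  using mapply_cong[of "mmult m M N" m "mid m" x x i]
  by (simp add: inverts_def mapply_mid mapply_mmult)

lemma inverts_mmult:
  assumes "inverts m M N" "inverts m M' N'"
  shows "inverts m (mmult m M M') (mmult m N' N)"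
proof -
  have "mmult m (mmult m M M') (mmult m N' N) = mmult m M (mmult m (mmult m M' N') N)"
    by (simp add: mmult_assoc)
  also have "\<dots> =\<^bsub>m\<^esub> mmult m M N"
    by (intro mmult_cong mat_eq_refl mmult_inverts_cancel assms)
  also have "\<dots> =\<^bsub>m\<^esub> mid m" using assms(1) by (simp add: inverts_def)
  finally show ?thesis by (simp add: inverts_def)
qed

lemma inverts_mtranspose:
  assumes "inverts m M N" shows "inverts m (mtranspose M) (mtranspose N)"
  using mtranspose_cong[OF inverts_commute[OF assms, unfolded inverts_def]]
  by (simp add: inverts_def mtranspose_mmult)

lemma inverts_unique:
  assumes "inverts m M N" "inverts m M N'" shows "N =\<^bsub>m\<^esub> N'"
proof -
  have "N =\<^bsub>m\<^esub> mmult m N (mid m)" by (rule mat_eq_sym[OF mmult_mid_right])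
  also have "\<dots> =\<^bsub>m\<^esub> mmult m N (mmult m M N')"
    by (rule mmult_cong[OF mat_eq_refl mat_eq_sym[OF assms(2)[unfolded inverts_def]]])
  also have "\<dots> = mmult m (mmult m N M) N'" by (simp add: mmult_assoc)
  also have "\<dots> =\<^bsub>m\<^esub> N'" by (rule mmult_inverts_cancel[OF inverts_commute[OF assms(1)]])
  finally show ?thesis .
qed

lemma inverts_scaled_mid: "c \<noteq> 0 \<Longrightarrow> inverts m (scaled_mid m c) (scaled_mid m (1 / c))"
  using mmult_scaled_mid[of m c "1 / c"] by (simp add: inverts_def scaled_mid_def[of m 1])

lemma minv_eqI:
  assumes "inverts m M N" shows "minv m M =\<^bsub>m\<^esub> N"
proof -
  let ?N = "\<lambda>i j. if i < m \<and> j < m then N i j else 0"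
  have N_eq: "?N =\<^bsub>m\<^esub> N" by (simp add: mat_eq_def)
  then have inv: "inverts m M ?N"
    using assms inverts_cong[OF mat_eq_refl] by blast
  have "minv m M = ?N"
    unfolding minv_def mat_eq_def[symmetric] inverts_def[symmetric]
  proof (rule the_equality)
    fix N' assume N': "mat_on m N' \<and> inverts m M N'"
    then have "N' =\<^bsub>m\<^esub> ?N" using inv by (blast intro: inverts_unique)
    then show "N' = ?N" using N' by (auto simp: fun_eq_iff mat_eq_def mat_on_def)
  qed (use inv in \<open>auto simp: mat_on_def\<close>)
  with N_eq show ?thesis by simp
qed

lemma minv_mid: "minv m (mid m) =\<^bsub>m\<^esub> mid m"
  by (rule minv_eqI) (simp add: inverts_def mmult_mid_left)

lemma minv_scaled_mid: "c \<noteq> 0 \<Longrightarrow> minv m (scaled_mid m c) =\<^bsub>m\<^esub> scaled_mid m (1 / c)"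
  by (intro minv_eqI inverts_scaled_mid)

definition adjugate :: "nat \<Rightarrow> rmat \<Rightarrow> rmat" where
  "adjugate m M = (\<lambda>i j. (-1) ^ (j + i) *
     mdet (m - 1) (\<lambda>a b. M (if a < j then a else Suc a) (if b < i then b else Suc b)))"

lemma adjugate_eq_adj_mat: "i < m \<Longrightarrow> j < m \<Longrightarrow> adjugate m M i j = adj_mat (mat_of m M) $$ (i, j)"
  by (auto simp: adjugate_def adj_mat_def cofactor_def mat_delete_def mdet_eq_det mat_of_def
      intro!: arg_cong[where f = det] eq_matI)

lemma inverts_adjugate:
  assumes "mdet m M \<noteq> 0"
  shows "inverts m M (\<lambda>i j. adjugate m M i j / mdet m M)"
  unfolding inverts_def
proof (rule mat_eqI)
  fix i j assume ij: "i < m" "j < m"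
  have adj: "mat_of m M * adj_mat (mat_of m M) = mdet m M \<cdot>\<^sub>m 1\<^sub>m m"
    "adj_mat (mat_of m M) \<in> carrier_mat m m"
    using adj_mat[OF mat_of_carrier[of m M]] by (auto simp: mdet_eq_det)
  have "mmult m M (\<lambda>i j. adjugate m M i j / mdet m M) i j
      = (\<Sum>l<m. M i l * adj_mat (mat_of m M) $$ (l, j)) / mdet m M"
    using ij by (simp add: mmult_def adjugate_eq_adj_mat sum_divide_distrib)
  also have "(\<Sum>l<m. M i l * adj_mat (mat_of m M) $$ (l, j))
      = (mat_of m M * adj_mat (mat_of m M)) $$ (i, j)"
    using ij adj(2) by (auto simp: scalar_prod_def lessThan_atLeast0 intro!: sum.cong)
  also have "\<dots> = mdet m M * mid m i j" using ij by (simp add: adj(1) mid_def)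
  finally show "mmult m M (\<lambda>i j. adjugate m M i j / mdet m M) i j = mid m i j"
    using assms by simp
qed

lemma minv_eq_adjugate: "mdet m M \<noteq> 0 \<Longrightarrow> minv m M =\<^bsub>m\<^esub> (\<lambda>i j. adjugate m M i j / mdet m M)"
  by (intro minv_eqI inverts_adjugate)

lemma inverts_minv: "mdet m M \<noteq> 0 \<Longrightarrow> inverts m M (minv m M)"
  using inverts_adjugate minv_eq_adjugate inverts_cong[OF mat_eq_refl] by blast

lemma msym_minv:
  assumes "msym m M" "mdet m M \<noteq> 0" shows "msym m (minv m M)"
proof -
  have "inverts m M (mtranspose (minv m M))"
    using inverts_mtranspose[OF inverts_minv[OF assms(2)]] assms(1) inverts_cong[OF _ mat_eq_refl]
    by (auto simp: msym_iff_mtranspose)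
  then show ?thesis
    using inverts_minv[OF assms(2)] inverts_unique by (auto simp: msym_iff_mtranspose)
qed

lemma exists_kernel_vector:
  assumes "mdet m M = 0"
  obtains x where "\<exists>i<m. x i \<noteq> 0" "\<And>i. i < m \<Longrightarrow> mapply m M x i = 0"
proof -
  obtain v where v: "v \<in> carrier_vec m" "v \<noteq> 0\<^sub>v m" "mat_of m M *\<^sub>v v = 0\<^sub>v m"
    using assms det_0_iff_vec_prod_zero_field[OF mat_of_carrier[of m M]] by (auto simp: mdet_eq_det)
  have "\<exists>i<m. Matrix.vec_index v i \<noteq> 0"
  proof (rule ccontr)
    assume "\<not> ?thesis"
    then have "v = 0\<^sub>v m" using v(1) by (intro eq_vecI) auto
    then show False using v(2) by simp
  qed
  moreover have "mapply m M (Matrix.vec_index v) i = 0" if "i < m" for i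
  proof -
    have "mapply m M (Matrix.vec_index v) i = Matrix.vec_index (mat_of m M *\<^sub>v v) i"
      using that v(1) by (auto simp: mapply_def scalar_prod_def lessThan_atLeast0 intro!: sum.cong)
    then show ?thesis using v(3) that by simp
  qed
  ultimately show ?thesis by (rule that[of "Matrix.vec_index v"])
qed

section \<open>Quadratic forms and positive definite matrices\<close>

definition dot :: "nat \<Rightarrow> (nat \<Rightarrow> real) \<Rightarrow> (nat \<Rightarrow> real) \<Rightarrow> real" where
  "dot m x y = (\<Sum>i<m. x i * y i)"

definition quad_form :: "nat \<Rightarrow> rmat \<Rightarrow> (nat \<Rightarrow> real) \<Rightarrow> real" where
  "quad_form m M x = (\<Sum>i<m. \<Sum>j<m. x i * M i j * x j)"

definition spd :: "nat \<Rightarrow> rmat \<Rightarrow> bool" where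
  "spd m M \<longleftrightarrow> msym m M \<and> mpd m M"

lemma dot_cong: "(\<And>i. i < m \<Longrightarrow> x i = x' i) \<Longrightarrow> (\<And>i. i < m \<Longrightarrow> y i = y' i) \<Longrightarrow> dot m x y = dot m x' y'"
  by (simp add: dot_def)

lemma dot_commute: "dot m x y = dot m y x"
  by (simp add: dot_def mult.commute)

lemma dot_self_nonneg [simp]: "dot m x x \<ge> 0"
  by (simp add: dot_def sum_nonneg)

lemma dot_self_pos_iff: "dot m x x > 0 \<longleftrightarrow> (\<exists>i<m. x i \<noteq> 0)"
proof -
  have "dot m x x = 0 \<longleftrightarrow> (\<forall>i<m. x i = 0)"
    unfolding dot_def by (subst sum_nonneg_eq_0_iff) auto
  then show ?thesis by (auto simp: less_le)
qed

lemma power2_le_dot_self: "i < m \<Longrightarrow> (x i)\<^sup>2 \<le> dot m x x"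
  unfolding dot_def power2_eq_square
  by (rule member_le_sum[of i "{..<m}" "\<lambda>i. x i * x i"]) auto

lemma dot_mapply_mtranspose: "dot m x (mapply m M y) = dot m (mapply m (mtranspose M) x) y"
proof -
  have "dot m x (mapply m M y) = (\<Sum>i<m. \<Sum>j<m. x i * (M i j * y j))"
    by (simp add: dot_def mapply_def sum_distrib_left)
  also have "\<dots> = (\<Sum>j<m. \<Sum>i<m. x i * (M i j * y j))" by (rule sum.swap)
  finally show ?thesis
    by (simp add: dot_def mapply_def mtranspose_def sum_distrib_left sum_distrib_right mult_ac)
qed

lemma dot_mapply_msym:
  assumes "msym m M" shows "dot m x (mapply m M y) = dot m (mapply m M x) y"
  unfolding dot_mapply_mtranspose using assms
  by (intro dot_cong mapply_cong) (auto simp: msym_iff_mtranspose)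

lemma quad_form_eq_dot: "quad_form m M x = dot m x (mapply m M x)"
  by (simp add: quad_form_def dot_def mapply_def sum_distrib_left mult.assoc)

lemma quad_form_cong:
  "M =\<^bsub>m\<^esub> N \<Longrightarrow> (\<And>i. i < m \<Longrightarrow> x i = y i) \<Longrightarrow> quad_form m M x = quad_form m N y"
  by (simp add: quad_form_def mat_eq_def)

lemma quad_form_mid: "quad_form m (mid m) x = dot m x x"
  unfolding quad_form_eq_dot by (rule dot_cong) (simp_all add: mapply_mid)

lemma quad_form_scale: "quad_form m (\<lambda>i j. c * M i j) x = c * quad_form m M x"
  by (simp add: quad_form_def sum_distrib_left mult_ac)

lemma quad_form_diff: "quad_form m (\<lambda>i j. M i j - N i j) x = quad_form m M x - quad_form m N x"
  by (simp add: quad_form_def algebra_simps sum_subtractf)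

lemma quad_form_congruence:
  "quad_form m (mmult m (mtranspose T) (mmult m M T)) x = quad_form m M (mapply m T x)"
  by (simp add: quad_form_eq_dot mapply_mmult dot_mapply_mtranspose)

lemma mpd_iff_quad_form: "mpd m M \<longleftrightarrow> (\<forall>x. (\<exists>i<m. x i \<noteq> 0) \<longrightarrow> quad_form m M x > 0)"
  by (simp add: mpd_def quad_form_def)

lemma quad_form_pos: "mpd m M \<Longrightarrow> dot m x x > 0 \<Longrightarrow> quad_form m M x > 0"
  by (simp add: mpd_iff_quad_form dot_self_pos_iff)

lemma quad_form_nonneg: "mpd m M \<Longrightarrow> quad_form m M x \<ge> 0"
  by (cases "\<exists>i<m. x i \<noteq> 0") (auto simp: mpd_iff_quad_form quad_form_def intro: less_imp_le)

lemma mpd_cong: "M =\<^bsub>m\<^esub> N \<Longrightarrow> mpd m M \<longleftrightarrow> mpd m N"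
  using quad_form_cong[of M m N] by (simp add: mpd_iff_quad_form)

lemma spd_cong: "M =\<^bsub>m\<^esub> N \<Longrightarrow> spd m M \<longleftrightarrow> spd m N"
  unfolding spd_def using msym_cong mpd_cong by blast

lemma mdet_nonzero_if_mpd:
  assumes "mpd m M" shows "mdet m M \<noteq> 0"
proof
  assume "mdet m M = 0"
  then obtain x where x: "\<exists>i<m. x i \<noteq> 0" "\<And>i. i < m \<Longrightarrow> mapply m M x i = 0"
    by (rule exists_kernel_vector) blast
  then have "quad_form m M x = 0" by (simp add: quad_form_eq_dot dot_def)
  then show False using assms x(1) by (auto simp: mpd_iff_quad_form)
qed

lemma spd_mdet_nonzero: "spd m M \<Longrightarrow> mdet m M \<noteq> 0"
  by (simp add: spd_def mdet_nonzero_if_mpd)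

lemma spd_inverts_minv: "spd m M \<Longrightarrow> inverts m M (minv m M)"
  by (intro inverts_minv spd_mdet_nonzero)

lemma spd_msym_minv: "spd m M \<Longrightarrow> msym m (minv m M)"
  by (intro msym_minv spd_mdet_nonzero) (simp_all add: spd_def)

lemma spd_scale: "c > 0 \<Longrightarrow> spd m M \<Longrightarrow> spd m (\<lambda>i j. c * M i j)"
  by (simp add: spd_def msym_def mpd_iff_quad_form quad_form_scale)

lemma spd_mid: "spd m (mid m)"
  by (simp add: spd_def msym_def mid_sym mpd_iff_quad_form quad_form_mid dot_self_pos_iff)

lemma spd_scaled_mid: "c > 0 \<Longrightarrow> spd m (scaled_mid m c)"
  unfolding scaled_mid_def by (intro spd_scale spd_mid)

lemma spd_congruence:
  assumes "spd m M" "mdet m T \<noteq> 0"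
  shows "spd m (mmult m (mtranspose T) (mmult m M T))"
  unfolding spd_def
proof
  let ?P = "mmult m (mtranspose T) (mmult m M T)"
  have "mtranspose ?P = mmult m (mtranspose T) (mmult m (mtranspose M) T)"
    by (simp add: mtranspose_mmult mmult_assoc)
  also have "\<dots> =\<^bsub>m\<^esub> ?P"
    using assms(1) by (intro mmult_cong mat_eq_refl) (simp add: spd_def msym_iff_mtranspose)
  finally show "msym m ?P" by (simp add: msym_iff_mtranspose)
  show "mpd m ?P"
    unfolding mpd_iff_quad_form quad_form_congruence
  proof (intro allI impI)
    fix x :: "nat \<Rightarrow> real" assume x: "\<exists>i<m. x i \<noteq> 0"
    have inv: "inverts m (minv m T) T" by (rule inverts_commute[OF inverts_minv[OF assms(2)]])
    have "\<exists>i<m. mapply m T x i \<noteq> 0"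
    proof (rule ccontr)
      obtain i where i: "i < m" "x i \<noteq> 0" using x by blast
      assume "\<not> ?thesis"
      then have "mapply m (minv m T) (mapply m T x) i = 0"
        by (simp add: mapply_def[of m "minv m T"])
      then show False using mapply_inverts_cancel[OF inv i(1), of x] i(2) by simp
    qed
    then show "quad_form m M (mapply m T x) > 0"
      using assms(1) by (auto simp: spd_def mpd_iff_quad_form)
  qed
qed

lemma spd_gram:
  assumes "mdet m T \<noteq> 0" shows "spd m (mmult m (mtranspose T) T)"
proof -
  have "mmult m (mtranspose T) (mmult m (mid m) T) =\<^bsub>m\<^esub> mmult m (mtranspose T) T"
    by (intro mmult_cong mat_eq_refl mmult_mid_left)
  then show ?thesis using spd_congruence[OF spd_mid assms] spd_cong by blast
qed

lemma spd_square:
  assumes "msym m T" "mdet m T \<noteq> 0" shows "spd m (mmult m T T)"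
proof -
  have "mmult m (mtranspose T) T =\<^bsub>m\<^esub> mmult m T T"
    using assms(1) by (intro mmult_cong mat_eq_refl) (simp add: msym_iff_mtranspose)
  then show ?thesis using spd_gram[OF assms(2)] spd_cong by blast
qed

lemma quad_form_linear_combination:
  assumes "msym m M"
  shows "quad_form m M (\<lambda>i. s * x i + t * y i)
    = s\<^sup>2 * quad_form m M x + 2 * s * t * dot m x (mapply m M y) + t\<^sup>2 * quad_form m M y"
proof -
  have "quad_form m M (\<lambda>i. s * x i + t * y i) = s\<^sup>2 * quad_form m M x
      + s * t * dot m x (mapply m M y) + s * t * dot m y (mapply m M x) + t\<^sup>2 * quad_form m M y"
    unfolding quad_form_eq_dot
    by (simp add: dot_def mapply_def sum.distrib sum_distrib_left distrib_left distrib_right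
        power2_eq_square mult_ac)
  also have "dot m y (mapply m M x) = dot m x (mapply m M y)"
    using dot_mapply_msym[OF assms] by (simp add: dot_commute)
  finally show ?thesis by simp
qed

lemma spd_cauchy_schwarz:
  assumes M: "spd m M"
  shows "(dot m x (mapply m M y))\<^sup>2 \<le> quad_form m M x * quad_form m M y"
proof (cases "dot m y y > 0")
  case True
  let ?a = "quad_form m M y" and ?b = "dot m x (mapply m M y)" and ?c = "quad_form m M x"
  have a: "?a > 0" using M True by (simp add: spd_def quad_form_pos)
  have "0 \<le> quad_form m M (\<lambda>i. ?a * x i + (- ?b) * y i)"
    by (rule quad_form_nonneg) (use M in \<open>simp add: spd_def\<close>)
  also have "\<dots> = ?a\<^sup>2 * ?c + 2 * ?a * (- ?b) * ?b + (- ?b)\<^sup>2 * ?a"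
    by (rule quad_form_linear_combination) (use M in \<open>simp add: spd_def\<close>)
  finally have "0 \<le> ?a * (?c * ?a - ?b\<^sup>2)"
    by (simp add: power2_eq_square algebra_simps)
  then show ?thesis using a by (simp add: zero_le_mult_iff)
next
  case False
  then have "y i = 0" if "i < m" for i using that by (auto simp: dot_self_pos_iff)
  then show ?thesis by (simp add: dot_def mapply_def quad_form_def)
qed

lemma abs_quad_form_le: "\<bar>quad_form m M x\<bar> \<le> (\<Sum>i<m. \<Sum>j<m. \<bar>M i j\<bar>) * dot m x x"
proof -
  have "\<bar>quad_form m M x\<bar> \<le> (\<Sum>i<m. \<Sum>j<m. \<bar>x i * M i j * x j\<bar>)"
    unfolding quad_form_def by (rule order_trans[OF sum_abs]) (intro sum_mono sum_abs)
  also have "\<dots> \<le> (\<Sum>i<m. \<Sum>j<m. \<bar>M i j\<bar> * dot m x x)"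
  proof (intro sum_mono)
    fix i j assume "i \<in> {..<m}" "j \<in> {..<m}"
    then have "(x i)\<^sup>2 \<le> dot m x x" "(x j)\<^sup>2 \<le> dot m x x" by (auto intro: power2_le_dot_self)
    moreover have "2 * (\<bar>x i\<bar> * \<bar>x j\<bar>) \<le> (x i)\<^sup>2 + (x j)\<^sup>2"
      using sum_squares_bound[of "\<bar>x i\<bar>" "\<bar>x j\<bar>"] by (simp add: mult.assoc)
    ultimately have "\<bar>x i\<bar> * \<bar>x j\<bar> \<le> dot m x x" by linarith
    then show "\<bar>x i * M i j * x j\<bar> \<le> \<bar>M i j\<bar> * dot m x x"
      by (simp add: abs_mult mult.assoc mult.left_commute[of "\<bar>x i\<bar>"] mult_left_mono)
  qed
  finally show ?thesis by (simp add: sum_distrib_right)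
qed

lemma exists_quad_form_bound:
  obtains c where "c > 0" "\<And>x. \<bar>quad_form m M x\<bar> \<le> c * dot m x x"
proof
  let ?s = "\<Sum>i<m. \<Sum>j<m. \<bar>M i j\<bar>"
  have "?s \<ge> 0" by (intro sum_nonneg) simp
  then show "?s + 1 > 0" by simp
  show "\<bar>quad_form m M x\<bar> \<le> (?s + 1) * dot m x x" for x
    using abs_quad_form_le[of m M x] dot_self_nonneg[of m x] unfolding distrib_right by linarith
qed

lemma le_if_power2_le_mult: "a\<^sup>2 \<le> b * a \<Longrightarrow> 0 \<le> a \<Longrightarrow> 0 \<le> b \<Longrightarrow> a \<le> b" for a b :: real
  by (cases "a = 0") (auto simp: power2_eq_square)

lemma spd_coercive:
  assumes M: "spd m M"
  obtains \<delta> where "\<delta> > 0" "\<And>x. \<delta> * dot m x x \<le> quad_form m M x"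
proof -
  obtain c where c: "c > 0" "\<And>x. \<bar>quad_form m (minv m M) x\<bar> \<le> c * dot m x x"
    by (rule exists_quad_form_bound[of m "minv m M"]) blast
  have "dot m x x \<le> c * quad_form m M x" for x
  proof (rule le_if_power2_le_mult)
    have M_nonneg: "quad_form m M x \<ge> 0" using M by (simp add: spd_def quad_form_nonneg)
    then show "0 \<le> c * quad_form m M x" using c(1) by simp
    let ?y = "mapply m (minv m M) x"
    have My: "mapply m M ?y i = x i" if "i < m" for i
      by (rule mapply_inverts_cancel[OF spd_inverts_minv[OF M] that])
    have "(dot m x x)\<^sup>2 = (dot m x (mapply m M ?y))\<^sup>2"
      using dot_cong[of m x x "mapply m M ?y" x] My by simp
    also have "\<dots> \<le> quad_form m M x * quad_form m M ?y" by (rule spd_cauchy_schwarz[OF M])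
    also have "quad_form m M ?y = quad_form m (minv m M) x"
      unfolding quad_form_eq_dot using dot_cong[of m ?y ?y "mapply m M ?y" x] My
      by (simp add: dot_commute)
    also have "quad_form m M x * \<dots> \<le> quad_form m M x * (c * dot m x x)"
      using c(2)[of x] by (intro mult_left_mono M_nonneg) simp
    finally show "(dot m x x)\<^sup>2 \<le> c * quad_form m M x * dot m x x" by (simp add: mult_ac)
  qed simp
  then show ?thesis using that[of "1 / c"] c(1) by (simp add: field_simps)
qed

section \<open>Positive definite square roots\<close>

definition is_msqrt :: "nat \<Rightarrow> rmat \<Rightarrow> rmat \<Rightarrow> bool" where
  "is_msqrt m M R \<longleftrightarrow> spd m R \<and> mmult m R R =\<^bsub>m\<^esub> M"

lemma is_msqrt_unique:
  assumes R: "is_msqrt m M R" and S: "is_msqrt m M S"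
  shows "R =\<^bsub>m\<^esub> S"
proof -
  define D where "D = (\<lambda>i j. R i j - S i j)"
  have mpd: "mpd m R" "mpd m S" and S_sym: "\<And>j l. j < m \<Longrightarrow> l < m \<Longrightarrow> S l j = S j l"
    using R S by (auto simp: is_msqrt_def spd_def msym_def)
  \<comment> \<open>\<open>R D + D S = R\<^sup>2 - S\<^sup>2 = 0\<close>; pairing this with \<open>D\<close> gives two nonnegative numbers with sum 0.\<close>
  have RD: "mmult m R D i j = - mmult m D S i j" if "i < m" "j < m" for i j
  proof -
    have "mmult m R R i j = mmult m S S i j"
      using R S that by (simp add: is_msqrt_def mat_eq_def)
    then show ?thesis by (simp add: mmult_def D_def algebra_simps sum_subtractf)
  qed
  have "(\<Sum>j<m. quad_form m R (\<lambda>i. D i j)) = (\<Sum>j<m. \<Sum>i<m. D i j * mmult m R D i j)"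
    by (simp add: quad_form_eq_dot dot_def mapply_def mmult_def)
  also have "\<dots> = (\<Sum>j<m. \<Sum>i<m. - (D i j * mmult m D S i j))" using RD by simp
  also have "\<dots> = - (\<Sum>i<m. \<Sum>j<m. D i j * mmult m D S i j)"
    by (subst sum.swap) (simp add: sum_negf)
  also have "(\<Sum>i<m. \<Sum>j<m. D i j * mmult m D S i j) = (\<Sum>i<m. quad_form m S (\<lambda>j. D i j))"
    unfolding quad_form_eq_dot dot_def mapply_def mmult_def
    by (intro sum.cong refl) (simp add: S_sym mult.commute)
  finally have "(\<Sum>j<m. quad_form m R (\<lambda>i. D i j)) = - (\<Sum>i<m. quad_form m S (\<lambda>j. D i j))" .
  moreover have "(\<Sum>i<m. quad_form m S (\<lambda>j. D i j)) \<ge> 0" "(\<Sum>j<m. quad_form m R (\<lambda>i. D i j)) \<ge> 0"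
    by (intro sum_nonneg quad_form_nonneg mpd)+
  ultimately have "(\<Sum>j<m. quad_form m R (\<lambda>i. D i j)) = 0" by linarith
  then have "quad_form m R (\<lambda>i. D i j) = 0" if "j < m" for j
    using that by (subst (asm) sum_nonneg_eq_0_iff) (auto intro: quad_form_nonneg mpd)
  then have "D i j = 0" if "i < m" "j < m" for i j
    using mpd(1) that unfolding mpd_iff_quad_form by (metis less_irrefl)
  then show ?thesis by (simp add: D_def mat_eq_def)
qed

lemma is_msqrt_cong: "M =\<^bsub>m\<^esub> N \<Longrightarrow> R =\<^bsub>m\<^esub> S \<Longrightarrow> is_msqrt m M R \<longleftrightarrow> is_msqrt m N S"
  using spd_cong[of R m S] mmult_cong[of R m S R S] by (auto simp: is_msqrt_def mat_eq_def)

lemma is_msqrt_spd: "is_msqrt m M R \<Longrightarrow> spd m R"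
  by (simp add: is_msqrt_def)

lemma is_msqrt_square: "is_msqrt m M R \<Longrightarrow> mmult m R R =\<^bsub>m\<^esub> M"
  by (simp add: is_msqrt_def)

lemma is_msqrt_scaled_mid: "c > 0 \<Longrightarrow> is_msqrt m (scaled_mid m c) (scaled_mid m (sqrt c))"
  using mmult_scaled_mid[of m "sqrt c" "sqrt c"] by (simp add: is_msqrt_def spd_scaled_mid)

lemma msqrt_eqI:
  assumes "is_msqrt m M R" shows "msqrt m M =\<^bsub>m\<^esub> R"
proof -
  let ?R = "\<lambda>i j. if i < m \<and> j < m then R i j else 0"
  have R_eq: "?R =\<^bsub>m\<^esub> R" by (simp add: mat_eq_def)
  then have root: "is_msqrt m M ?R" using assms is_msqrt_cong[OF mat_eq_refl] by blast
  have is_msqrt_iff: "is_msqrt m M S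
      \<longleftrightarrow> msym m S \<and> mpd m S \<and> (\<forall>i<m. \<forall>j<m. mmult m S S i j = M i j)" for S
    by (auto simp: is_msqrt_def spd_def mat_eq_def)
  have "msqrt m M = ?R"
    unfolding msqrt_def is_msqrt_iff[symmetric]
  proof (rule the_equality)
    fix S assume S: "mat_on m S \<and> is_msqrt m M S"
    then have "S =\<^bsub>m\<^esub> ?R" using root by (blast intro: is_msqrt_unique)
    then show "S = ?R" using S by (auto simp: fun_eq_iff mat_eq_def mat_on_def)
  qed (use root in \<open>auto simp: mat_on_def\<close>)
  with R_eq show ?thesis by simp
qed

subsection \<open>Existence by the binomial series\<close>

fun mpow :: "nat \<Rightarrow> rmat \<Rightarrow> nat \<Rightarrow> rmat" where
  "mpow m E 0 = mid m"
| "mpow m E (Suc k) = mmult m E (mpow m E k)"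

lemma mmult_mpow: "mmult m (mpow m E s) (mpow m E t) =\<^bsub>m\<^esub> mpow m E (s + t)"
proof (induction s)
  case 0 then show ?case by (simp add: mmult_mid_left)
next
  case (Suc s) then show ?case by (simp add: mmult_assoc mmult_cong)
qed

lemma msym_mpow:
  assumes "msym m E" shows "msym m (mpow m E k)"
  unfolding msym_iff_mtranspose
proof (induction k)
  case 0 then show ?case by simp
next
  case (Suc k)
  have mpow_1: "E =\<^bsub>m\<^esub> mpow m E 1" by (simp add: mat_eq_sym[OF mmult_mid_right])
  have "mtranspose (mpow m E (Suc k)) = mmult m (mtranspose (mpow m E k)) (mtranspose E)"
    by (simp add: mtranspose_mmult)
  also have "\<dots> =\<^bsub>m\<^esub> mmult m (mpow m E k) (mpow m E 1)"
    using Suc assms by (intro mmult_cong mat_eq_trans[OF _ mpow_1]) (auto simp: msym_iff_mtranspose)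
  also have "\<dots> =\<^bsub>m\<^esub> mpow m E (Suc k)" using mmult_mpow[of m E k 1] by simp
  finally show ?case .
qed

definition binomial_term :: "nat \<Rightarrow> rmat \<Rightarrow> real \<Rightarrow> nat \<Rightarrow> rmat" where
  "binomial_term m E a k = (\<lambda>i j. (a gchoose k) * (-1) ^ k * mpow m E k i j)"

definition binomial_series :: "nat \<Rightarrow> rmat \<Rightarrow> real \<Rightarrow> rmat" where
  "binomial_series m E a = (\<lambda>i j. \<Sum>k. binomial_term m E a k i j)"

lemma msym_binomial_series: "msym m E \<Longrightarrow> msym m (binomial_series m E a)"
  using msymD[OF msym_mpow] by (simp add: msym_def binomial_series_def binomial_term_def)

lemma binomial_series_1: "binomial_series m E 1 =\<^bsub>m\<^esub> (\<lambda>i j. mid m i j - E i j)"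
proof (rule mat_eqI)
  fix i j assume ij: "i < m" "j < m"
  have "(1 gchoose k :: real) = 0" if "k \<ge> 2" for k
    using that binomial_gbinomial[of 1 k, where ?'a = real] by (simp add: binomial_eq_0)
  then have "binomial_series m E 1 i j = (\<Sum>k\<in>{0,1}. binomial_term m E 1 k i j)"
    unfolding binomial_series_def by (intro suminf_finite) (auto simp: binomial_term_def)
  then show "binomial_series m E 1 i j = mid m i j - E i j"
    using mat_eqD[OF mmult_mid_right ij] by (simp add: binomial_term_def)
qed

lemma sum_mmult_binomial_term:
  "(\<Sum>t\<le>k. mmult m (binomial_term m E a t) (binomial_term m E b (k - t)) i j)
    = binomial_term m E (a + b) k i j" if ij: "i < m" "j < m"
proof -
  have "mmult m (binomial_term m E a t) (binomial_term m E b (k - t)) i j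
      = (a gchoose t) * (b gchoose (k - t)) * ((-1) ^ k * mpow m E k i j)" if "t \<le> k" for t
  proof -
    have sign: "(-1) ^ t * (-1) ^ (k - t) = ((-1) ^ k :: real)" using that by (simp flip: power_add)
    have "mmult m (binomial_term m E a t) (binomial_term m E b (k - t)) i j
        = (a gchoose t) * (b gchoose (k - t)) * ((-1) ^ t * (-1) ^ (k - t)
          * mmult m (mpow m E t) (mpow m E (k - t)) i j)"
      by (simp add: binomial_term_def mmult_def sum_distrib_left mult_ac)
    then show ?thesis using mat_eqD[OF mmult_mpow ij] that by (simp only: sign) simp
  qed
  then have "(\<Sum>t\<le>k. mmult m (binomial_term m E a t) (binomial_term m E b (k - t)) i j)
      = (\<Sum>t\<le>k. (a gchoose t) * (b gchoose (k - t))) * ((-1) ^ k * mpow m E k i j)"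
    by (simp add: sum_distrib_right)
  then show ?thesis
    by (simp add: gbinomial_Vandermonde binomial_term_def atMost_atLeast0)
qed

context
  fixes m :: nat and E :: rmat and r :: real
  assumes E: "spd m E" and E_le: "\<And>x. quad_form m E x \<le> r * dot m x x"
    and r: "0 \<le> r" "r < 1"
begin

lemma dot_mapply_contraction: "dot m (mapply m E x) (mapply m E x) \<le> r\<^sup>2 * dot m x x"
proof (rule le_if_power2_le_mult)
  let ?y = "mapply m E x"
  have "(dot m ?y ?y)\<^sup>2 \<le> quad_form m E ?y * quad_form m E x"
    by (rule spd_cauchy_schwarz[OF E])
  also have "\<dots> \<le> (r * dot m ?y ?y) * (r * dot m x x)"
    using E by (intro mult_mono E_le quad_form_nonneg mult_nonneg_nonneg r) (auto simp: spd_def)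
  finally show "(dot m ?y ?y)\<^sup>2 \<le> r\<^sup>2 * dot m x x * dot m ?y ?y"
    by (simp add: power2_eq_square mult_ac)
qed simp_all

lemma abs_mpow_le:
  assumes ij: "i < m" "j < m" shows "\<bar>mpow m E k i j\<bar> \<le> r ^ k"
proof -
  have "dot m (\<lambda>i. mpow m E k i j) (\<lambda>i. mpow m E k i j) \<le> (r ^ k)\<^sup>2"
  proof (induction k)
    case 0
    have "dot m (\<lambda>i. mid m i j) (\<lambda>i. mid m i j) = mid m j j"
      unfolding dot_def using ij(2) by (rule sum_mult_mid)
    then show ?case using ij by (simp add: mid_def)
  next
    case (Suc k)
    have column: "(\<lambda>i. mpow m E (Suc k) i j) = mapply m E (\<lambda>i. mpow m E k i j)"
      by (simp add: mapply_def mmult_def)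
    have "dot m (\<lambda>i. mpow m E (Suc k) i j) (\<lambda>i. mpow m E (Suc k) i j)
        \<le> r\<^sup>2 * dot m (\<lambda>i. mpow m E k i j) (\<lambda>i. mpow m E k i j)"
      unfolding column by (rule dot_mapply_contraction)
    also have "\<dots> \<le> r\<^sup>2 * (r ^ k)\<^sup>2" using Suc by (intro mult_left_mono) auto
    finally show ?case by (simp add: power_mult_distrib)
  qed
  then have "(mpow m E k i j)\<^sup>2 \<le> (r ^ k)\<^sup>2"
    using power2_le_dot_self[OF ij(1), of "\<lambda>i. mpow m E k i j"] by linarith
  then show ?thesis using r by (simp add: abs_le_square_iff[symmetric])
qed

lemma summable_binomial_term:
  assumes "i < m" "j < m" shows "summable (\<lambda>k. norm (binomial_term m E a k i j))"
proof (rule summable_comparison_test)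
  have "summable (\<lambda>k. norm ((a gchoose k) * r ^ k))"
    using r by (intro abs_summable_in_conv_radius) (auto simp: conv_radius_gchoose)
  then show "summable (\<lambda>k. \<bar>a gchoose k\<bar> * r ^ k)" using r by (simp add: abs_mult power_abs)
  show "\<exists>N. \<forall>k\<ge>N. norm (norm (binomial_term m E a k i j)) \<le> \<bar>a gchoose k\<bar> * r ^ k"
    using abs_mpow_le[OF assms]
    by (auto simp: binomial_term_def abs_mult power_abs intro!: mult_left_mono)
qed

lemma mmult_binomial_series:
  "mmult m (binomial_series m E a) (binomial_series m E b) =\<^bsub>m\<^esub> binomial_series m E (a + b)"
proof (rule mat_eqI)
  fix i j assume ij: "i < m" "j < m"
  have "(\<lambda>k. \<Sum>l<m. \<Sum>t\<le>k. binomial_term m E a t i l * binomial_term m E b (k - t) l j) sums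
      mmult m (binomial_series m E a) (binomial_series m E b) i j"
    unfolding mmult_def binomial_series_def
    using ij by (intro sums_sum Cauchy_product_sums summable_binomial_term) auto
  moreover have "(\<Sum>l<m. \<Sum>t\<le>k. binomial_term m E a t i l * binomial_term m E b (k - t) l j)
      = binomial_term m E (a + b) k i j" for k
    using sum_mmult_binomial_term[OF ij, of E a b k] unfolding mmult_def by (subst sum.swap) simp
  ultimately show "mmult m (binomial_series m E a) (binomial_series m E b) i j
      = binomial_series m E (a + b) i j"
    by (simp add: binomial_series_def sums_iff)
qed

text \<open>\<open>(1 - E)\<^sup>1\<^sup>/\<^sup>2\<close> is positive definite because it is the square of \<open>(1 - E)\<^sup>1\<^sup>/\<^sup>4\<close>.\<close>

lemma is_msqrt_binomial_series:
  assumes D: "spd m (\<lambda>i j. mid m i j - E i j)"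
  shows "is_msqrt m (\<lambda>i j. mid m i j - E i j) (binomial_series m E (1 / 2))"
proof -
  let ?P = "binomial_series m E"
  have P_sym: "msym m (?P a)" for a using E by (intro msym_binomial_series) (simp add: spd_def)
  have "mdet m (?P (1 / 4)) * mdet m (?P (3 / 4)) = mdet m (?P 1)"
    unfolding mdet_mmult[symmetric] using mmult_binomial_series[of "1 / 4" "3 / 4"]
    by (intro mdet_cong) simp
  also have "\<dots> \<noteq> 0" using spd_mdet_nonzero[OF D] mdet_cong[OF binomial_series_1] by simp
  finally have det: "mdet m (?P (1 / 4)) \<noteq> 0" by auto
  have "mmult m (?P (1 / 4)) (?P (1 / 4)) =\<^bsub>m\<^esub> ?P (1 / 2)"
    using mmult_binomial_series[of "1 / 4" "1 / 4"] by simp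
  then have "spd m (?P (1 / 2))" using spd_square[OF P_sym det] spd_cong by blast
  moreover have "mmult m (?P (1 / 2)) (?P (1 / 2)) =\<^bsub>m\<^esub> (\<lambda>i j. mid m i j - E i j)"
    using mmult_binomial_series[of "1 / 2" "1 / 2"] binomial_series_1[of m E]
    by (auto intro: mat_eq_trans)
  ultimately show ?thesis by (simp add: is_msqrt_def)
qed

end

lemma spd_scaled_contraction:
  assumes M: "spd m M"
  obtains c r where "c > 0" "0 \<le> r" "r < 1" "spd m (\<lambda>i j. mid m i j - M i j / c)"
    "\<And>x. quad_form m (\<lambda>i j. mid m i j - M i j / c) x \<le> r * dot m x x"
proof -
  obtain \<delta> where \<delta>: "\<delta> > 0" "\<And>x. \<delta> * dot m x x \<le> quad_form m M x"
    by (rule spd_coercive[OF M]) blast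
  obtain b where b: "b > 0" "\<And>x. \<bar>quad_form m M x\<bar> \<le> b * dot m x x"
    by (rule exists_quad_form_bound[of m M]) blast
  define c where "c = b + \<delta>"
  have c: "c > 0" "\<delta> \<le> c" using \<delta>(1) b(1) by (auto simp: c_def)
  let ?E = "\<lambda>i j. mid m i j - M i j / c"
  have q: "quad_form m ?E x = dot m x x - quad_form m M x / c" for x
    using quad_form_diff[of m "mid m" "\<lambda>i j. 1 / c * M i j" x] quad_form_scale[of m "1 / c" M x]
    by (simp add: quad_form_mid)
  show ?thesis
  proof (rule that[of c "1 - \<delta> / c"])
    show "spd m ?E"
      unfolding spd_def
    proof
      show "msym m ?E" using M by (simp add: spd_def msym_def mid_sym)
      show "mpd m ?E"
        unfolding mpd_iff_quad_form q
      proof (intro allI impI)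
        fix x :: "nat \<Rightarrow> real" assume "\<exists>i<m. x i \<noteq> 0"
        then have "0 < \<delta> * dot m x x" using \<delta>(1) by (simp add: dot_self_pos_iff)
        then have "quad_form m M x < c * dot m x x"
          using b(2)[of x] by (simp add: c_def distrib_right)
        then show "0 < dot m x x - quad_form m M x / c" using c by (simp add: field_simps)
      qed
    qed
    show "quad_form m ?E x \<le> (1 - \<delta> / c) * dot m x x" for x
      unfolding q using \<delta>(2)[of x] c by (simp add: field_simps)
  qed (use \<delta>(1) c in auto)
qed

lemma exists_msqrt:
  assumes M: "spd m M" obtains R where "is_msqrt m M R"
proof -
  obtain c r where c: "c > 0" "0 \<le> r" "r < 1" and E: "spd m (\<lambda>i j. mid m i j - M i j / c)"
    and E_le: "\<And>x. quad_form m (\<lambda>i j. mid m i j - M i j / c) x \<le> r * dot m x x"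
    by (rule spd_scaled_contraction[OF M]) blast
  have "spd m (\<lambda>i j. M i j / c)" using spd_scale[OF _ M, of "1 / c"] c(1) by simp
  then obtain R where R: "spd m R" "mmult m R R =\<^bsub>m\<^esub> (\<lambda>i j. M i j / c)"
    using is_msqrt_binomial_series[OF E E_le c(2,3)] by (auto simp: is_msqrt_def)
  let ?S = "\<lambda>i j. sqrt c * R i j"
  have "mmult m ?S ?S i j = (sqrt c * sqrt c) * mmult m R R i j" for i j
    by (simp only: mmult_def sum_distrib_left mult_ac)
  then have "mmult m ?S ?S =\<^bsub>m\<^esub> M" using R(2) c(1) by (simp add: mat_eq_def)
  then have "is_msqrt m M ?S" using spd_scale[OF _ R(1)] c(1) by (simp add: is_msqrt_def)
  then show ?thesis by (rule that)
qed

lemma is_msqrt_msqrt: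
  assumes "spd m M" shows "is_msqrt m M (msqrt m M)"
proof -
  obtain R where "is_msqrt m M R" using exists_msqrt[OF assms] .
  then show ?thesis using msqrt_eqI is_msqrt_cong[OF mat_eq_refl] by blast
qed

lemma spd_msqrt: "spd m M \<Longrightarrow> spd m (msqrt m M)"
  by (rule is_msqrt_spd[OF is_msqrt_msqrt])

lemma mmult_minv_msqrt:
  assumes M: "spd m M" shows "mmult m (minv m (msqrt m M)) (minv m (msqrt m M)) =\<^bsub>m\<^esub> minv m M"
proof -
  let ?R = "msqrt m M"
  have "inverts m ?R (minv m ?R)" by (rule spd_inverts_minv[OF spd_msqrt[OF M]])
  then have "inverts m (mmult m ?R ?R) (mmult m (minv m ?R) (minv m ?R))"
    by (intro inverts_mmult)
  then have "inverts m M (mmult m (minv m ?R) (minv m ?R))"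
    using inverts_cong[OF is_msqrt_square[OF is_msqrt_msqrt[OF M]] mat_eq_refl] by blast
  then show ?thesis by (rule mat_eq_sym[OF minv_eqI])
qed

lemma spd_mdet_pos:
  assumes "spd m M" shows "mdet m M > 0"
proof -
  have "mdet m M = mdet m (msqrt m M) * mdet m (msqrt m M)"
    unfolding mdet_mmult[symmetric]
    using mdet_cong[OF is_msqrt_square[OF is_msqrt_msqrt[OF assms]]] by simp
  then show ?thesis using spd_mdet_nonzero[OF assms]
    by (metis not_real_square_gt_zero mult_zero_left)
qed

lemma quad_form_minv_eq_dot:
  assumes M: "spd m M"
  defines "N \<equiv> minv m (msqrt m M)"
  shows "quad_form m (minv m M) y = dot m (mapply m N y) (mapply m N y)"
proof -
  have "dot m (mapply m N y) (mapply m N y) = dot m y (mapply m (mmult m N N) y)"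
    using dot_mapply_msym[OF spd_msym_minv[OF spd_msqrt[OF M]]] by (simp add: N_def mapply_mmult)
  then show ?thesis
    using mapply_cong[OF mmult_minv_msqrt[OF M], of y y] unfolding quad_form_eq_dot N_def
    by (simp add: dot_def)
qed

lemma quad_form_minv_nonneg: "spd m M \<Longrightarrow> quad_form m (minv m M) y \<ge> 0"
  by (simp add: quad_form_minv_eq_dot)

section \<open>Coordinates arranged in consecutive blocks\<close>

lemma (in comm_monoid_set) lessThan_add:
  "F g {..<a + b} = F g {..<a} \<^bold>* F (\<lambda>i. g (a + i)) {..<b}" for a b :: nat
  by (induction b) (simp_all add: ac_simps)

definition block_offset :: "(nat \<Rightarrow> nat) \<Rightarrow> nat \<Rightarrow> nat" where
  "block_offset s k = (\<Sum>j<k. s j)"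

lemma block_offset_0 [simp]: "block_offset s 0 = 0"
  by (simp add: block_offset_def)

lemma block_offset_Suc [simp]: "block_offset s (Suc k) = block_offset s k + s k"
  by (simp add: block_offset_def)

lemma block_offset_mono: "k \<le> l \<Longrightarrow> block_offset s k \<le> block_offset s l"
  unfolding block_offset_def by (rule sum_mono2) auto

lemma block_offset_const: "block_offset (\<lambda>_. K) k = K * k"
  by (simp add: block_offset_def mult.commute)

lemma block_index_less: "k < K \<Longrightarrow> i < s k \<Longrightarrow> block_offset s k + i < block_offset s K"
  using block_offset_mono[of "Suc k" K s] by simp

lemma block_index_unique:
  assumes "i < s k" "block_offset s l \<le> block_offset s k + i"
    "block_offset s k + i < block_offset s l + s l"
  shows "l = k"
  using assms block_offset_mono[of "Suc l" k s] block_offset_mono[of "Suc k" l s]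
  by (cases l k rule: linorder_cases) auto

lemma (in comm_monoid_set) lessThan_block_offset:
  "F g {..<block_offset s K} = F (\<lambda>k. F (\<lambda>i. g (block_offset s k + i)) {..<s k}) {..<K}"
  by (induction K) (simp_all add: lessThan_add)

lemma block_index_cases:
  assumes "c < block_offset s K" obtains k i where "k < K" "i < s k" "c = block_offset s k + i"
proof -
  have "\<exists>k<K. \<exists>i<s k. c = block_offset s k + i" using assms
  proof (induction K)
    case 0 then show ?case by simp
  next
    case (Suc K)
    show ?case
    proof (cases "c < block_offset s K")
      case True then show ?thesis using Suc.IH less_SucI by blast
    next
      case False
      then have "c - block_offset s K < s K" "c = block_offset s K + (c - block_offset s K)"
        using Suc.prems by auto
      then show ?thesis by blast
    qed
  qed
  then show ?thesis using that by blast
qed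

section \<open>Vectorization and Kronecker products\<close>

lemma sum_vec_index: "sum f {..<K * K} = (\<Sum>j<K. \<Sum>i<K. f (i + K * j))"
  for f :: "nat \<Rightarrow> 'a::comm_monoid_add"
  using sum.lessThan_block_offset[of f "\<lambda>_. K" K] by (simp add: block_offset_const add.commute)

lemma vec_index_less: "i < K \<Longrightarrow> j < K \<Longrightarrow> i + K * j < K * (K::nat)"
  using block_index_less[of j K i "\<lambda>_. K"] by (simp add: block_offset_const add.commute)

lemma vec_index_cases:
  fixes p K :: nat
  assumes "p < K * K" obtains i j where "i < K" "j < K" "p = i + K * j"
proof -
  obtain j i where "j < K" "i < K" "p = block_offset (\<lambda>_. K) j + i"
    by (rule block_index_cases[of p "\<lambda>_. K" K]) (use assms in \<open>simp_all add: block_offset_const\<close>)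
  then show ?thesis using that[of i j] by (simp add: block_offset_const add.commute)
qed

lemma vec_index_eq_iff:
  fixes K :: nat
  assumes "i < K" "k < K" shows "i + K * j = k + K * l \<longleftrightarrow> i = k \<and> j = l"
proof
  assume eq: "i + K * j = k + K * l"
  then have "(i + K * j) mod K = (k + K * l) mod K" "(i + K * j) div K = (k + K * l) div K"
    by simp_all
  then show "i = k \<and> j = l" using assms by simp
qed simp

lemma vecm_index: "i < K \<Longrightarrow> j < K \<Longrightarrow> vecm K B (i + K * j) = B i j"
  by (simp add: vecm_def vec_index_less)

lemma Ed_index: "i < K \<Longrightarrow> k < K \<Longrightarrow> Ed K k (i + K * j) = (if k = i \<and> k = j then 1 else 0)"
  by (auto simp: Ed_def vec_index_eq_iff)

lemma kron_index:
  "i < K \<Longrightarrow> j < K \<Longrightarrow> k < K \<Longrightarrow> l < K \<Longrightarrow> kron K B C (i + K * j) (k + K * l) = B j l * C i k"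
  by (simp add: kron_def vec_index_less)

lemma mat_eq_vec_indexI:
  assumes "\<And>i j k l. i < K \<Longrightarrow> j < K \<Longrightarrow> k < K \<Longrightarrow> l < K \<Longrightarrow>
    M (i + K * j) (k + K * l) = N (i + K * j) (k + K * l)"
  shows "M =\<^bsub>K * K\<^esub> N"
  using assms by (intro mat_eqI) (elim vec_index_cases, blast)

lemma kron_cong: "B =\<^bsub>K\<^esub> B' \<Longrightarrow> C =\<^bsub>K\<^esub> C' \<Longrightarrow> kron K B C =\<^bsub>K * K\<^esub> kron K B' C'"
  by (rule mat_eq_vec_indexI) (simp add: kron_index mat_eq_def)

lemma mmult_kron:
  "mmult (K * K) (kron K B C) (kron K B' C') =\<^bsub>K * K\<^esub> kron K (mmult K B B') (mmult K C C')"
proof (rule mat_eq_vec_indexI)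
  fix i j k l assume idx: "i < K" "j < K" "k < K" "l < K"
  then have "mmult (K * K) (kron K B C) (kron K B' C') (i + K * j) (k + K * l)
      = (\<Sum>b<K. \<Sum>a<K. (B j b * B' b l) * (C i a * C' a k))"
    unfolding mmult_def sum_vec_index by (intro sum.cong refl) (simp add: kron_index)
  then show "mmult (K * K) (kron K B C) (kron K B' C') (i + K * j) (k + K * l)
      = kron K (mmult K B B') (mmult K C C') (i + K * j) (k + K * l)"
    using idx by (simp add: kron_index mmult_def sum_product)
qed

lemma kron_mid: "kron K (mid K) (mid K) =\<^bsub>K * K\<^esub> mid (K * K)"
  by (rule mat_eq_vec_indexI) (auto simp: kron_index mid_def vec_index_less vec_index_eq_iff)

lemma inverts_kron:
  assumes "inverts K B B'" "inverts K C C'"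
  shows "inverts (K * K) (kron K B C) (kron K B' C')"
  unfolding inverts_def
  by (rule mat_eq_trans[OF mmult_kron mat_eq_trans[OF kron_cong kron_mid]])
     (use assms in \<open>simp_all add: inverts_def\<close>)

lemma msym_kron: "msym K B \<Longrightarrow> msym K C \<Longrightarrow> msym (K * K) (kron K B C)"
  unfolding msym_iff_mtranspose
  by (rule mat_eq_vec_indexI) (simp add: mtranspose_def kron_index mat_eq_def)

lemma spd_kron:
  assumes "spd K B" "spd K C" shows "spd (K * K) (kron K B C)"
proof -
  let ?R = "msqrt K B" and ?S = "msqrt K C"
  have R: "is_msqrt K B ?R" and S: "is_msqrt K C ?S" using assms by (auto intro: is_msqrt_msqrt)
  have "mmult (K * K) (kron K ?R ?S) (kron K ?R ?S) =\<^bsub>K * K\<^esub> kron K B C"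
    by (rule mat_eq_trans[OF mmult_kron kron_cong[OF is_msqrt_square[OF R] is_msqrt_square[OF S]]])
  moreover have "spd (K * K) (mmult (K * K) (kron K ?R ?S) (kron K ?R ?S))"
  proof (rule spd_square)
    show "msym (K * K) (kron K ?R ?S)"
      using is_msqrt_spd[OF R] is_msqrt_spd[OF S] by (intro msym_kron) (auto simp: spd_def)
    show "mdet (K * K) (kron K ?R ?S) \<noteq> 0"
      by (rule mdet_nonzero_if_inverts[OF inverts_kron])
         (use R S in \<open>auto intro: spd_inverts_minv is_msqrt_spd\<close>)
  qed
  ultimately show ?thesis using spd_cong by blast
qed

lemma is_msqrt_kron:
  assumes "is_msqrt K B R" "is_msqrt K C S" shows "is_msqrt (K * K) (kron K B C) (kron K R S)"
  using assms spd_kron mat_eq_trans[OF mmult_kron kron_cong] by (simp add: is_msqrt_def)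

lemma Aot_invsqrt_eq_kron:
  assumes "spd K A"
  shows "Aot_invsqrt K A =\<^bsub>K * K\<^esub> kron K (minv K (msqrt K A)) (minv K (msqrt K A))"
  unfolding Aot_invsqrt_def
proof (rule minv_eqI)
  let ?R = "msqrt K A"
  have "msqrt (K * K) (kron K A A) =\<^bsub>K * K\<^esub> kron K ?R ?R"
    using assms by (intro msqrt_eqI is_msqrt_kron is_msqrt_msqrt)
  moreover have "inverts (K * K) (kron K ?R ?R) (kron K (minv K ?R) (minv K ?R))"
    using assms by (intro inverts_kron spd_inverts_minv spd_msqrt)
  ultimately show "inverts (K * K) (msqrt (K * K) (kron K A A)) (kron K (minv K ?R) (minv K ?R))"
    using inverts_cong[OF _ mat_eq_refl] by blast
qed

lemma Aot_inv_eq_kron: "spd K A \<Longrightarrow> Aot_inv K A =\<^bsub>K * K\<^esub> kron K (minv K A) (minv K A)"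
  unfolding Aot_inv_def by (intro minv_eqI inverts_kron spd_inverts_minv)

lemma mmult_HK:
  assumes kl: "k < K" "l < K"
  shows "mmult (K * K) M (HK K) p (k + K * l) = M p (k + K * l) + M p (l + K * k)"
proof -
  have HK_col: "HK K q (k + K * l) = mid (K * K) q (k + K * l) + mid (K * K) q (l + K * k)"
    if "q < K * K" for q
    using that kl
    by (elim vec_index_cases) (auto simp: HK_def commK_def mid_def vec_index_less vec_index_eq_iff)
  have "mmult (K * K) M (HK K) p (k + K * l)
      = (\<Sum>q<K * K. M p q * mid (K * K) q (k + K * l))
        + (\<Sum>q<K * K. M p q * mid (K * K) q (l + K * k))"
    by (simp add: mmult_def HK_col distrib_left sum.distrib)
  then show ?thesis using kl by (simp add: sum_mult_mid vec_index_less)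
qed

section \<open>Limits and derivatives of determinants and inverses\<close>

definition mat_tendsto :: "nat \<Rightarrow> ('a \<Rightarrow> rmat) \<Rightarrow> rmat \<Rightarrow> 'a filter \<Rightarrow> bool" where
  "mat_tendsto m M N F \<longleftrightarrow> (\<forall>i<m. \<forall>j<m. ((\<lambda>x. M x i j) \<longlongrightarrow> N i j) F)"

definition has_mat_derivative :: "nat \<Rightarrow> (real \<Rightarrow> rmat) \<Rightarrow> rmat \<Rightarrow> real \<Rightarrow> bool" where
  "has_mat_derivative m M M' t \<longleftrightarrow>
     (\<forall>i<m. \<forall>j<m. ((\<lambda>s. M s i j) has_real_derivative M' i j) (at t))"

lemma mat_tendstoD: "mat_tendsto m M N F \<Longrightarrow> i < m \<Longrightarrow> j < m \<Longrightarrow> ((\<lambda>x. M x i j) \<longlongrightarrow> N i j) F"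
  by (simp add: mat_tendsto_def)

lemma has_mat_derivativeD:
  "has_mat_derivative m M M' t \<Longrightarrow> i < m \<Longrightarrow> j < m \<Longrightarrow>
     ((\<lambda>s. M s i j) has_real_derivative M' i j) (at t)"
  by (simp add: has_mat_derivative_def)

lemma mat_tendsto_const: "mat_tendsto m (\<lambda>_. M) M F"
  by (simp add: mat_tendsto_def)

lemma mat_tendsto_mono: "F \<le> G \<Longrightarrow> mat_tendsto m M N G \<Longrightarrow> mat_tendsto m M N F"
  by (auto simp: mat_tendsto_def intro: tendsto_mono)

lemma mat_tendsto_mmult:
  "mat_tendsto m M N F \<Longrightarrow> mat_tendsto m M' N' F \<Longrightarrow>
     mat_tendsto m (\<lambda>x. mmult m (M x) (M' x)) (mmult m N N') F"
  unfolding mat_tendsto_def mmult_def by (intro allI impI tendsto_sum tendsto_mult) auto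

lemma tendsto_mapply:
  "mat_tendsto m M N F \<Longrightarrow> i < m \<Longrightarrow> ((\<lambda>x. mapply m (M x) y i) \<longlongrightarrow> mapply m N y i) F"
  unfolding mapply_def by (intro tendsto_sum tendsto_mult tendsto_const mat_tendstoD) auto

lemma tendsto_quad_form:
  "mat_tendsto m M N F \<Longrightarrow> ((\<lambda>x. quad_form m (M x) y) \<longlongrightarrow> quad_form m N y) F"
  unfolding quad_form_def by (intro tendsto_sum tendsto_mult tendsto_const mat_tendstoD) auto

lemma tendsto_mdet:
  assumes "mat_tendsto m M N F" shows "((\<lambda>x. mdet m (M x)) \<longlongrightarrow> mdet m N) F"
  unfolding mdet_def
proof (intro tendsto_sum tendsto_mult tendsto_const tendsto_prod)
  fix p i assume "p \<in> {p. p permutes {..<m}}" "i \<in> {..<m}"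
  then have "i < m" "p i < m" using permutes_in_image[of p "{..<m}" i] by auto
  then show "((\<lambda>x. M x i (p i)) \<longlongrightarrow> N i (p i)) F" by (rule mat_tendstoD[OF assms])
qed

lemma mat_tendsto_minv:
  assumes M: "mat_tendsto m M N F" and N: "mdet m N \<noteq> 0"
  shows "mat_tendsto m (\<lambda>x. minv m (M x)) (minv m N) F"
  unfolding mat_tendsto_def
proof (intro allI impI)
  fix i j assume ij: "i < m" "j < m"
  have det: "((\<lambda>x. mdet m (M x)) \<longlongrightarrow> mdet m N) F" by (rule tendsto_mdet[OF M])
  have "((\<lambda>x. adjugate m (M x) i j / mdet m (M x)) \<longlongrightarrow> adjugate m N i j / mdet m N) F"
    using M unfolding adjugate_def
    by (intro tendsto_divide tendsto_mult tendsto_const tendsto_mdet det N)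
       (auto simp: mat_tendsto_def)
  moreover have "eventually (\<lambda>x. adjugate m (M x) i j / mdet m (M x) = minv m (M x) i j) F"
    using tendsto_imp_eventually_ne[OF det N]
    by eventually_elim (simp add: mat_eqD[OF minv_eq_adjugate] ij)
  ultimately have "((\<lambda>x. minv m (M x) i j) \<longlongrightarrow> adjugate m N i j / mdet m N) F"
    by (rule Lim_transform_eventually)
  then show "((\<lambda>x. minv m (M x) i j) \<longlongrightarrow> minv m N i j) F"
    by (simp add: mat_eqD[OF minv_eq_adjugate] N ij)
qed

lemma eventually_mpd:
  assumes M: "mat_tendsto m M N F" and N: "spd m N"
  shows "eventually (\<lambda>x. mpd m (M x)) F"
proof -
  obtain \<delta> where \<delta>: "\<delta> > 0" "\<And>y. \<delta> * dot m y y \<le> quad_form m N y"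
    by (rule spd_coercive[OF N]) blast
  have "((\<lambda>x. \<Sum>i<m. \<Sum>j<m. \<bar>N i j - M x i j\<bar>) \<longlongrightarrow> (\<Sum>i<m. \<Sum>j<m. \<bar>N i j - N i j\<bar>)) F"
    by (intro tendsto_sum tendsto_rabs tendsto_diff tendsto_const mat_tendstoD[OF M]) auto
  then have "eventually (\<lambda>x. (\<Sum>i<m. \<Sum>j<m. \<bar>N i j - M x i j\<bar>) < \<delta>) F"
    using \<delta>(1) by (intro order_tendstoD(2)[where y = 0]) auto
  then show ?thesis
  proof eventually_elim
    case (elim x)
    show "mpd m (M x)"
      unfolding mpd_iff_quad_form
    proof (intro allI impI)
      fix y :: "nat \<Rightarrow> real" assume "\<exists>i<m. y i \<noteq> 0"
      then have "(\<Sum>i<m. \<Sum>j<m. \<bar>N i j - M x i j\<bar>) * dot m y y < \<delta> * dot m y y"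
        using elim by (intro mult_strict_right_mono) (simp_all add: dot_self_pos_iff)
      moreover have "\<bar>quad_form m N y - quad_form m (M x) y\<bar>
          \<le> (\<Sum>i<m. \<Sum>j<m. \<bar>N i j - M x i j\<bar>) * dot m y y"
        using abs_quad_form_le[of m "\<lambda>i j. N i j - M x i j" y] by (simp only: quad_form_diff)
      ultimately show "quad_form m (M x) y > 0" using \<delta>(2)[of y] by linarith
    qed
  qed
qed

lemma DERIV_tendsto_nhds: "(f has_real_derivative D) (at t) \<Longrightarrow> (f \<longlongrightarrow> f t) (nhds t)"
  using DERIV_isCont[of f D t] by (simp add: isCont_def tendsto_at_iff_tendsto_nhds)

lemma mat_tendsto_if_has_mat_derivative:
  "has_mat_derivative m M M' t \<Longrightarrow> mat_tendsto m M (M t) (nhds t)"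
  by (auto simp: mat_tendsto_def has_mat_derivative_def intro: DERIV_tendsto_nhds)

lemma prod_mid_permutation_eq_0:
  assumes p: "p permutes {..<m}" and "p \<noteq> id"
  shows "(\<Prod>j\<in>{..<m} - {i}. mid m j (p j)) = 0"
proof -
  obtain a where a: "p a \<noteq> a" using assms(2) by (auto simp: fun_eq_iff)
  have pa: "p (p a) \<noteq> p a" using a permutes_inj[OF p] by (auto dest: injD)
  have "a < m" "p a < m"
    using a pa permutes_not_in[OF p, of a] permutes_not_in[OF p, of "p a"] by blast+
  then have "a \<in> {..<m} - {i} \<or> p a \<in> {..<m} - {i}" using a by auto
  moreover have "mid m a (p a) = 0" "mid m (p a) (p (p a)) = 0" using a pa
    by (simp_all add: mid_def)
  ultimately have "\<exists>j\<in>{..<m} - {i}. mid m j (p j) = 0" by blast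
  then show ?thesis by (intro prod_zero) auto
qed

lemma DERIV_mdet_at_mid:
  assumes D: "has_mat_derivative m M M' t" and M_eq: "M t =\<^bsub>m\<^esub> mid m"
  shows "((\<lambda>s. mdet m (M s)) has_real_derivative (\<Sum>i<m. M' i i)) (at t)"
proof -
  let ?P = "{p. p permutes {..<m}}"
  let ?minor = "\<lambda>p i. \<Prod>j\<in>{..<m} - {i}. M t j (p j)"
  have image: "p i < m" if "p permutes {..<m}" "i < m" for p i
    using that permutes_in_image[of p "{..<m}" i] by auto
  have minor: "?minor p i = (if p = id then 1 else 0)" if p: "p permutes {..<m}" for p i
  proof -
    have "?minor p i = (\<Prod>j\<in>{..<m} - {i}. mid m j (p j))"
      using mat_eqD[OF M_eq] image[OF p] by (intro prod.cong) auto
    then show ?thesis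
      using prod_mid_permutation_eq_0[OF p] by (cases "p = id") (simp_all add: mid_def)
  qed
  have "((\<lambda>s. mdet m (M s)) has_real_derivative
     (\<Sum>p\<in>?P. of_int (sign p) * (\<Sum>i<m. M' i (p i) * ?minor p i))) (at t)"
    unfolding mdet_def
    by (intro DERIV_sum DERIV_cmult has_field_derivative_prod has_mat_derivativeD[OF D])
       (auto simp: image)
  also have "(\<Sum>p\<in>?P. of_int (sign p) * (\<Sum>i<m. M' i (p i) * ?minor p i))
      = (\<Sum>p\<in>?P. if p = id then \<Sum>i<m. M' i i else 0)"
  proof (intro sum.cong refl)
    fix p assume "p \<in> ?P"
    then have p: "p permutes {..<m}" by simp
    show "of_int (sign p) * (\<Sum>i<m. M' i (p i) * ?minor p i)
        = (if p = id then \<Sum>i<m. M' i i else 0)"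
      unfolding minor[OF p] by (cases "p = id") simp_all
  qed
  also have "\<dots> = (\<Sum>i<m. M' i i)"
    by (subst sum.delta) (auto simp: finite_permutations permutes_id)
  finally show ?thesis .
qed

lemma DERIV_mdet:
  assumes D: "has_mat_derivative m M M' t" and det: "mdet m (M t) \<noteq> 0"
  shows "((\<lambda>s. mdet m (M s)) has_real_derivative
     mdet m (M t) * (\<Sum>i<m. mmult m (minv m (M t)) M' i i)) (at t)"
proof -
  let ?N = "minv m (M t)"
  have inv: "inverts m ?N (M t)" by (rule inverts_commute[OF inverts_minv[OF det]])
  have "((\<lambda>s. mdet m (mmult m ?N (M s))) has_real_derivative (\<Sum>i<m. mmult m ?N M' i i)) (at t)"
  proof (rule DERIV_mdet_at_mid[where M = "\<lambda>s. mmult m ?N (M s)" and M' = "mmult m ?N M'"])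
    show "has_mat_derivative m (\<lambda>s. mmult m ?N (M s)) (mmult m ?N M') t"
      unfolding has_mat_derivative_def mmult_def
      by (intro allI impI DERIV_sum DERIV_cmult has_mat_derivativeD[OF D]) auto
    show "mmult m ?N (M t) =\<^bsub>m\<^esub> mid m" using inv by (simp add: inverts_def)
  qed
  then have "((\<lambda>s. mdet m (M t) * mdet m (mmult m ?N (M s))) has_real_derivative
      mdet m (M t) * (\<Sum>i<m. mmult m ?N M' i i)) (at t)"
    by (rule DERIV_cmult)
  moreover have "mdet m (M t) * mdet m (mmult m ?N (M s)) = mdet m (M s)" for s
    using mdet_mult_inverse[OF inv] by (simp add: mdet_mmult) (metis mult.assoc mult.commute mult_1)
  ultimately show ?thesis by simp
qed

lemma minv_diff:
  assumes M: "mdet m M \<noteq> 0" and N: "mdet m N \<noteq> 0"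
  shows "(\<lambda>i j. minv m M i j - minv m N i j) =\<^bsub>m\<^esub>
    (\<lambda>i j. - mmult m (minv m M) (mmult m (\<lambda>k l. M k l - N k l) (minv m N)) i j)"
proof (rule mat_eqI)
  fix i j assume ij: "i < m" "j < m"
  let ?P = "minv m M" and ?Q = "minv m N"
  have "mmult m ?P (mmult m M ?Q) i j = ?Q i j"
    using mat_eqD[OF mmult_inverts_cancel[OF inverts_commute[OF inverts_minv[OF M]]] ij]
    by (simp add: mmult_assoc)
  moreover have "mmult m ?P (mmult m N ?Q) i j = ?P i j"
    using mat_eqD[OF mat_eq_trans[OF
        mmult_cong[OF mat_eq_refl inverts_minv[OF N, unfolded inverts_def]]
          mmult_mid_right] ij] .
  ultimately show "?P i j - ?Q i j = - mmult m ?P (mmult m (\<lambda>k l. M k l - N k l) ?Q) i j"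
    by (simp add: mmult_def left_diff_distrib right_diff_distrib sum_subtractf)
qed

lemma has_mat_derivative_minv:
  assumes D: "has_mat_derivative m M M' t" and det: "mdet m (M t) \<noteq> 0"
  shows "has_mat_derivative m (\<lambda>s. minv m (M s))
     (\<lambda>i j. - mmult m (minv m (M t)) (mmult m M' (minv m (M t))) i j) t"
  unfolding has_mat_derivative_def
proof (intro allI impI)
  fix i j assume ij: "i < m" "j < m"
  let ?N = "minv m (M t)" and ?Q = "\<lambda>s k l. (M s k l - M t k l) / (s - t)"
  note lim = mat_tendsto_mono[OF at_within_le_nhds mat_tendsto_if_has_mat_derivative[OF D]]
  have "mat_tendsto m ?Q M' (at t)"
    using D by (simp add: mat_tendsto_def has_mat_derivative_def has_field_derivative_iff)
  then have "mat_tendsto m (\<lambda>s. mmult m (minv m (M s)) (mmult m (?Q s) ?N))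
      (mmult m ?N (mmult m M' ?N)) (at t)"
    by (intro mat_tendsto_mmult mat_tendsto_minv lim det mat_tendsto_const)
  then have "((\<lambda>s. - mmult m (minv m (M s)) (mmult m (?Q s) ?N) i j)
      \<longlongrightarrow> - mmult m ?N (mmult m M' ?N) i j) (at t)"
    using ij by (intro tendsto_minus) (rule mat_tendstoD)
  moreover have "eventually (\<lambda>s. - mmult m (minv m (M s)) (mmult m (?Q s) ?N) i j
      = (minv m (M s) i j - ?N i j) / (s - t)) (at t)"
    using tendsto_imp_eventually_ne[OF tendsto_mdet[OF lim] det]
  proof eventually_elim
    case (elim s)
    then show ?case
      using mat_eqD[OF minv_diff[OF elim det] ij] by (simp add: mmult_def flip: sum_divide_distrib)
  qed
  ultimately show "((\<lambda>s. minv m (M s) i j) has_real_derivative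
      - mmult m ?N (mmult m M' ?N) i j) (at t)"
    unfolding has_field_derivative_iff by (rule Lim_transform_eventually)
qed

lemma DERIV_quad_form_minv:
  assumes D: "has_mat_derivative m M M' t" and M: "spd m (M t)"
  shows "((\<lambda>s. quad_form m (minv m (M s)) y) has_real_derivative
     - quad_form m M' (mapply m (minv m (M t)) y)) (at t)"
proof -
  let ?N = "minv m (M t)"
  have "((\<lambda>s. quad_form m (minv m (M s)) y) has_real_derivative
      quad_form m (\<lambda>i j. - mmult m ?N (mmult m M' ?N) i j) y) (at t)"
    unfolding quad_form_def
    by (intro DERIV_sum DERIV_cmult DERIV_cmult_right
        has_mat_derivativeD[OF has_mat_derivative_minv[OF D spd_mdet_nonzero[OF M]]]) auto
  also have "quad_form m (\<lambda>i j. - mmult m ?N (mmult m M' ?N) i j) y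
      = - quad_form m (mmult m ?N (mmult m M' ?N)) y"
    using quad_form_scale[of m "-1"] by simp
  also have "quad_form m (mmult m ?N (mmult m M' ?N)) y
      = quad_form m (mmult m (mtranspose ?N) (mmult m M' ?N)) y"
    using spd_msym_minv[OF M]
    by (intro quad_form_cong mmult_cong mat_eq_refl)
       (auto simp: msym_iff_mtranspose intro: mat_eq_sym)
  also have "\<dots> = quad_form m M' (mapply m ?N y)" by (rule quad_form_congruence)
  finally show ?thesis .
qed

section \<open>The standardized t density as a function of its scale matrix\<close>

definition t_const :: "real \<Rightarrow> nat \<Rightarrow> real" where
  "t_const \<nu> m = Gamma ((\<nu> + real m) / 2) / Gamma (\<nu> / 2) * ((\<nu> - 2) * pi) powr (- real m / 2)"

lemma t_const_pos: "\<nu> > 2 \<Longrightarrow> t_const \<nu> m > 0"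
  unfolding t_const_def
  by (intro mult_pos_pos divide_pos_pos Gamma_real_pos) (auto intro: add_pos_nonneg)

lemma tstd_density_eq_quad_form:
  "tstd_density \<nu> m \<Sigma> y = t_const \<nu> m * mdet m \<Sigma> powr (- 1 / 2)
     * (1 + quad_form m (minv m \<Sigma>) y / (\<nu> - 2)) powr (- (\<nu> + real m) / 2)"
  by (simp add: tstd_density_def t_const_def quad_form_def)

lemma tstd_density_cong: "(\<And>i. i < m \<Longrightarrow> y i = y' i) \<Longrightarrow> tstd_density \<nu> m \<Sigma> y = tstd_density \<nu> m \<Sigma> y'"
  by (simp add: tstd_density_def)

lemma tstd_density_mid:
  "tstd_density \<nu> m (mid m) y
     = t_const \<nu> m * (1 + dot m y y / (\<nu> - 2)) powr (- (\<nu> + real m) / 2)"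
  using quad_form_cong[OF minv_mid, of m y y] by (simp add: tstd_density_eq_quad_form quad_form_mid)

lemma tstd_density_standardize:
  assumes "spd m \<Sigma>"
  shows "tstd_density \<nu> m \<Sigma> y
    = tstd_density \<nu> m (mid m) (mapply m (minv m (msqrt m \<Sigma>)) y) * mdet m \<Sigma> powr (- 1 / 2)"
  unfolding tstd_density_mid unfolding tstd_density_eq_quad_form quad_form_minv_eq_dot[OF assms]
  by simp

lemma one_plus_quad_form_pos: "\<nu> > 2 \<Longrightarrow> spd m \<Sigma> \<Longrightarrow> 1 + quad_form m (minv m \<Sigma>) y / (\<nu> - 2) > 0"
  by (intro add_pos_nonneg divide_nonneg_pos quad_form_minv_nonneg) auto

lemma tstd_density_pos:
  assumes "\<nu> > 2" "spd m \<Sigma>" shows "tstd_density \<nu> m \<Sigma> y > 0"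
  using t_const_pos[OF assms(1), of m] spd_mdet_pos[OF assms(2)]
    one_plus_quad_form_pos[OF assms, of y]
  by (simp add: tstd_density_eq_quad_form)

lemma ln_tstd_density:
  assumes "\<nu> > 2" "mdet m \<Sigma> > 0" "1 + quad_form m (minv m \<Sigma>) y / (\<nu> - 2) > 0"
  shows "ln (tstd_density \<nu> m \<Sigma> y) = ln (t_const \<nu> m) - 1 / 2 * ln (mdet m \<Sigma>)
    - (\<nu> + real m) / 2 * ln (1 + quad_form m (minv m \<Sigma>) y / (\<nu> - 2))"
  using assms t_const_pos[OF assms(1), of m]
  by (simp add: tstd_density_eq_quad_form ln_mult_pos ln_powr) (simp add: algebra_simps)

definition t_score :: "real \<Rightarrow> nat \<Rightarrow> rmat \<Rightarrow> (nat \<Rightarrow> real) \<Rightarrow> rmat" where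
  "t_score \<nu> m \<Sigma> y = (\<lambda>i j. 1 / 2 * ((\<nu> + real m) / (\<nu> - 2 + quad_form m (minv m \<Sigma>) y)
     * (mapply m (minv m \<Sigma>) y i * mapply m (minv m \<Sigma>) y j) - minv m \<Sigma> i j))"

lemma msym_t_score: "spd m \<Sigma> \<Longrightarrow> msym m (t_score \<nu> m \<Sigma> y)"
  using msymD[OF spd_msym_minv] by (simp add: msym_def t_score_def mult.commute)

lemma sum_t_score_mult:
  assumes "spd m \<Sigma>"
  shows "(\<Sum>i<m. \<Sum>j<m. t_score \<nu> m \<Sigma> y i j * H i j)
    = (\<nu> + real m) / 2
        * (quad_form m H (mapply m (minv m \<Sigma>) y) / (\<nu> - 2 + quad_form m (minv m \<Sigma>) y))
      - 1 / 2 * (\<Sum>i<m. mmult m (minv m \<Sigma>) H i i)"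
proof -
  have trace: "(\<Sum>i<m. mmult m (minv m \<Sigma>) H i i) = (\<Sum>i<m. \<Sum>j<m. minv m \<Sigma> i j * H i j)"
    unfolding mmult_def
    by (subst sum.swap, intro sum.cong refl) (simp add: msymD[OF spd_msym_minv[OF assms]])
  have linear: "(\<Sum>i<m. \<Sum>j<m. 1 / 2 * (w * (u i * u j) - N i j) * H i j)
      = w / 2 * quad_form m H u - 1 / 2 * (\<Sum>i<m. \<Sum>j<m. N i j * H i j)" for w u N
    by (simp add: quad_form_def sum_distrib_left left_diff_distrib right_diff_distrib
        sum_subtractf mult_ac)
  show ?thesis unfolding t_score_def linear trace by simp
qed

lemma DERIV_ln_tstd_density:
  assumes \<nu>: "\<nu> > 2" and D: "has_mat_derivative m M M' t" and M: "spd m (M t)"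
  shows "((\<lambda>s. ln (tstd_density \<nu> m (M s) y)) has_real_derivative
     (\<Sum>i<m. \<Sum>j<m. t_score \<nu> m (M t) y i j * M' i j)) (at t)"
proof -
  define q where "q s = quad_form m (minv m (M s)) y" for s
  define h where "h = quad_form m M' (mapply m (minv m (M t)) y)"
  define tr where "tr = (\<Sum>i<m. mmult m (minv m (M t)) M' i i)"
  have det_pos: "mdet m (M t) > 0" by (rule spd_mdet_pos[OF M])
  have q_pos: "1 + q t / (\<nu> - 2) > 0" unfolding q_def by (rule one_plus_quad_form_pos[OF \<nu> M])
  have q_deriv: "(q has_real_derivative - h) (at t)"
    unfolding q_def h_def by (rule DERIV_quad_form_minv[OF D M])
  have det_deriv: "((\<lambda>s. mdet m (M s)) has_real_derivative mdet m (M t) * tr) (at t)"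
    unfolding tr_def by (rule DERIV_mdet[OF D spd_mdet_nonzero[OF M]])
  have quot_deriv: "((\<lambda>s. 1 + q s / (\<nu> - 2)) has_real_derivative 0 + - h / (\<nu> - 2)) (at t)"
    by (intro DERIV_add DERIV_const DERIV_cdivide q_deriv)
  have "((\<lambda>s. ln (mdet m (M s))) has_real_derivative tr) (at t)"
    by (rule DERIV_cong[OF DERIV_chain2[OF DERIV_ln[OF det_pos] det_deriv]]) (use det_pos in simp)
  moreover have "((\<lambda>s. ln (1 + q s / (\<nu> - 2))) has_real_derivative - (h / (\<nu> - 2 + q t))) (at t)"
    by (rule DERIV_cong[OF DERIV_chain2[OF DERIV_ln[OF q_pos] quot_deriv]])
       (use q_pos \<nu> in \<open>simp add: divide_simps\<close>)
  ultimately have "((\<lambda>s. ln (t_const \<nu> m) - 1 / 2 * ln (mdet m (M s))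
      - (\<nu> + real m) / 2 * ln (1 + q s / (\<nu> - 2))) has_real_derivative
      0 - 1 / 2 * tr - (\<nu> + real m) / 2 * - (h / (\<nu> - 2 + q t))) (at t)"
    by (intro DERIV_diff DERIV_cmult DERIV_const)
  also have "0 - 1 / 2 * tr - (\<nu> + real m) / 2 * - (h / (\<nu> - 2 + q t))
      = (\<Sum>i<m. \<Sum>j<m. t_score \<nu> m (M t) y i j * M' i j)"
    unfolding sum_t_score_mult[OF M] by (simp add: tr_def h_def q_def)
  finally have formula_deriv: "((\<lambda>s. ln (t_const \<nu> m) - 1 / 2 * ln (mdet m (M s))
      - (\<nu> + real m) / 2 * ln (1 + q s / (\<nu> - 2))) has_real_derivative
      (\<Sum>i<m. \<Sum>j<m. t_score \<nu> m (M t) y i j * M' i j)) (at t)" .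
  have "eventually (\<lambda>s. mdet m (M s) > 0 \<and> 1 + q s / (\<nu> - 2) > 0) (nhds t)"
    by (intro eventually_conj order_tendstoD(1)[OF DERIV_tendsto_nhds[OF det_deriv] det_pos]
        order_tendstoD(1)[OF DERIV_tendsto_nhds[OF quot_deriv] q_pos])
  then have "eventually
      (\<lambda>s. ln (tstd_density \<nu> m (M s) y) = ln (t_const \<nu> m) - 1 / 2 * ln (mdet m (M s))
      - (\<nu> + real m) / 2 * ln (1 + q s / (\<nu> - 2))) (nhds t)"
    by eventually_elim (use \<nu> in \<open>simp add: ln_tstd_density q_def\<close>)
  then show ?thesis using formula_deriv by (subst DERIV_cong_ev[OF refl _ refl])
qed

lemma mat_tendsto_t_score:
  assumes \<nu>: "\<nu> > 2" and M: "mat_tendsto m M \<Sigma> F" and \<Sigma>: "spd m \<Sigma>"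
  shows "mat_tendsto m (\<lambda>x. t_score \<nu> m (M x) y) (t_score \<nu> m \<Sigma> y) F"
proof -
  note N = mat_tendsto_minv[OF M spd_mdet_nonzero[OF \<Sigma>]]
  have "\<nu> - 2 + quad_form m (minv m \<Sigma>) y \<noteq> 0"
    using \<nu> quad_form_minv_nonneg[OF \<Sigma>, of y] by linarith
  then show ?thesis
    unfolding mat_tendsto_def t_score_def
    by (intro allI impI tendsto_mult tendsto_diff tendsto_divide tendsto_add tendsto_const
        tendsto_quad_form[OF N] tendsto_mapply[OF N] mat_tendstoD[OF N])
qed

lemma t_score_standardized:
  fixes y :: "nat \<Rightarrow> real"
  assumes \<Sigma>: "spd m \<Sigma>" and ij: "i < m" "j < m"
  defines "N \<equiv> minv m (msqrt m \<Sigma>)" and "x \<equiv> mapply m (minv m (msqrt m \<Sigma>)) y"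
  shows "t_score \<nu> m \<Sigma> y i j = 1 / 2 * (\<Sum>a<m. \<Sum>b<m. N i a * N j b *
     ((\<nu> + real m) / (\<nu> - 2 + dot m x x) * (x a * x b) - mid m a b))"
proof -
  define w where "w = (\<nu> + real m) / (\<nu> - 2 + dot m x x)"
  have minv_square: "mmult m N N =\<^bsub>m\<^esub> minv m \<Sigma>" unfolding N_def by (rule mmult_minv_msqrt[OF \<Sigma>])
  have Nx: "mapply m N x i = mapply m (minv m \<Sigma>) y i" if "i < m" for i
    unfolding x_def N_def[symmetric] mapply_mmult[symmetric] by (rule mapply_cong[OF minv_square refl that])
  have q: "quad_form m (minv m \<Sigma>) y = dot m x x"
    unfolding x_def by (rule quad_form_minv_eq_dot[OF \<Sigma>])
  have "(\<Sum>a<m. \<Sum>b<m. N i a * N j b * (w * (x a * x b) - mid m a b))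
      = (\<Sum>a<m. \<Sum>b<m. w * ((N i a * x a) * (N j b * x b)))
        - (\<Sum>a<m. N i a * (\<Sum>b<m. mid m a b * N j b))"
    by (simp add: sum_distrib_left right_diff_distrib sum_subtractf mult_ac)
  also have "(\<Sum>a<m. \<Sum>b<m. w * ((N i a * x a) * (N j b * x b)))
      = w * (mapply m N x i * mapply m N x j)"
    unfolding mapply_def sum_product by (simp only: sum_distrib_left)
  also have "(\<Sum>a<m. N i a * (\<Sum>b<m. mid m a b * N j b)) = mmult m N N i j"
    unfolding mmult_def
    by (intro sum.cong refl)
       (simp add: sum_mid_mult ij N_def msymD[OF spd_msym_minv[OF spd_msqrt[OF \<Sigma>]]])
  also have "mmult m N N i j = minv m \<Sigma> i j" by (rule mat_eqD[OF minv_square ij])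
  finally show ?thesis unfolding t_score_def q w_def[symmetric] using ij by (simp add: Nx)
qed

lemma sum_diag_t_score_scaled_mid:
  assumes "c > 0"
  shows "(\<Sum>i<m. t_score \<nu> m (scaled_mid m c) y i i)
    = 1 / 2 * ((\<nu> + real m) / (\<nu> - 2 + dot m y y / c) * (dot m y y / c) - real m) / c"
proof -
  let ?N = "minv m (scaled_mid m c)"
  have N: "?N =\<^bsub>m\<^esub> scaled_mid m (1 / c)" using assms by (intro minv_scaled_mid) simp
  have Ny: "mapply m ?N y i = y i / c" if "i < m" for i
    using mapply_cong[OF N refl that] that by (simp add: mapply_scaled_mid)
  have q: "quad_form m ?N y = dot m y y / c"
    unfolding quad_form_eq_dot by (simp add: dot_def Ny sum_divide_distrib)
  have "t_score \<nu> m (scaled_mid m c) y i i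
      = 1 / 2 * ((\<nu> + real m) / (\<nu> - 2 + dot m y y / c) * (y i * y i / c) - 1) / c" if "i < m" for i
  proof -
    have "?N i i = 1 / c" using mat_eqD[OF N that that] that by (simp add: scaled_mid_def mid_def)
    moreover have "1 / 2 * (w * (a / c * (a / c)) - 1 / c) = 1 / 2 * (w * (a * a / c) - 1) / c"
      for w a
      by (simp add: diff_divide_distrib)
    ultimately show ?thesis using that by (simp only: t_score_def q Ny)
  qed
  then show ?thesis
    by (simp add: dot_def sum_subtractf flip: sum_divide_distrib sum_distrib_left)
qed

section \<open>Gradients along symmetric matrices\<close>

lemma fro_nonneg: "fro K M \<ge> 0"
  by (auto simp: fro_def intro!: sum_nonneg)

lemma abs_entry_le_fro:
  assumes "i < K" "j < K" shows "\<bar>M i j\<bar> \<le> fro K M"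
proof -
  have "(M i j)\<^sup>2 \<le> (\<Sum>j<K. (M i j)\<^sup>2)"
    using assms by (intro member_le_sum[of j "{..<K}" "\<lambda>j. (M i j)\<^sup>2"]) auto
  also have "\<dots> \<le> (\<Sum>i<K. \<Sum>j<K. (M i j)\<^sup>2)"
    using assms by (intro member_le_sum[of i "{..<K}" "\<lambda>i. \<Sum>j<K. (M i j)\<^sup>2"] sum_nonneg) auto
  finally show ?thesis unfolding fro_def by (metis real_sqrt_abs real_sqrt_le_iff)
qed

lemma fro_scale: "fro K (\<lambda>i j. t * M i j) = \<bar>t\<bar> * fro K M"
  by (simp add: fro_def power_mult_distrib real_sqrt_mult flip: sum_distrib_left)

lemma abs_sum_vecm_diff_le:
  assumes c: "\<And>p. p < K * K \<Longrightarrow> \<bar>c p\<bar> \<le> e" and e: "e \<ge> 0"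
  shows "\<bar>\<Sum>p<K * K. c p * (vecm K B p - vecm K A p)\<bar>
    \<le> real (K * K) * e * fro K (\<lambda>i j. B i j - A i j)"
proof -
  have entry: "\<bar>vecm K B p - vecm K A p\<bar> \<le> fro K (\<lambda>i j. B i j - A i j)" if p: "p < K * K" for p
  proof -
    obtain i j where "i < K" "j < K" "p = i + K * j" by (rule vec_index_cases[OF p])
    then show ?thesis using abs_entry_le_fro[of i K j "\<lambda>i j. B i j - A i j"]
      by (simp add: vecm_index)
  qed
  have "\<bar>\<Sum>p<K * K. c p * (vecm K B p - vecm K A p)\<bar>
      \<le> (\<Sum>p<K * K. \<bar>c p * (vecm K B p - vecm K A p)\<bar>)"
    by (rule sum_abs)
  also have "\<dots> \<le> (\<Sum>p<K * K. e * fro K (\<lambda>i j. B i j - A i j))"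
    unfolding abs_mult using c e entry by (intro sum_mono mult_mono) auto
  finally show ?thesis by simp
qed

definition sym_nhds :: "nat \<Rightarrow> rmat \<Rightarrow> rmat filter" where
  "sym_nhds K A = (INF d\<in>{0<..}. principal {B. msym K B \<and> fro K (\<lambda>i j. B i j - A i j) < d})"

lemma eventually_sym_nhds:
  "eventually P (sym_nhds K A) \<longleftrightarrow>
     (\<exists>d>0. \<forall>B. msym K B \<and> fro K (\<lambda>i j. B i j - A i j) < d \<longrightarrow> P B)"
  unfolding sym_nhds_def
proof (subst eventually_INF_base)
  fix a b :: real assume "a \<in> {0<..}" "b \<in> {0<..}"
  then show "\<exists>x\<in>{0<..}. principal {B. msym K B \<and> fro K (\<lambda>i j. B i j - A i j) < x}
     \<le> inf (principal {B. msym K B \<and> fro K (\<lambda>i j. B i j - A i j) < a})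
        (principal {B. msym K B \<and> fro K (\<lambda>i j. B i j - A i j) < b})"
    by (intro bexI[of _ "min a b"]) auto
qed (auto simp: eventually_principal)

lemma eventually_msym_sym_nhds: "eventually (msym K) (sym_nhds K A)"
  unfolding eventually_sym_nhds by (intro exI[of _ 1]) auto

lemma mat_tendsto_sym_nhds: "mat_tendsto K (\<lambda>B. B) A (sym_nhds K A)"
  unfolding mat_tendsto_def
proof (intro allI impI tendstoI)
  fix i j and e :: real assume "i < K" "j < K" "e > 0"
  then show "eventually (\<lambda>B. dist (B i j) (A i j) < e) (sym_nhds K A)"
    unfolding eventually_sym_nhds dist_real_def
    using abs_entry_le_fro[of i K j "\<lambda>i j. _ i j - A i j"] by (meson order.strict_trans1)
qed

definition mat_segment :: "rmat \<Rightarrow> rmat \<Rightarrow> real \<Rightarrow> rmat" where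
  "mat_segment A B t = (\<lambda>i j. A i j + t * (B i j - A i j))"

lemma mat_segment_0 [simp]: "mat_segment A B 0 = A"
  and mat_segment_1 [simp]: "mat_segment A B 1 = B"
  by (simp_all add: mat_segment_def)

lemma msym_mat_segment: "msym m A \<Longrightarrow> msym m B \<Longrightarrow> msym m (mat_segment A B t)"
  by (simp add: msym_def mat_segment_def)

lemma has_mat_derivative_mat_segment:
  "has_mat_derivative m (mat_segment A B) (\<lambda>i j. B i j - A i j) t"
  unfolding has_mat_derivative_def mat_segment_def by (auto intro!: derivative_eq_intros)

lemma fro_mat_segment_diff_le:
  assumes "0 \<le> t" "t \<le> 1"
  shows "fro K (\<lambda>i j. mat_segment A B t i j - A i j) \<le> fro K (\<lambda>i j. B i j - A i j)"
proof -
  have "fro K (\<lambda>i j. mat_segment A B t i j - A i j) = t * fro K (\<lambda>i j. B i j - A i j)"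
    using fro_scale[of K t "\<lambda>i j. B i j - A i j"] assms by (simp add: mat_segment_def)
  also have "\<dots> \<le> 1 * fro K (\<lambda>i j. B i j - A i j)" using assms by (intro mult_right_mono fro_nonneg)
  finally show ?thesis by simp
qed

lemma has_sym_gradI:
  assumes A: "msym K A" and P: "eventually P (sym_nhds K A)"
    and deriv: "\<And>B t. msym K B \<Longrightarrow> P (mat_segment A B t) \<Longrightarrow>
        ((\<lambda>s. f (mat_segment A B s)) has_real_derivative
          (\<Sum>p<K * K. g (mat_segment A B t) p * (vecm K B p - vecm K A p))) (at t)"
    and cont: "\<And>p. p < K * K \<Longrightarrow> ((\<lambda>B. g B p) \<longlongrightarrow> g A p) (sym_nhds K A)"
  shows "has_sym_grad K f A (g A)"
  unfolding has_sym_grad_def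
proof (intro allI impI)
  fix e :: real assume e: "e > 0"
  define e' where "e' = e / (real (K * K) + 1)"
  have e': "e' > 0" "real (K * K) * e' \<le> e"
    using e by (simp_all add: e'_def divide_simps add_nonneg_pos del: of_nat_mult)
  have "eventually (\<lambda>B. \<forall>p\<in>{..<K * K}. \<bar>g B p - g A p\<bar> < e') (sym_nhds K A)"
    using tendstoD[OF cont e'(1)] by (intro eventually_ball_finite) (auto simp: dist_real_def)
  with P have "eventually (\<lambda>B. P B \<and> (\<forall>p\<in>{..<K * K}. \<bar>g B p - g A p\<bar> < e')) (sym_nhds K A)"
    by (rule eventually_conj)
  then obtain d where d: "d > 0" "\<And>B. msym K B \<Longrightarrow> fro K (\<lambda>i j. B i j - A i j) < d \<Longrightarrow>
      P B \<and> (\<forall>p\<in>{..<K * K}. \<bar>g B p - g A p\<bar> < e')"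
    unfolding eventually_sym_nhds by blast
  show "\<exists>d>0. \<forall>B. msym K B \<and> fro K (\<lambda>i j. B i j - A i j) < d \<longrightarrow>
        \<bar>f B - f A - (\<Sum>p<K * K. g A p * (vecm K B p - vecm K A p))\<bar>
          \<le> e * fro K (\<lambda>i j. B i j - A i j)"
  proof (intro exI[of _ d] conjI allI impI d(1))
    fix B assume B: "msym K B \<and> fro K (\<lambda>i j. B i j - A i j) < d"
    let ?A = "mat_segment A B" and ?h = "\<lambda>p. vecm K B p - vecm K A p"
    have near: "P (?A t) \<and> (\<forall>p\<in>{..<K * K}. \<bar>g (?A t) p - g A p\<bar> < e')" if "0 \<le> t" "t \<le> 1" for t
      using B fro_mat_segment_diff_le[OF that, of K A B]
      by (intro d(2) msym_mat_segment A) auto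
    obtain t where t: "0 < t" "t < 1"
        "f (?A 1) - f (?A 0) = (1 - 0) * (\<Sum>p<K * K. g (?A t) p * ?h p)"
      using MVT2[of 0 1 "\<lambda>t. f (?A t)" "\<lambda>t. \<Sum>p<K * K. g (?A t) p * ?h p"] deriv near B by auto
    have "\<bar>f B - f A - (\<Sum>p<K * K. g A p * ?h p)\<bar> = \<bar>\<Sum>p<K * K. (g (?A t) p - g A p) * ?h p\<bar>"
      using t(3) by (simp add: sum_subtractf left_diff_distrib)
    also have "\<dots> \<le> real (K * K) * e' * fro K (\<lambda>i j. B i j - A i j)"
      using near[of t] t(1,2) e'(1) by (intro abs_sum_vecm_diff_le) (auto simp: less_imp_le)
    also have "\<dots> \<le> e * fro K (\<lambda>i j. B i j - A i j)" by (intro mult_right_mono e' fro_nonneg)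
    finally show "\<bar>f B - f A - (\<Sum>p<K * K. g A p * ?h p)\<bar> \<le> e * fro K (\<lambda>i j. B i j - A i j)" .
  qed
qed

section \<open>Gaussian moments\<close>

definition gauss_moment :: "nat \<Rightarrow> real" where
  "gauss_moment k = (if even k then fact k / (2 ^ k * fact (k div 2)) else 0)"

lemma gauss_moment_values:
  "gauss_moment 0 = 1" "gauss_moment (Suc 0) = 0" "gauss_moment 2 = 1 / 2"
  "gauss_moment 3 = 0" "gauss_moment 4 = 3 / 4"
  by (simp_all add: gauss_moment_def fact_numeral)

lemma has_bochner_integral_gauss_moment:
  "has_bochner_integral lborel (\<lambda>x. exp (- x\<^sup>2) * x ^ k) (sqrt pi * gauss_moment k)"
proof (cases "even k")
  case True
  then obtain i where k: "k = 2 * i" by (elim evenE)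
  have "has_bochner_integral lborel (\<lambda>x::real. exp (- x\<^sup>2) * x ^ (2 * i))
      (2 *\<^sub>R ((sqrt pi / 2) * (fact (2 * i) / (2 ^ (2 * i) * fact i))))"
    by (rule has_bochner_integral_even_function[OF gaussian_moment_even_pos]) simp
  then show ?thesis by (simp add: gauss_moment_def k)
next
  case False
  then obtain i where k: "k = 2 * i + 1" by (elim oddE)
  have "has_bochner_integral lborel (\<lambda>x::real. exp (- x\<^sup>2) * x ^ (2 * i + 1)) 0"
    by (rule has_bochner_integral_odd_function[OF gaussian_moment_odd_pos]) simp
  then show ?thesis by (simp add: gauss_moment_def k)
qed

lemma gaussian_integral_scale:
  assumes g: "has_bochner_integral lborel (\<lambda>x. exp (- x\<^sup>2) * g x) c"
    and homogeneous: "\<And>t x. t > 0 \<Longrightarrow> g (t * x) = t ^ k * g x" and s: "s > 0"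
  shows "has_bochner_integral lborel (\<lambda>x. exp (- s * x\<^sup>2) * g x) (c * s powr (- (1 + real k) / 2))"
proof -
  let ?r = "sqrt s"
  have r: "?r > 0" "?r\<^sup>2 = s" using s by simp_all
  have "has_bochner_integral lborel (\<lambda>x. exp (- (0 + ?r * x)\<^sup>2) * g (0 + ?r * x)) (c /\<^sub>R \<bar>?r\<bar>)"
    using g lborel_has_bochner_integral_real_affine_iff[of ?r "\<lambda>x. exp (- x\<^sup>2) * g x" c 0] r by simp
  then have "has_bochner_integral lborel
      (\<lambda>x. (1 / ?r ^ k) * (exp (- (0 + ?r * x)\<^sup>2) * g (0 + ?r * x)))
      ((1 / ?r ^ k) * (c /\<^sub>R \<bar>?r\<bar>))"
    by (rule has_bochner_integral_mult_right)
  moreover have "(1 / ?r ^ k) * (exp (- (0 + ?r * x)\<^sup>2) * g (0 + ?r * x)) = exp (- s * x\<^sup>2) * g x"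
    for x
    using r by (simp add: homogeneous power_mult_distrib)
  moreover have "(1 / ?r ^ k) * (c /\<^sub>R \<bar>?r\<bar>) = c * s powr (- (1 + real k) / 2)"
  proof -
    have root_power: "?r ^ Suc k = s powr ((1 + real k) / 2)"
      unfolding powr_half_sqrt[OF less_imp_le[OF s], symmetric] using s
      by (subst powr_power) (simp_all add: add_divide_distrib)
    have "s powr (- (1 + real k) / 2) = 1 / ?r ^ Suc k"
      unfolding root_power minus_divide_left[symmetric] by (rule powr_minus_divide)
    then show ?thesis using r(1) by (simp add: divide_simps mult.commute[of ?r])
  qed
  ultimately show ?thesis by simp
qed

lemma (in product_sigma_finite) has_bochner_integral_prod:
  fixes f :: "'i \<Rightarrow> 'a \<Rightarrow> real"
  assumes I: "finite I" and f: "\<And>i. i \<in> I \<Longrightarrow> has_bochner_integral (M i) (f i) (c i)"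
  shows "has_bochner_integral (Pi\<^sub>M I M) (\<lambda>x. \<Prod>i\<in>I. f i (x i)) (\<Prod>i\<in>I. c i)"
proof -
  have int: "integrable (M i) (f i)" if "i \<in> I" for i using f[OF that] by (rule integrable.intros)
  have "(\<Prod>i\<in>I. integral\<^sup>L (M i) (f i)) = (\<Prod>i\<in>I. c i)"
    using f by (intro prod.cong refl has_bochner_integral_integral_eq)
  then show ?thesis
    using product_integrable_prod[OF I int] product_integral_prod[OF I int]
    by (simp add: has_bochner_integral_iff)
qed

interpretation lborel_prod: product_sigma_finite "\<lambda>_::nat. lborel :: real measure"
  by standard

abbreviation lborel_on :: "nat set \<Rightarrow> (nat \<Rightarrow> real) measure" where
  "lborel_on J \<equiv> Pi\<^sub>M J (\<lambda>_. lborel)"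

lemma has_bochner_integral_gaussian_prod:
  assumes J: "finite J" and s: "s > 0"
    and g: "\<And>j. j \<in> J \<Longrightarrow> has_bochner_integral lborel (\<lambda>x. exp (- x\<^sup>2) * g j x) (c j)"
    and homogeneous: "\<And>j t x. j \<in> J \<Longrightarrow> t > 0 \<Longrightarrow> g j (t * x) = t ^ \<alpha> j * g j x"
  shows "has_bochner_integral (lborel_on J)
     (\<lambda>v. exp (- s * (\<Sum>j\<in>J. (v j)\<^sup>2)) * (\<Prod>j\<in>J. g j (v j)))
     ((\<Prod>j\<in>J. c j) * s powr (- real (card J + (\<Sum>j\<in>J. \<alpha> j)) / 2))"
proof -
  have "has_bochner_integral (lborel_on J) (\<lambda>v. \<Prod>j\<in>J. exp (- s * (v j)\<^sup>2) * g j (v j))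
      (\<Prod>j\<in>J. c j * s powr (- (1 + real (\<alpha> j)) / 2))"
    using g homogeneous s
    by (intro lborel_prod.has_bochner_integral_prod gaussian_integral_scale J) auto
  moreover have "(\<Prod>j\<in>J. exp (- s * (v j)\<^sup>2) * g j (v j))
      = exp (- s * (\<Sum>j\<in>J. (v j)\<^sup>2)) * (\<Prod>j\<in>J. g j (v j))" for v
    using J by (simp add: prod.distrib exp_sum[symmetric] sum_distrib_left sum_negf)
  moreover have "(\<Sum>j\<in>J. - (1 + real (\<alpha> j)) / 2) = - real (card J + (\<Sum>j\<in>J. \<alpha> j)) / 2"
    by (simp add: sum_subtractf add_divide_distrib diff_divide_distrib sum_negf
        flip: sum_divide_distrib)
  then have "(\<Prod>j\<in>J. c j * s powr (- (1 + real (\<alpha> j)) / 2))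
      = (\<Prod>j\<in>J. c j) * s powr (- real (card J + (\<Sum>j\<in>J. \<alpha> j)) / 2)"
    using s J by (simp only: prod.distrib powr_sum[symmetric])
  ultimately show ?thesis by simp
qed

section \<open>Gamma mixtures\<close>

definition gamma_kernel :: "real \<Rightarrow> real \<Rightarrow> real \<Rightarrow> real" where
  "gamma_kernel p b s = indicator {0<..} s * s powr (p - 1) * exp (- s * b)"

lemma gamma_kernel_nonneg [simp]: "gamma_kernel p b s \<ge> 0"
  by (simp add: gamma_kernel_def)

lemma gamma_kernel_nonpos [simp]: "s \<le> 0 \<Longrightarrow> gamma_kernel p b s = 0"
  by (simp add: gamma_kernel_def)

lemma borel_measurable_gamma_kernel [measurable]: "gamma_kernel p b \<in> borel_measurable borel"
  unfolding gamma_kernel_def by measurable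

lemma gamma_kernel_mult_exp: "gamma_kernel p b s * exp (- s * q) = gamma_kernel p (b + q) s"
  by (simp add: gamma_kernel_def algebra_simps flip: exp_add)

lemma gamma_kernel_mult_powr: "s > 0 \<Longrightarrow> gamma_kernel p b s * s powr - \<kappa> = gamma_kernel (p - \<kappa>) b s"
  by (simp add: gamma_kernel_def algebra_simps flip: powr_add)

lemma has_bochner_integral_gamma_kernel:
  assumes p: "p > 0" and b: "b > 0"
  shows "has_bochner_integral lborel (gamma_kernel p b) (Gamma p / b powr p)"
proof -
  let ?f = "\<lambda>t::real. indicator {0..} t * t powr (p - 1) / exp t"
  have "has_bochner_integral lborel ?f (Gamma p)"
  proof (rule has_bochner_integral_nn_integral)
    show "(\<integral>\<^sup>+t. ennreal (?f t) \<partial>lborel) = ennreal (Gamma p)"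
      by (rule Gamma_conv_nn_integral_real[OF p, symmetric])
  qed (use Gamma_real_pos[OF p] in \<open>auto simp: less_imp_le\<close>)
  then have "has_bochner_integral lborel (\<lambda>s. ?f (0 + b * s)) (Gamma p /\<^sub>R \<bar>b\<bar>)"
    using lborel_has_bochner_integral_real_affine_iff[of b ?f "Gamma p" 0] b by simp
  then have "has_bochner_integral lborel (\<lambda>s. b powr (1 - p) * ?f (0 + b * s))
      (b powr (1 - p) * (Gamma p /\<^sub>R \<bar>b\<bar>))"
    by (rule has_bochner_integral_mult_right)
  moreover have "b powr (1 - p) * ?f (0 + b * s) = gamma_kernel p b s" for s
  proof (cases "s > 0")
    case True
    have "b powr (1 - p) * (b * s) powr (p - 1) = s powr (p - 1)"
      using True b by (simp add: powr_mult flip: powr_add mult.assoc)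
    then show ?thesis
      using True b by (simp add: gamma_kernel_def indicator_def exp_minus divide_inverse mult_ac)
  next
    case False
    then show ?thesis using b by (auto simp: indicator_def zero_le_mult_iff)
  qed
  moreover have "b powr (1 - p) * (Gamma p /\<^sub>R \<bar>b\<bar>) = Gamma p / b powr p"
    using b by (simp add: powr_diff field_simps)
  ultimately show ?thesis by simp
qed

context
  fixes M :: "'a measure" and f q :: "'a \<Rightarrow> real" and b c c' p \<kappa> :: real
  assumes M: "sigma_finite_measure M"
    and f [measurable]: "f \<in> borel_measurable M" and q [measurable]: "q \<in> borel_measurable M"
    and q_nonneg: "\<And>v. q v \<ge> 0" and b: "b > 0" and p: "0 < p" "\<kappa> < p"
    and moment: "\<And>s. s > 0 \<Longrightarrow> has_bochner_integral M (\<lambda>v. exp (- s * q v) * f v) (c * s powr - \<kappa>)"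
    and abs_moment: "\<And>s. s > 0 \<Longrightarrow>
      has_bochner_integral M (\<lambda>v. exp (- s * q v) * \<bar>f v\<bar>) (c' * s powr - \<kappa>)"
begin

interpretation sigma_finite_measure M by (rule M)

interpretation pair_sigma_finite lborel M ..

lemma has_bochner_integral_gamma_kernel_mult:
  assumes "\<And>s. s > 0 \<Longrightarrow> has_bochner_integral M (\<lambda>v. exp (- s * q v) * h v) (d * s powr - \<kappa>)"
  shows "has_bochner_integral M
      (\<lambda>v. gamma_kernel p (b + q v) s * h v) (d * gamma_kernel (p - \<kappa>) b s)"
proof (cases "s > 0")
  case True
  have "has_bochner_integral M (\<lambda>v. gamma_kernel p b s * (exp (- s * q v) * h v))
      (gamma_kernel p b s * (d * s powr - \<kappa>))"
    by (rule has_bochner_integral_mult_right[OF assms[OF True]])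
  moreover have "gamma_kernel p b s * (exp (- s * q v) * h v) = gamma_kernel p (b + q v) s * h v"
    for v
    by (simp only: gamma_kernel_mult_exp mult.assoc[symmetric])
  moreover have "gamma_kernel p b s * (d * s powr - \<kappa>) = d * gamma_kernel (p - \<kappa>) b s"
    by (simp only: gamma_kernel_mult_powr[OF True, symmetric] mult_ac)
  ultimately show ?thesis by (simp only:)
qed (simp add: has_bochner_integral_zero)

lemma integrable_gamma_kernel_mult:
  "integrable (lborel \<Otimes>\<^sub>M M) (\<lambda>(s, v). gamma_kernel p (b + q v) s * f v)"
proof (rule Fubini_integrable)
  show "(\<lambda>(s, v). gamma_kernel p (b + q v) s * f v) \<in> borel_measurable (lborel \<Otimes>\<^sub>M M)"
    unfolding gamma_kernel_def by measurable
  have "(\<integral>v. norm (gamma_kernel p (b + q v) s * f v) \<partial>M) = c' * gamma_kernel (p - \<kappa>) b s" for s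
    using has_bochner_integral_integral_eq[OF has_bochner_integral_gamma_kernel_mult[OF abs_moment]]
    by (simp add: abs_mult)
  then show "integrable lborel
      (\<lambda>s. \<integral>v. norm (case (s, v) of (s, v) \<Rightarrow> gamma_kernel p (b + q v) s * f v) \<partial>M)"
    using integrable.intros[OF has_bochner_integral_gamma_kernel[of "p - \<kappa>" b]] p b by simp
  show "AE s in lborel. integrable M (\<lambda>v. case (s, v) of (s, v) \<Rightarrow> gamma_kernel p (b + q v) s * f v)"
    unfolding prod.case
    by (intro AE_I2 integrable.intros[OF has_bochner_integral_gamma_kernel_mult[OF moment]])
qed

lemma has_bochner_integral_gamma_mixture:
  "has_bochner_integral M (\<lambda>v. f v * (b + q v) powr - p)
     (c * (Gamma (p - \<kappa>) / b powr (p - \<kappa>)) / Gamma p)"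
proof -
  note int = integrable_gamma_kernel_mult
  have G: "Gamma p > 0" by (rule Gamma_real_pos[OF p(1)])
  have mixture: "integral\<^sup>L lborel (gamma_kernel p (b + q v)) * f v
      = Gamma p * (f v * (b + q v) powr - p)"
    for v
  proof -
    have "b + q v > 0" using b q_nonneg[of v] by (rule add_pos_nonneg)
    then have "integral\<^sup>L lborel (gamma_kernel p (b + q v)) = Gamma p / (b + q v) powr p"
      by (intro has_bochner_integral_integral_eq has_bochner_integral_gamma_kernel p(1))
    then show ?thesis by (simp add: powr_minus divide_inverse)
  qed
  have "integrable M (\<lambda>v. f v * (b + q v) powr - p)"
    using integrable_snd[OF int] G by (simp add: mixture)
  moreover have "(\<integral>v. f v * (b + q v) powr - p \<partial>M) = c * (Gamma (p - \<kappa>) / b powr (p - \<kappa>)) / Gamma p"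
  proof -
    have "Gamma p * (\<integral>v. f v * (b + q v) powr - p \<partial>M)
        = (\<integral>s. \<integral>v. gamma_kernel p (b + q v) s * f v \<partial>M \<partial>lborel)"
      using Fubini_integral[OF int] by (simp add: mixture)
    also have "\<dots> = (\<integral>s. c * gamma_kernel (p - \<kappa>) b s \<partial>lborel)"
      by (intro Bochner_Integration.integral_cong refl has_bochner_integral_integral_eq
          has_bochner_integral_gamma_kernel_mult moment)
    also have "\<dots> = c * (Gamma (p - \<kappa>) / b powr (p - \<kappa>))"
      using has_bochner_integral_integral_eq[OF has_bochner_integral_gamma_kernel[of "p - \<kappa>" b]] p b
      by simp
    finally show ?thesis using G by (intro eq_divide_imp) (simp_all add: mult.commute)
  qed
  ultimately show ?thesis by (simp add: has_bochner_integral_iff)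
qed

end

section \<open>Moments of the standardized t distribution\<close>

text \<open>The coordinates of the random vector are the elements of a finite set \<open>J\<close>, so that independent
  vectors can live on disjoint sets.\<close>

definition sum_sq :: "nat set \<Rightarrow> (nat \<Rightarrow> real) \<Rightarrow> real" where
  "sum_sq J v = (\<Sum>j\<in>J. (v j)\<^sup>2)"

definition t_density_on :: "nat set \<Rightarrow> real \<Rightarrow> (nat \<Rightarrow> real) \<Rightarrow> real" where
  "t_density_on J \<nu> v =
     t_const \<nu> (card J) * (1 + sum_sq J v / (\<nu> - 2)) powr (- (\<nu> + real (card J)) / 2)"

abbreviation has_t_expectation :: "nat set \<Rightarrow> real \<Rightarrow> ((nat \<Rightarrow> real) \<Rightarrow> real) \<Rightarrow> real \<Rightarrow> bool" where
  "has_t_expectation J \<nu> f x \<equiv> has_bochner_integral (lborel_on J) (\<lambda>v. f v * t_density_on J \<nu> v) x"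

definition t_weight :: "nat set \<Rightarrow> real \<Rightarrow> (nat \<Rightarrow> real) \<Rightarrow> real" where
  "t_weight J \<nu> v = (\<nu> + real (card J)) / (\<nu> - 2 + sum_sq J v)"

definition t_phi :: "nat set \<Rightarrow> real \<Rightarrow> real" where
  "t_phi J \<nu> = (\<nu> + real (card J)) / (\<nu> + real (card J) + 2)"

lemma sum_sq_nonneg [simp]: "sum_sq J v \<ge> 0"
  by (simp add: sum_sq_def sum_nonneg)

lemma power_moment_mixture:
  assumes J: "finite J" and b: "b > 0" and a: "a > real (card J) / 2" and r: "sum \<alpha> J = 2 * r"
  shows "has_bochner_integral (lborel_on J)
      (\<lambda>v. (\<Prod>j\<in>J. v j ^ \<alpha> j) * (b + sum_sq J v) powr - (a + real r))
     (sqrt pi ^ card J * (\<Prod>j\<in>J. gauss_moment (\<alpha> j))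
       * (Gamma (a - real (card J) / 2) / b powr (a - real (card J) / 2)) / Gamma (a + real r))"
proof -
  let ?\<kappa> = "real (card J) / 2 + real r"
  have \<kappa>: "- real (card J + sum \<alpha> J) / 2 = - ?\<kappa>" by (simp add: r add_divide_distrib)
  have gauss: "has_bochner_integral (lborel_on J) (\<lambda>v. exp (- s * sum_sq J v) * (\<Prod>j\<in>J. g j (v j)))
      ((\<Prod>j\<in>J. c j) * s powr - ?\<kappa>)"
    if "s > 0" "\<And>j. j \<in> J \<Longrightarrow> has_bochner_integral lborel (\<lambda>x. exp (- x\<^sup>2) * g j x) (c j)"
      "\<And>j t x. j \<in> J \<Longrightarrow> t > 0 \<Longrightarrow> g j (t * x) = t ^ \<alpha> j * g j x" for s g c
    unfolding sum_sq_def \<kappa>[symmetric]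
    by (rule has_bochner_integral_gaussian_prod[OF J that(1), of g c \<alpha>]) (fact that)+
  define c' :: "nat \<Rightarrow> real" where "c' j = (\<integral>x. exp (- x\<^sup>2) * \<bar>x\<bar> ^ \<alpha> j \<partial>lborel)" for j
  have abs_moment: "has_bochner_integral lborel (\<lambda>x. exp (- x\<^sup>2) * \<bar>x\<bar> ^ \<alpha> j) (c' j)" for j
    using integrable_abs[OF integrable.intros[OF has_bochner_integral_gauss_moment[of "\<alpha> j"]]]
    by (simp add: has_bochner_integral_iff c'_def abs_mult power_abs)
  have "has_bochner_integral (lborel_on J)
      (\<lambda>v. (\<Prod>j\<in>J. v j ^ \<alpha> j) * (b + sum_sq J v) powr - (a + real r))
      ((\<Prod>j\<in>J. sqrt pi * gauss_moment (\<alpha> j))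
        * (Gamma (a + real r - ?\<kappa>) / b powr (a + real r - ?\<kappa>)) / Gamma (a + real r))"
  proof (rule has_bochner_integral_gamma_mixture)
    show "sigma_finite_measure (lborel_on J)" by (rule lborel_prod.sigma_finite[OF J])
    show "sum_sq J \<in> borel_measurable (lborel_on J)" unfolding sum_sq_def by measurable
    fix s :: real assume s: "s > 0"
    show "has_bochner_integral (lborel_on J) (\<lambda>v. exp (- s * sum_sq J v) * (\<Prod>j\<in>J. v j ^ \<alpha> j))
        ((\<Prod>j\<in>J. sqrt pi * gauss_moment (\<alpha> j)) * s powr - ?\<kappa>)"
      by (rule gauss[OF s has_bochner_integral_gauss_moment]) (simp add: power_mult_distrib)
    show "has_bochner_integral (lborel_on J) (\<lambda>v. exp (- s * sum_sq J v) * \<bar>\<Prod>j\<in>J. v j ^ \<alpha> j\<bar>)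
        ((\<Prod>j\<in>J. c' j) * s powr - ?\<kappa>)"
      unfolding abs_prod power_abs
      by (rule gauss[OF s abs_moment]) (simp add: abs_mult power_mult_distrib)
  qed (use a b in \<open>auto intro: le_less_trans[of 0 "real (card J) / 2"] add_pos_nonneg\<close>)
  then show ?thesis by (simp add: prod.distrib)
qed

lemma t_weighted_density_eq:
  assumes "\<nu> > 2"
  shows "t_weight J \<nu> v ^ r * t_density_on J \<nu> v
    = t_const \<nu> (card J) * (\<nu> - 2) powr ((\<nu> + real (card J)) / 2) * (\<nu> + real (card J)) ^ r
      * (\<nu> - 2 + sum_sq J v) powr - ((\<nu> + real (card J)) / 2 + real r)"
proof -
  define b where "b = \<nu> - 2"
  define a where "a = (\<nu> + real (card J)) / 2"
  define q where "q = b + sum_sq J v"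
  have b: "b > 0" using assms by (simp add: b_def)
  have q: "q > 0" unfolding q_def using b by (intro add_pos_nonneg) auto
  have "1 + sum_sq J v / b = q / b" using b by (simp add: q_def field_simps)
  then have "(1 + sum_sq J v / b) powr - a = b powr a * q powr - a"
    using b q by (simp add: powr_divide powr_minus_divide)
  moreover have "q powr - (a + real r) = q powr - a / q ^ r"
    using q powr_add[of q "- a" "- real r"] by (simp add: powr_minus powr_realpow divide_inverse)
  moreover have "- (\<nu> + real (card J)) / 2 = - a"
    by (simp only: a_def minus_divide_left)
  ultimately show ?thesis
    unfolding t_weight_def t_density_on_def b_def[symmetric] q_def[symmetric] a_def[symmetric]
    by (simp add: power_divide)
qed

lemma t_weighted_moment:
  assumes J: "finite J" and \<nu>: "\<nu> > 2" and r: "sum \<alpha> J = 2 * r"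
  defines "a \<equiv> (\<nu> + real (card J)) / 2"
  shows "has_t_expectation J \<nu> (\<lambda>v. t_weight J \<nu> v ^ r * (\<Prod>j\<in>J. v j ^ \<alpha> j))
     ((2 * a) ^ r * Gamma a / Gamma (a + real r) * (\<Prod>j\<in>J. gauss_moment (\<alpha> j)))"
proof -
  let ?m = "real (card J)" and ?P = "\<Prod>j\<in>J. gauss_moment (\<alpha> j)"
  define b where "b = \<nu> - 2"
  have b: "b > 0" using \<nu> by (simp add: b_def)
  have a: "a > ?m / 2" "a > 0" "a - ?m / 2 = \<nu> / 2" "\<nu> + ?m = 2 * a"
    using \<nu> by (auto simp: a_def field_simps add_pos_nonneg)
  let ?C = "t_const \<nu> (card J) * b powr a * (2 * a) ^ r"
  have "has_bochner_integral (lborel_on J)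
      (\<lambda>v. ?C * ((\<Prod>j\<in>J. v j ^ \<alpha> j) * (b + sum_sq J v) powr - (a + real r)))
     (?C * (sqrt pi ^ card J * ?P * (Gamma (\<nu> / 2) / b powr (\<nu> / 2)) / Gamma (a + real r)))"
    using power_moment_mixture[OF J b a(1) r]
    by (intro has_bochner_integral_mult_right) (simp only: a(3))
  moreover have
    "?C * (sqrt pi ^ card J * ?P * (Gamma (\<nu> / 2) / b powr (\<nu> / 2)) / Gamma (a + real r))
      = (2 * a) ^ r * Gamma a / Gamma (a + real r) * ?P"
  proof -
    have t: "t_const \<nu> (card J) = Gamma a / Gamma (\<nu> / 2) / (b powr (?m / 2) * sqrt pi ^ card J)"
      unfolding t_const_def b_def[symmetric] a_def[symmetric] using b
      by (simp add: powr_mult powr_minus_divide powr_half_sqrt[symmetric] powr_power)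
    have p: "b powr a = b powr (?m / 2) * b powr (\<nu> / 2)"
      unfolding powr_add[symmetric] by (simp add: a_def add_divide_distrib add.commute)
    have "Gamma (\<nu> / 2) \<noteq> 0" using \<nu> by (simp add: Gamma_real_pos[THEN less_imp_neq, symmetric])
    then show ?thesis unfolding t p using b by simp
  qed
  moreover have "t_weight J \<nu> v ^ r * (\<Prod>j\<in>J. v j ^ \<alpha> j) * t_density_on J \<nu> v
      = ?C * ((\<Prod>j\<in>J. v j ^ \<alpha> j) * (b + sum_sq J v) powr - (a + real r))" for v
  proof -
    have "t_weight J \<nu> v ^ r * t_density_on J \<nu> v = ?C * (b + sum_sq J v) powr - (a + real r)"
      using t_weighted_density_eq[OF \<nu>, of J v r, folded a_def b_def] unfolding a(4) .
    moreover have "t_weight J \<nu> v ^ r * (\<Prod>j\<in>J. v j ^ \<alpha> j) * t_density_on J \<nu> v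
        = (t_weight J \<nu> v ^ r * t_density_on J \<nu> v) * (\<Prod>j\<in>J. v j ^ \<alpha> j)"
      by (simp only: mult_ac)
    ultimately show ?thesis by (simp only: mult_ac)
  qed
  ultimately show ?thesis by (simp only:)
qed

lemma has_bochner_integral_t_density_on:
  assumes "finite J" "\<nu> > 2" shows "has_bochner_integral (lborel_on J) (t_density_on J \<nu>) 1"
proof -
  have "Gamma ((\<nu> + real (card J)) / 2) > 0"
    using assms by (intro Gamma_real_pos) (simp add: add_pos_nonneg)
  then show ?thesis
    using t_weighted_moment[OF assms, of "\<lambda>_. 0" 0] by (simp add: gauss_moment_values)
qed

lemma prod_power_of_bool:
  fixes v :: "nat \<Rightarrow> real"
  assumes "finite J" "i \<in> J" shows "(\<Prod>x\<in>J. v x ^ of_bool (x = i)) = v i"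
proof -
  have "(\<Prod>x\<in>J. v x ^ of_bool (x = i)) = (\<Prod>x\<in>J. if x = i then v x else 1)"
    by (intro prod.cong refl) auto
  then show ?thesis using assms by simp
qed

lemma prod_gauss_moment_restrict:
  assumes "finite J" "S \<subseteq> J" "\<And>x. x \<notin> S \<Longrightarrow> \<alpha> x = 0"
  shows "(\<Prod>x\<in>J. gauss_moment (\<alpha> x)) = (\<Prod>x\<in>S. gauss_moment (\<alpha> x))"
  using assms by (intro prod.mono_neutral_right) (auto simp: gauss_moment_values)

lemma gauss_moment_pair:
  assumes "finite J" "i \<in> J" "j \<in> J"
  shows "(\<Prod>x\<in>J. gauss_moment (of_bool (x = i) + of_bool (x = j))) = 1 / 2 * of_bool (i = j)"
proof -
  have "(\<Prod>x\<in>J. gauss_moment (of_bool (x = i) + of_bool (x = j)))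
      = (\<Prod>x\<in>{i, j}. gauss_moment (of_bool (x = i) + of_bool (x = j)))"
    using assms by (intro prod_gauss_moment_restrict) auto
  also have "\<dots> = 1 / 2 * of_bool (i = j)"
    by (cases "i = j") (simp_all add: gauss_moment_values numeral_2_eq_2[symmetric])
  finally show ?thesis .
qed

lemma gauss_moment_isserlis:
  assumes "finite J" "i \<in> J" "j \<in> J" "k \<in> J" "l \<in> J"
  shows "(\<Prod>x\<in>J. gauss_moment
      (of_bool (x = i) + of_bool (x = j) + of_bool (x = k) + of_bool (x = l)))
    = 1 / 4 * (of_bool (i = j \<and> k = l) + of_bool (i = k \<and> j = l) + of_bool (i = l \<and> j = k))"
proof -
  let ?\<alpha> = "\<lambda>x. of_bool (x = i) + of_bool (x = j) + of_bool (x = k) + of_bool (x = l) :: nat"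
  have moments: "gauss_moment (Suc (Suc 0)) = 1 / 2" "gauss_moment (Suc (Suc (Suc 0))) = 0"
    "gauss_moment (Suc (Suc (Suc (Suc 0)))) = 3 / 4"
    using gauss_moment_values by (simp_all add: eval_nat_numeral)
  have "(\<Prod>x\<in>J. gauss_moment (?\<alpha> x)) = (\<Prod>x\<in>{i, j, k, l}. gauss_moment (?\<alpha> x))"
    using assms by (intro prod_gauss_moment_restrict) auto
  also have "\<dots> = 1 / 4 *
      (of_bool (i = j \<and> k = l) + of_bool (i = k \<and> j = l) + of_bool (i = l \<and> j = k))"
    by (cases "i = j"; cases "i = k"; cases "i = l"; cases "j = k"; cases "j = l"; cases "k = l")
       (simp_all add: gauss_moment_values moments prod.insert_if)
  finally show ?thesis .
qed

lemma Gamma_plus1_real: "x > 0 \<Longrightarrow> Gamma (x + 1) = x * Gamma x" for x :: real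
  by (intro Gamma_plus1) (auto elim!: nonpos_Ints_cases)

lemma t_second_moment:
  assumes J: "finite J" and \<nu>: "\<nu> > 2" and ij: "i \<in> J" "j \<in> J"
  shows "has_t_expectation J \<nu> (\<lambda>v. t_weight J \<nu> v * (v i * v j)) (of_bool (i = j))"
proof -
  let ?\<alpha> = "\<lambda>x. of_bool (x = i) + of_bool (x = j) :: nat"
  define a where "a = (\<nu> + real (card J)) / 2"
  have a: "a > 0" using \<nu> by (simp add: a_def add_pos_nonneg)
  have degree: "sum ?\<alpha> J = 2 * 1" using J ij by (simp add: sum.distrib of_bool_def)
  have monomial: "(\<Prod>x\<in>J. v x ^ ?\<alpha> x) = v i * v j" for v :: "nat \<Rightarrow> real"
    unfolding power_add prod.distrib using J ij by (simp only: prod_power_of_bool)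
  have "Gamma (a + 1) = a * Gamma a" using a by (rule Gamma_plus1_real)
  moreover have "Gamma a \<noteq> 0" using Gamma_real_pos[OF a] by linarith
  ultimately have "(2 * a) ^ 1 * Gamma a / Gamma (a + real 1) * (1 / 2 * of_bool (i = j))
      = of_bool (i = j)"
    using a by simp
  then show ?thesis
    using t_weighted_moment[OF J \<nu> degree]
    unfolding monomial gauss_moment_pair[OF J ij] a_def[symmetric] by simp
qed

lemma t_fourth_moment:
  assumes J: "finite J" and \<nu>: "\<nu> > 2" and ijkl: "i \<in> J" "j \<in> J" "k \<in> J" "l \<in> J"
  shows "has_t_expectation J \<nu> (\<lambda>v. t_weight J \<nu> v ^ 2 * (v i * v j * v k * v l))
     (t_phi J \<nu> * (of_bool (i = j \<and> k = l) + of_bool (i = k \<and> j = l) + of_bool (i = l \<and> j = k)))"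
proof -
  let ?\<alpha> = "\<lambda>x. of_bool (x = i) + of_bool (x = j) + of_bool (x = k) + of_bool (x = l) :: nat"
  define a where "a = (\<nu> + real (card J)) / 2"
  have a: "a > 0" using \<nu> by (simp add: a_def add_pos_nonneg)
  have degree: "sum ?\<alpha> J = 2 * 2" using J ijkl by (simp add: sum.distrib of_bool_def)
  have monomial: "(\<Prod>x\<in>J. v x ^ ?\<alpha> x) = v i * v j * v k * v l" for v :: "nat \<Rightarrow> real"
    unfolding power_add prod.distrib using J ijkl by (simp only: prod_power_of_bool)
  have "Gamma (a + 1) = a * Gamma a" "Gamma (a + 1 + 1) = (a + 1) * Gamma (a + 1)"
    using a by (intro Gamma_plus1_real; simp)+
  then have Gamma_shift: "Gamma (a + real 2) = (a + 1) * (a * Gamma a)" by (simp add: add.assoc)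
  have "Gamma a \<noteq> 0" using Gamma_real_pos[OF a] by linarith
  then have "(2 * a) ^ 2 * Gamma a / Gamma (a + real 2) * (1 / 4 * x) = a / (a + 1) * x" for x
    unfolding Gamma_shift using a by (simp add: power2_eq_square divide_simps)
  moreover have "a / (a + 1) = t_phi J \<nu>" using \<nu> by (simp add: a_def t_phi_def field_simps)
  ultimately show ?thesis
    using t_weighted_moment[OF J \<nu> degree]
    unfolding monomial gauss_moment_isserlis[OF J ijkl] a_def[symmetric] by simp
qed

definition t_centered :: "nat set \<Rightarrow> real \<Rightarrow> nat \<Rightarrow> nat \<Rightarrow> (nat \<Rightarrow> real) \<Rightarrow> real" where
  "t_centered J \<nu> a b v = t_weight J \<nu> v * (v a * v b) - of_bool (a = b)"

definition t_form :: "nat set \<Rightarrow> real \<Rightarrow> rmat \<Rightarrow> (nat \<Rightarrow> real) \<Rightarrow> real" where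
  "t_form J \<nu> M v = (\<Sum>a\<in>J. \<Sum>b\<in>J. M a b * t_centered J \<nu> a b v)"

lemma t_centered_mean:
  assumes "finite J" "\<nu> > 2" "a \<in> J" "b \<in> J"
  shows "has_t_expectation J \<nu> (t_centered J \<nu> a b) 0"
proof -
  have "has_bochner_integral (lborel_on J)
      (\<lambda>v. t_weight J \<nu> v * (v a * v b) * t_density_on J \<nu> v - of_bool (a = b) * t_density_on J \<nu> v)
      (of_bool (a = b) - of_bool (a = b) * 1)"
    by (intro has_bochner_integral_diff has_bochner_integral_mult_right t_second_moment
        has_bochner_integral_t_density_on assms)
  then show ?thesis by (simp add: t_centered_def left_diff_distrib)
qed

lemma t_centered_cov:
  assumes J: "finite J" "\<nu> > 2" and abcd: "a \<in> J" "b \<in> J" "c \<in> J" "d \<in> J"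
  shows "has_t_expectation J \<nu> (\<lambda>v. t_centered J \<nu> a b v * t_centered J \<nu> c d v)
     ((t_phi J \<nu> - 1) * of_bool (a = b \<and> c = d)
       + t_phi J \<nu> * (of_bool (a = c \<and> b = d) + of_bool (a = d \<and> b = c)))"
proof -
  let ?\<phi> = "t_phi J \<nu>" and ?w = "t_weight J \<nu>" and ?f = "t_density_on J \<nu>"
  let ?ab = "of_bool (a = b) :: real" and ?cd = "of_bool (c = d) :: real"
  have "has_bochner_integral (lborel_on J)
      (\<lambda>v. ?w v ^ 2 * (v a * v b * v c * v d) * ?f v - ?cd * (?w v * (v a * v b) * ?f v)
        - ?ab * (?w v * (v c * v d) * ?f v) + ?ab * ?cd * ?f v)
      (?\<phi> * (of_bool (a = b \<and> c = d) + of_bool (a = c \<and> b = d) + of_bool (a = d \<and> b = c))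
        - ?cd * ?ab - ?ab * ?cd + ?ab * ?cd * 1)"
    by (intro has_bochner_integral_add has_bochner_integral_diff has_bochner_integral_mult_right
        t_second_moment t_fourth_moment has_bochner_integral_t_density_on J abcd)
  moreover have "?w v ^ 2 * (v a * v b * v c * v d) * ?f v - ?cd * (?w v * (v a * v b) * ?f v)
        - ?ab * (?w v * (v c * v d) * ?f v) + ?ab * ?cd * ?f v
      = t_centered J \<nu> a b v * t_centered J \<nu> c d v * ?f v" for v
    by (simp add: t_centered_def algebra_simps power2_eq_square)
  moreover have "?ab * ?cd = of_bool (a = b \<and> c = d)" by simp
  ultimately show ?thesis by (simp add: algebra_simps)
qed

lemma t_form_mean:
  assumes "finite J" "\<nu> > 2"
  shows "has_t_expectation J \<nu> (t_form J \<nu> M) 0"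
proof -
  have "has_bochner_integral (lborel_on J)
      (\<lambda>v. \<Sum>a\<in>J. \<Sum>b\<in>J. M a b * (t_centered J \<nu> a b v * t_density_on J \<nu> v)) (\<Sum>a\<in>J. \<Sum>b\<in>J. M a b * 0)"
    by (intro has_bochner_integral_sum has_bochner_integral_mult_right t_centered_mean assms)
  then show ?thesis by (simp add: t_form_def sum_distrib_right mult.assoc)
qed

lemma sum_delta_diagonal:
  fixes f :: "nat \<Rightarrow> nat \<Rightarrow> real"
  assumes "finite J"
  shows "(\<Sum>a\<in>J. \<Sum>b\<in>J. f a b * of_bool (a = b)) = (\<Sum>a\<in>J. f a a)"
  using assms by (simp add: of_bool_def if_distrib[of "\<lambda>x. _ * x"] cong: if_cong)

lemma sum_delta_pair:
  fixes f :: "nat \<Rightarrow> nat \<Rightarrow> real"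
  assumes "finite J" "a \<in> J" "b \<in> J"
  shows "(\<Sum>c\<in>J. \<Sum>d\<in>J. f c d * of_bool (a = c \<and> b = d)) = f a b"
proof -
  have "(\<Sum>c\<in>J. \<Sum>d\<in>J. f c d * of_bool (a = c \<and> b = d))
      = (\<Sum>c\<in>J. if c = a then (\<Sum>d\<in>J. if d = b then f c d else 0) else 0)"
    by (intro sum.cong refl) (auto simp: of_bool_def intro!: sum.cong)
  then show ?thesis using assms by simp
qed

lemma sum_delta_pair_swap:
  fixes f :: "nat \<Rightarrow> nat \<Rightarrow> real"
  assumes "finite J" "a \<in> J" "b \<in> J"
  shows "(\<Sum>c\<in>J. \<Sum>d\<in>J. f c d * of_bool (a = d \<and> b = c)) = f b a"
  using sum_delta_pair[of J b a f] assms by (simp only: conj_commute)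

lemma sum_double_product:
  fixes M N F G :: rmat
  shows "(\<Sum>a\<in>J. \<Sum>b\<in>J. M a b * (\<Sum>c\<in>J. \<Sum>d\<in>J. N c d * (F a b * G c d * z)))
    = (\<Sum>a\<in>J. \<Sum>b\<in>J. M a b * F a b) * (\<Sum>c\<in>J. \<Sum>d\<in>J. N c d * G c d) * z"
proof -
  define T where "T = (\<Sum>c\<in>J. \<Sum>d\<in>J. N c d * G c d)"
  have "(\<Sum>c\<in>J. \<Sum>d\<in>J. N c d * (x * G c d * z)) = x * T * z" for x
    by (simp add: T_def sum_distrib_left sum_distrib_right mult_ac)
  then show ?thesis by (simp add: sum_distrib_right mult.assoc flip: T_def)
qed

lemma t_form_cov:
  assumes J: "finite J" "\<nu> > 2"
  shows "has_t_expectation J \<nu> (\<lambda>v. t_form J \<nu> M v * t_form J \<nu> N v)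
     ((t_phi J \<nu> - 1) * ((\<Sum>a\<in>J. M a a) * (\<Sum>a\<in>J. N a a))
       + t_phi J \<nu> * ((\<Sum>a\<in>J. \<Sum>b\<in>J. M a b * N a b) + (\<Sum>a\<in>J. \<Sum>b\<in>J. M a b * N b a)))"
proof -
  let ?\<phi> = "t_phi J \<nu>" and ?E = "t_centered J \<nu>"
  let ?S = "\<lambda>f. \<Sum>a\<in>J. \<Sum>b\<in>J. M a b * (\<Sum>c\<in>J. \<Sum>d\<in>J. N c d * f a b c d)"
  have "has_bochner_integral (lborel_on J)
      (\<lambda>v. ?S (\<lambda>a b c d. ?E a b v * ?E c d v * t_density_on J \<nu> v))
     (?S (\<lambda>a b c d. (?\<phi> - 1) * of_bool (a = b \<and> c = d)
       + ?\<phi> * (of_bool (a = c \<and> b = d) + of_bool (a = d \<and> b = c))))"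
    by (intro has_bochner_integral_sum has_bochner_integral_mult_right t_centered_cov J)
  moreover have "?S (\<lambda>a b c d. ?E a b v * ?E c d v * t_density_on J \<nu> v)
      = t_form J \<nu> M v * t_form J \<nu> N v * t_density_on J \<nu> v" for v
    by (simp only: sum_double_product t_form_def)
  moreover have "?S (\<lambda>a b c d. (?\<phi> - 1) * of_bool (a = b \<and> c = d)
       + ?\<phi> * (of_bool (a = c \<and> b = d) + of_bool (a = d \<and> b = c)))
     = (?\<phi> - 1) * ?S (\<lambda>a b c d. of_bool (a = b) * of_bool (c = d) * 1)
       + ?\<phi> * (?S (\<lambda>a b c d. of_bool (a = c \<and> b = d)) + ?S (\<lambda>a b c d. of_bool (a = d \<and> b = c)))"
    unfolding sum_distrib_left sum.distrib[symmetric]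
    by (intro sum.cong refl) (simp add: algebra_simps)
  moreover have "?S (\<lambda>a b c d. of_bool (a = b) * of_bool (c = d) * 1)
      = (\<Sum>a\<in>J. M a a) * (\<Sum>a\<in>J. N a a)"
    unfolding sum_double_product sum_delta_diagonal[OF J(1)] by simp
  moreover have "?S (\<lambda>a b c d. of_bool (a = c \<and> b = d)) = (\<Sum>a\<in>J. \<Sum>b\<in>J. M a b * N a b)"
    by (intro sum.cong refl) (simp only: sum_delta_pair[OF J(1)])
  moreover have "?S (\<lambda>a b c d. of_bool (a = d \<and> b = c)) = (\<Sum>a\<in>J. \<Sum>b\<in>J. M a b * N b a)"
    by (intro sum.cong refl) (simp only: sum_delta_pair_swap[OF J(1)])
  ultimately show ?thesis by simp
qed

section \<open>Integrals of functions of disjoint sets of coordinates\<close>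

definition depends_on :: "'i set \<Rightarrow> (('i \<Rightarrow> 'a) \<Rightarrow> 'b) \<Rightarrow> bool" where
  "depends_on I f \<longleftrightarrow> (\<forall>v. f (restrict v I) = f v)"

lemma depends_onD: "depends_on I f \<Longrightarrow> (\<And>i. i \<in> I \<Longrightarrow> u i = v i) \<Longrightarrow> f u = f v"
  unfolding depends_on_def by (metis restrict_ext)

lemma depends_on_const: "depends_on I (\<lambda>_. c)"
  by (simp add: depends_on_def)

lemma depends_on_if:
  "(P \<Longrightarrow> depends_on I f) \<Longrightarrow> (\<not> P \<Longrightarrow> depends_on I g) \<Longrightarrow> depends_on I (\<lambda>v. if P then f v else g v)"
  by (cases P) simp_all

lemma depends_on_mult: "depends_on I f \<Longrightarrow> depends_on I g \<Longrightarrow> depends_on I (\<lambda>v. f v * g v)"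
  by (simp add: depends_on_def)

lemma depends_on_prod:
  "(\<And>b. b \<in> B \<Longrightarrow> depends_on (J b) (h b)) \<Longrightarrow> depends_on (\<Union>b\<in>B. J b) (\<lambda>v. \<Prod>b\<in>B. h b v)"
  unfolding depends_on_def[of "\<Union>b\<in>B. J b"]
  by (intro allI prod.cong refl) (rule depends_onD[of "J _" "h _"], auto)

lemma depends_on_merge_left: "depends_on I f \<Longrightarrow> f (merge I J (u, w)) = f u"
  by (rule depends_onD[of I f]) (auto simp: merge_def)

lemma depends_on_merge_right:
  "depends_on J g \<Longrightarrow> I \<inter> J = {} \<Longrightarrow> g (merge I J (u, w)) = g w"
  by (rule depends_onD[of J g]) auto

lemma depends_on_measurable:
  assumes "depends_on I f" "f \<in> borel_measurable (Pi\<^sub>M I M)" "I \<subseteq> J"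
  shows "f \<in> borel_measurable (Pi\<^sub>M J M)"
proof -
  have "(\<lambda>v. f (restrict v I)) \<in> borel_measurable (Pi\<^sub>M J M)"
    by (rule measurable_compose[OF measurable_restrict_subset[OF assms(3)] assms(2)])
  then show ?thesis using assms(1) by (simp add: depends_on_def)
qed

context product_sigma_finite
begin

lemma integrable_mult_disjoint:
  fixes f g :: "('i \<Rightarrow> 'a) \<Rightarrow> real"
  assumes I: "finite I" and J: "finite J" and disjoint: "I \<inter> J = {}"
    and f: "integrable (Pi\<^sub>M I M) f" "depends_on I f"
    and g: "integrable (Pi\<^sub>M J M) g" "depends_on J g"
  shows "integrable (Pi\<^sub>M (I \<union> J) M) (\<lambda>v. f v * g v)"
proof -
  let ?h = "\<lambda>v. f v * g v"
  interpret I: sigma_finite_measure "Pi\<^sub>M I M" by (rule sigma_finite[OF I])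
  interpret J: sigma_finite_measure "Pi\<^sub>M J M" by (rule sigma_finite[OF J])
  interpret pair_sigma_finite "Pi\<^sub>M I M" "Pi\<^sub>M J M" ..
  have [measurable]: "f \<in> borel_measurable (Pi\<^sub>M I M)" "g \<in> borel_measurable (Pi\<^sub>M J M)"
    using f g by auto
  have [measurable]: "f \<in> borel_measurable (Pi\<^sub>M (I \<union> J) M)" "g \<in> borel_measurable (Pi\<^sub>M (I \<union> J) M)"
    using f g by (auto intro: depends_on_measurable)
  have "integrable (Pi\<^sub>M I M \<Otimes>\<^sub>M Pi\<^sub>M J M) (\<lambda>(u, w). f u * g w)"
  proof (rule Fubini_integrable)
    show "integrable (Pi\<^sub>M I M) (\<lambda>u. \<integral>w. norm (case (u, w) of (u, w) \<Rightarrow> f u * g w) \<partial>Pi\<^sub>M J M)"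
      using f(1) by (simp add: abs_mult)
    show "AE u in Pi\<^sub>M I M. integrable (Pi\<^sub>M J M) (\<lambda>w. case (u, w) of (u, w) \<Rightarrow> f u * g w)"
      using g(1) by simp
  qed measurable
  moreover have "(\<lambda>p. ?h (merge I J p)) = (\<lambda>(u, w). f u * g w)"
    using f(2) g(2) disjoint by (auto simp: depends_on_merge_left depends_on_merge_right)
  ultimately have "integrable (Pi\<^sub>M I M \<Otimes>\<^sub>M Pi\<^sub>M J M) (\<lambda>p. ?h (merge I J p))" by simp
  then have "integrable (distr (Pi\<^sub>M I M \<Otimes>\<^sub>M Pi\<^sub>M J M) (Pi\<^sub>M (I \<union> J) M) (merge I J)) ?h"
    by (subst integrable_distr_eq[OF measurable_merge]) measurable
  then show ?thesis unfolding distr_merge[OF disjoint I J] .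
qed

lemma has_bochner_integral_mult_disjoint:
  fixes f g :: "('i \<Rightarrow> 'a) \<Rightarrow> real"
  assumes I: "finite I" and J: "finite J" and disjoint: "I \<inter> J = {}"
    and f: "has_bochner_integral (Pi\<^sub>M I M) f x" "depends_on I f"
    and g: "has_bochner_integral (Pi\<^sub>M J M) g y" "depends_on J g"
  shows "has_bochner_integral (Pi\<^sub>M (I \<union> J) M) (\<lambda>v. f v * g v) (x * y)"
proof -
  have int: "integrable (Pi\<^sub>M (I \<union> J) M) (\<lambda>v. f v * g v)"
    using f g by (intro integrable_mult_disjoint I J disjoint) (auto simp: has_bochner_integral_iff)
  have "(\<integral>v. f v * g v \<partial>Pi\<^sub>M (I \<union> J) M)
      = (\<integral>u. (\<integral>w. f (merge I J (u, w)) * g (merge I J (u, w)) \<partial>Pi\<^sub>M J M) \<partial>Pi\<^sub>M I M)"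
    by (rule product_integral_fold[OF disjoint I J int])
  also have "\<dots> = x * y"
    using f g by (simp add: depends_on_merge_left depends_on_merge_right disjoint
        has_bochner_integral_iff)
  finally show ?thesis using int by (simp add: has_bochner_integral_iff)
qed

lemma has_bochner_integral_prod_disjoint:
  fixes h :: "'b \<Rightarrow> ('i \<Rightarrow> 'a) \<Rightarrow> real"
  assumes "finite B" "disjoint_family_on J B" "\<And>b. b \<in> B \<Longrightarrow> finite (J b)"
    and "\<And>b. b \<in> B \<Longrightarrow> has_bochner_integral (Pi\<^sub>M (J b) M) (h b) (x b)"
    and "\<And>b. b \<in> B \<Longrightarrow> depends_on (J b) (h b)"
  shows "has_bochner_integral (Pi\<^sub>M (\<Union>b\<in>B. J b) M) (\<lambda>v. \<Prod>b\<in>B. h b v) (\<Prod>b\<in>B. x b)"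
  using assms
proof (induction B)
  case empty
  interpret finite_measure "Pi\<^sub>M {} M" by rule (simp add: space_PiM)
  show ?case by (simp add: has_bochner_integral_iff space_PiM measure_def)
next
  case (insert b B)
  have disjoint: "J b \<inter> (\<Union>c\<in>B. J c) = {}"
    using insert.prems(1) insert.hyps(2) by (auto simp: disjoint_family_on_def)
  have "has_bochner_integral (Pi\<^sub>M (J b \<union> (\<Union>c\<in>B. J c)) M)
      (\<lambda>v. h b v * (\<Prod>c\<in>B. h c v)) (x b * (\<Prod>c\<in>B. x c))"
  proof (rule has_bochner_integral_mult_disjoint[OF _ _ disjoint])
    show "has_bochner_integral (Pi\<^sub>M (\<Union>c\<in>B. J c) M) (\<lambda>v. \<Prod>c\<in>B. h c v) (\<Prod>c\<in>B. x c)"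
      using insert.prems by (intro insert.IH) (auto simp: disjoint_family_on_def)
  qed (use insert.hyps insert.prems in \<open>auto intro: depends_on_prod\<close>)
  then show ?case using insert.hyps by simp
qed

end

section \<open>Orthogonal conjugation and block diagonal matrices\<close>

lemma spd_orthogonal_conj:
  assumes Q: "inverts n Q (mtranspose Q)" and M: "spd n M"
  shows "spd n (mmult n Q (mmult n M (mtranspose Q)))"
  using spd_congruence[OF M mdet_nonzero_if_inverts[OF inverts_commute[OF Q]]] by simp

lemma is_msqrt_orthogonal_conj:
  assumes Q: "inverts n Q (mtranspose Q)" and R: "is_msqrt n M R"
  shows "is_msqrt n (mmult n Q (mmult n M (mtranspose Q))) (mmult n Q (mmult n R (mtranspose Q)))"
  unfolding is_msqrt_def
proof
  let ?Q' = "mtranspose Q"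
  show "spd n (mmult n Q (mmult n R ?Q'))" by (rule spd_orthogonal_conj[OF Q is_msqrt_spd[OF R]])
  have "mmult n (mmult n Q (mmult n R ?Q')) (mmult n Q (mmult n R ?Q'))
      = mmult n Q (mmult n R (mmult n (mmult n ?Q' Q) (mmult n R ?Q')))"
    by (simp add: mmult_assoc)
  also have "\<dots> =\<^bsub>n\<^esub> mmult n Q (mmult n R (mmult n R ?Q'))"
    by (intro mmult_cong mat_eq_refl mmult_inverts_cancel[OF inverts_commute[OF Q]])
  also have "\<dots> = mmult n Q (mmult n (mmult n R R) ?Q')" by (simp add: mmult_assoc)
  also have "\<dots> =\<^bsub>n\<^esub> mmult n Q (mmult n M ?Q')"
    by (intro mmult_cong mat_eq_refl is_msqrt_square[OF R])
  finally show "mmult n (mmult n Q (mmult n R ?Q')) (mmult n Q (mmult n R ?Q'))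
      =\<^bsub>n\<^esub> mmult n Q (mmult n M ?Q')" .
qed

definition block_diag :: "nat \<Rightarrow> rmat \<Rightarrow> (nat \<Rightarrow> real) \<Rightarrow> rmat" where
  "block_diag K P e = (\<lambda>i j. if i < K \<and> j < K then P i j else if i = j \<and> K \<le> i then e i else 0)"

lemma mapply_block_diag:
  assumes "K \<le> n" "i < n"
  shows "mapply n (block_diag K P e) x i = (if i < K then mapply K P x i else e i * x i)"
proof (cases "i < K")
  case True
  have "mapply n (block_diag K P e) x i = (\<Sum>l<K. block_diag K P e i l * x l)"
    unfolding mapply_def using assms True
    by (intro sum.mono_neutral_right) (auto simp: block_diag_def)
  then show ?thesis using True by (simp add: mapply_def block_diag_def)
next
  case False
  then have "mapply n (block_diag K P e) x i = (\<Sum>l<n. if l = i then e i * x i else 0)"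
    unfolding mapply_def by (intro sum.cong refl) (auto simp: block_diag_def)
  then show ?thesis using False assms by simp
qed

lemma block_diag_cong:
  "P =\<^bsub>K\<^esub> P' \<Longrightarrow> (\<And>c. K \<le> c \<Longrightarrow> c < n \<Longrightarrow> e c = e' c) \<Longrightarrow> block_diag K P e =\<^bsub>n\<^esub> block_diag K P' e'"
  by (simp add: mat_eq_def block_diag_def)

lemma mmult_block_diag:
  assumes "K \<le> n"
  shows "mmult n (block_diag K P e) (block_diag K P' e')
    =\<^bsub>n\<^esub> block_diag K (mmult K P P') (\<lambda>c. e c * e' c)"
proof (rule mat_eqI)
  fix i j assume ij: "i < n" "j < n"
  have "mmult n (block_diag K P e) (block_diag K P' e') i j
      = mapply n (block_diag K P e) (\<lambda>l. block_diag K P' e' l j) i"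
    by (simp add: mmult_def mapply_def)
  then show "mmult n (block_diag K P e) (block_diag K P' e') i j
      = block_diag K (mmult K P P') (\<lambda>c. e c * e' c) i j"
    using assms ij
    by (auto simp: mapply_block_diag) (auto simp: block_diag_def mmult_def mapply_def)
qed

lemma inverts_block_diag:
  assumes "K \<le> n" "inverts K P P'" "\<And>c. K \<le> c \<Longrightarrow> c < n \<Longrightarrow> e c * e' c = 1"
  shows "inverts n (block_diag K P e) (block_diag K P' e')"
proof -
  have "block_diag K (mmult K P P') (\<lambda>c. e c * e' c) =\<^bsub>n\<^esub> block_diag K (mid K) (\<lambda>_. 1)"
    using assms by (intro block_diag_cong) (auto simp: inverts_def)
  also have "\<dots> =\<^bsub>n\<^esub> mid n" using assms(1) by (auto simp: mat_eq_def block_diag_def mid_def)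
  finally show ?thesis unfolding inverts_def using mmult_block_diag[OF assms(1)] mat_eq_trans
    by blast
qed

lemma spd_block_diag:
  assumes "K \<le> n" and P: "spd K P" and e: "\<And>c. K \<le> c \<Longrightarrow> c < n \<Longrightarrow> e c > 0"
  shows "spd n (block_diag K P e)"
  unfolding spd_def
proof
  show "msym n (block_diag K P e)" using P by (auto simp: spd_def msym_def block_diag_def)
  have split: "{..<n} = {..<K} \<union> {K..<n}" "{..<K} \<inter> {K..<n} = {}" using assms(1) by auto
  have q: "quad_form n (block_diag K P e) x = quad_form K P x + (\<Sum>c\<in>{K..<n}. e c * (x c)\<^sup>2)" for x
    unfolding quad_form_eq_dot dot_def split(1) using assms(1)
    by (subst sum.union_disjoint)
       (auto simp: mapply_block_diag power2_eq_square mult_ac intro!: sum.cong)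
  show "mpd n (block_diag K P e)"
    unfolding mpd_iff_quad_form
  proof (intro allI impI)
    fix x :: "nat \<Rightarrow> real" assume "\<exists>i<n. x i \<noteq> 0"
    then obtain i where i: "i < n" "x i \<noteq> 0" by blast
    have P_nonneg: "quad_form K P x \<ge> 0" using P by (simp add: spd_def quad_form_nonneg)
    have e_nonneg: "e c * (x c)\<^sup>2 \<ge> 0" if "c \<in> {K..<n}" for c
      using that e[of c] by simp
    show "quad_form n (block_diag K P e) x > 0"
    proof (cases "i < K")
      case True
      then have "quad_form K P x > 0" using P i by (auto simp: spd_def mpd_iff_quad_form)
      then show ?thesis unfolding q using e_nonneg by (intro add_pos_nonneg sum_nonneg)
    next
      case False
      then have "0 < e i * (x i)\<^sup>2" "i \<in> {K..<n}" using i e[of i] by auto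
      then have "0 < (\<Sum>c\<in>{K..<n}. e c * (x c)\<^sup>2)" using e_nonneg by (intro sum_pos2) auto
      then show ?thesis unfolding q using P_nonneg by (intro add_nonneg_pos)
    qed
  qed
qed

lemma is_msqrt_block_diag:
  assumes "K \<le> n" "is_msqrt K P R" and e: "\<And>c. K \<le> c \<Longrightarrow> c < n \<Longrightarrow> e c > 0"
  shows "is_msqrt n (block_diag K P e) (block_diag K R (\<lambda>c. sqrt (e c)))"
  unfolding is_msqrt_def
proof
  show "spd n (block_diag K R (\<lambda>c. sqrt (e c)))"
    using e by (intro spd_block_diag assms(1) is_msqrt_spd[OF assms(2)]) simp
  have "block_diag K (mmult K R R) (\<lambda>c. sqrt (e c) * sqrt (e c)) =\<^bsub>n\<^esub> block_diag K P e"
    using e by (intro block_diag_cong is_msqrt_square[OF assms(2)]) (simp add: less_imp_le)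
  then show "mmult n (block_diag K R (\<lambda>c. sqrt (e c))) (block_diag K R (\<lambda>c. sqrt (e c)))
      =\<^bsub>n\<^esub> block_diag K P e"
    by (rule mat_eq_trans[OF mmult_block_diag[OF assms(1)]])
qed

lemma mdet_block_diag:
  "mdet (K + m) (block_diag K P e) = mdet K P * (\<Prod>i<m. e (K + i))"
proof -
  let ?E = "mat m m (\<lambda>(i, j). if i = j then e (K + i) else 0)"
  have "mat_of (K + m) (block_diag K P e) = four_block_mat (mat_of K P) (0\<^sub>m K m) (0\<^sub>m m K) ?E"
    by (rule eq_matI) (auto simp: block_diag_def mat_of_def)
  moreover have "det (four_block_mat (mat_of K P) (0\<^sub>m K m) (0\<^sub>m m K) ?E) = det (mat_of K P) * det ?E"
    by (rule det_four_block_mat_lower_left_zero) auto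
  moreover have "det ?E = prod_list (diag_mat ?E)"
    by (rule det_upper_triangular[of _ m]) (auto simp: upper_triangular_def)
  moreover have "prod_list (diag_mat ?E) = (\<Prod>i<m. e (K + i))"
    by (simp add: diag_mat_def lessThan_atLeast0 flip: prod.distinct_set_conv_list cong: map_cong)
  ultimately show ?thesis by (simp add: mdet_eq_det)
qed

section \<open>The canonical form of a block correlation matrix\<close>

lemma roff_eq_block_offset: "roff nb = block_offset nb"
  by (simp add: fun_eq_iff roff_def block_offset_def)

lemma coff_eq_block_offset: "coff nb = block_offset (\<lambda>j. nb j - 1)"
  by (simp add: fun_eq_iff coff_def block_offset_def)

locale block_setting =
  fixes K :: nat and nb :: "nat \<Rightarrow> nat" and U :: "nat \<Rightarrow> rmat"
  assumes nb_ge_2: "\<And>k. k < K \<Longrightarrow> nb k \<ge> 2"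
    and U_vperp: "\<And>k. k < K \<Longrightarrow> is_vperp (nb k) (U k)"
begin

abbreviation n :: nat where "n \<equiv> ntot K nb"
abbreviation Q :: rmat where "Q \<equiv> Qmat K nb U"
abbreviation row_index :: "nat \<Rightarrow> nat \<Rightarrow> nat" where "row_index k a \<equiv> roff nb k + a"
abbreviation col_index :: "nat \<Rightarrow> nat \<Rightarrow> nat" where "col_index k i \<equiv> K + coff nb k + i"

lemma n_eq_block_offset: "n = block_offset nb K"
  by (simp add: ntot_def block_offset_def)

lemma n_eq_coff: "n = K + coff nb K"
proof -
  have "n = (\<Sum>k<K. 1 + (nb k - 1))"
    unfolding ntot_def using nb_ge_2 by (intro sum.cong refl) fastforce
  then show ?thesis by (simp only: sum.distrib coff_def) simp
qed

lemma K_le_n: "K \<le> n"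
  by (simp add: n_eq_coff)

lemma real_nb_diff: "k < K \<Longrightarrow> real (nb k - 1) = real (nb k) - 1"
  and real_nb_gt_1: "k < K \<Longrightarrow> real (nb k) > 1"
  using nb_ge_2[of k] by auto

lemma sum_rows: "sum f {..<n} = (\<Sum>k<K. \<Sum>a<nb k. f (row_index k a))"
  for f :: "nat \<Rightarrow> real"
  by (simp add: n_eq_block_offset roff_eq_block_offset sum.lessThan_block_offset)

lemma sum_cols: "sum f {..<n} = (\<Sum>k<K. f k) + (\<Sum>k<K. \<Sum>i<nb k - 1. f (col_index k i))"
  for f :: "nat \<Rightarrow> real"
  by (simp add: n_eq_coff sum.lessThan_add coff_eq_block_offset sum.lessThan_block_offset add.assoc)

lemma row_less: "k < K \<Longrightarrow> a < nb k \<Longrightarrow> row_index k a < n"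
  by (simp add: n_eq_block_offset roff_eq_block_offset block_index_less)

lemma col_less: "k < K \<Longrightarrow> i < nb k - 1 \<Longrightarrow> col_index k i < n"
  by (simp add: n_eq_coff coff_eq_block_offset block_index_less add.assoc)

lemma row_cases: assumes "r < n" obtains k a where "k < K" "a < nb k" "r = row_index k a"
  using assms block_index_cases[of r nb K] by (metis n_eq_block_offset roff_eq_block_offset)

lemma col_cases:
  assumes "c < n"
  obtains (mean) "c < K" | (contrast) k i where "k < K" "i < nb k - 1" "c = col_index k i"
proof (cases "c < K")
  case False
  then have "c - K < block_offset (\<lambda>j. nb j - 1) K"
    using assms by (simp add: n_eq_coff coff_eq_block_offset)
  then obtain k i where "k < K" "i < nb k - 1" "c - K = block_offset (\<lambda>j. nb j - 1) k + i"
    by (rule block_index_cases)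
  then show ?thesis using False contrast[of k i] by (simp add: coff_eq_block_offset)
qed (use mean in blast)

lemma inblk_row: "a < nb k \<Longrightarrow> inblk nb l (row_index k a) \<longleftrightarrow> l = k"
  using block_index_unique[of a nb k l] by (auto simp: inblk_def roff_eq_block_offset)

lemma row_eq_iff: "a < nb k \<Longrightarrow> b < nb l \<Longrightarrow> row_index k a = row_index l b \<longleftrightarrow> k = l \<and> a = b"
  using inblk_row[of a k l] inblk_row[of b l l] by auto

lemma col_in_block_iff:
  "i < nb k - 1 \<Longrightarrow> K + coff nb l \<le> col_index k i \<and> col_index k i < K + coff nb l + (nb l - 1)
      \<longleftrightarrow> l = k"
  using block_index_unique[of i "\<lambda>j. nb j - 1" k l] by (auto simp: coff_eq_block_offset)

lemma col_eq_iff: "i < nb k - 1 \<Longrightarrow> j < nb l - 1 \<Longrightarrow> col_index k i = col_index l j \<longleftrightarrow> k = l \<and> i = j"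
  using col_in_block_iff[of i k l] col_in_block_iff[of j l l] by auto

subsection \<open>The orthogonal matrix Q\<close>

lemma Q_mean_entry:
  assumes "k < K" "a < nb k" "l < K"
  shows "Q (row_index k a) l = (if l = k then 1 / sqrt (real (nb k)) else 0)"
proof -
  have "l < n" using assms K_le_n by simp
  then have "Q (row_index k a) l
      = (\<Sum>k'<K. if k' = k then (if l = k then 1 / sqrt (real (nb k)) else 0) else 0)"
    unfolding Qmat_def using assms by (auto simp: row_less inblk_row intro!: sum.cong)
  then show ?thesis using assms by simp
qed

lemma Q_contrast_entry:
  assumes "k < K" "a < nb k" "l < K" "i < nb l - 1"
  shows "Q (row_index k a) (col_index l i) = (if l = k then U k a i else 0)"
proof -
  have "Q (row_index k a) (col_index l i) = (\<Sum>k'<K. if k' = k then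
       (if K + coff nb k \<le> col_index l i \<and> col_index l i < K + coff nb k + (nb k - 1)
                then U k a (col_index l i - K - coff nb k) else 0) else 0)"
    unfolding Qmat_def using assms by (auto simp: row_less col_less inblk_row intro!: sum.cong)
  also have "\<dots> = (if l = k then U k a i else 0)"
    using assms col_in_block_iff[of i l k] by (simp add: eq_commute[of k l])
  finally show ?thesis .
qed

lemma sum_Q_mean_col:
  assumes "k < K"
  shows "(\<Sum>r<n. Q r k * f r) = (\<Sum>a<nb k. f (row_index k a)) / sqrt (real (nb k))"
proof -
  have "(\<Sum>r<n. Q r k * f r)
      = (\<Sum>l<K. if l = k then (\<Sum>a<nb l. f (row_index l a)) / sqrt (real (nb l)) else 0)"
    unfolding sum_rows using assms
    by (intro sum.cong refl) (simp add: Q_mean_entry sum_divide_distrib)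
  then show ?thesis using assms by simp
qed

lemma sum_Q_contrast_col:
  assumes "k < K" "i < nb k - 1"
  shows "(\<Sum>r<n. Q r (col_index k i) * f r) = (\<Sum>a<nb k. U k a i * f (row_index k a))"
proof -
  have "(\<Sum>r<n. Q r (col_index k i) * f r)
      = (\<Sum>l<K. if l = k then (\<Sum>a<nb l. U l a i * f (row_index l a)) else 0)"
    unfolding sum_rows using assms by (intro sum.cong refl) (simp add: Q_contrast_entry)
  then show ?thesis using assms by simp
qed

lemma sum_Q_row:
  assumes "k < K" "a < nb k"
  shows "(\<Sum>c<n. Q (row_index k a) c * f c)
    = f k / sqrt (real (nb k)) + (\<Sum>i<nb k - 1. U k a i * f (col_index k i))"
proof -
  have "(\<Sum>c<n. Q (row_index k a) c * f c) = (\<Sum>l<K. if l = k then f l / sqrt (real (nb l)) else 0)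
      + (\<Sum>l<K. if l = k then (\<Sum>i<nb l - 1. U l a i * f (col_index l i)) else 0)"
    unfolding sum_cols using assms
    by (intro arg_cong2[where f = plus] sum.cong refl) (auto simp: Q_mean_entry Q_contrast_entry)
  then show ?thesis using assms by simp
qed

lemma U_orthonormal:
  "k < K \<Longrightarrow> i < nb k - 1 \<Longrightarrow> j < nb k - 1 \<Longrightarrow> (\<Sum>a<nb k. U k a i * U k a j) = (if i = j then 1 else 0)"
  using U_vperp[of k] by (simp add: is_vperp_def)

lemma U_sum_col: "k < K \<Longrightarrow> i < nb k - 1 \<Longrightarrow> (\<Sum>a<nb k. U k a i) = 0"
  using U_vperp[of k] by (simp add: is_vperp_def)

lemma Q_cols_orthonormal:
  assumes "c < n" "d < n"
  shows "(\<Sum>r<n. Q r c * Q r d) = mid n c d"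
  using assms(1)
proof (cases rule: col_cases)
  case c: mean
  show ?thesis using assms(2)
  proof (cases rule: col_cases)
    case d: mean
    have "(\<Sum>r<n. Q r c * Q r d) = (if c = d then 1 else 0)"
      unfolding sum_Q_mean_col[OF c] using c d real_nb_gt_1[OF c]
      by (cases "c = d") (simp_all add: Q_mean_entry)
    then show ?thesis using assms(1) by (simp add: mid_def)
  next
    case d: (contrast l i)
    then show ?thesis
      using c by (cases "l = c") (simp_all add: sum_Q_mean_col Q_contrast_entry U_sum_col mid_def)
  qed
next
  case c: (contrast k i)
  show ?thesis using assms(2)
  proof (cases rule: col_cases)
    case d: mean
    have "(\<Sum>r<n. Q r c * Q r d) = (\<Sum>a<nb k. U k a i * Q (row_index k a) d)"
      unfolding c(3) by (rule sum_Q_contrast_col[OF c(1,2)])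
    also have "\<dots> = 0"
      using c d U_sum_col[OF c(1,2)] by (simp add: Q_mean_entry flip: sum_divide_distrib)
    finally show ?thesis using c d by (simp add: mid_def)
  next
    case d: (contrast l j)
    have "(\<Sum>r<n. Q r c * Q r d) = (if k = l \<and> i = j then 1 else 0)"
      unfolding c(3) d(3) sum_Q_contrast_col[OF c(1,2)]
      using c d by (cases "k = l") (simp_all add: Q_contrast_entry U_orthonormal)
    then show ?thesis using assms(1) c d by (simp add: mid_def col_eq_iff)
  qed
qed

lemma inverts_Q: "inverts n Q (mtranspose Q)"
  by (rule inverts_commute)
     (simp add: inverts_def mat_eq_def mmult_def mtranspose_def Q_cols_orthonormal)

lemma mapply_mtranspose_Q: "mapply n (mtranspose Q) z = Yv K nb U z"
  by (simp add: mapply_def mtranspose_def Yv_def)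

lemma U_outer_product:
  assumes "k < K" "a < nb k" "b < nb k"
  shows "(\<Sum>i<nb k - 1. U k a i * U k b i) = (if a = b then 1 else 0) - 1 / real (nb k)"
proof -
  have "mid n (row_index k a) (row_index k b) = (\<Sum>c<n. Q (row_index k a) c * Q (row_index k b) c)"
    using inverts_Q assms by (simp add: inverts_def mat_eq_def mmult_def mtranspose_def row_less)
  also have "\<dots> = 1 / real (nb k) + (\<Sum>i<nb k - 1. U k a i * U k b i)"
    unfolding sum_Q_row[OF assms(1,2)] using assms by (simp add: Q_mean_entry Q_contrast_entry)
  finally show ?thesis using assms by (simp add: mid_def row_less)
qed

subsection \<open>The canonical form\<close>

definition blockwise :: "(nat \<Rightarrow> real) \<Rightarrow> nat \<Rightarrow> real" where
  "blockwise l c = (\<Sum>k<K. if K + coff nb k \<le> c \<and> c < K + coff nb k + (nb k - 1) then l k else 0)"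

lemma blockwise_col: "k < K \<Longrightarrow> i < nb k - 1 \<Longrightarrow> blockwise l (col_index k i) = l k"
  using col_in_block_iff[of i k] by (simp add: blockwise_def)

lemma blockwise_pos:
  assumes "\<And>k. k < K \<Longrightarrow> l k > 0" "K \<le> c" "c < n" shows "blockwise l c > 0"
  using assms(3) by (cases rule: col_cases) (use assms in \<open>auto simp: blockwise_col\<close>)

definition Dmat :: "rmat \<Rightarrow> rmat" where
  "Dmat B = block_diag K B (blockwise (lam nb B))"

lemma Cmat_entry:
  assumes "k < K" "a < nb k" "l < K" "b < nb l"
  shows "Cmat K nb B (row_index k a) (row_index l b) = (if k = l \<and> a = b then 1 else rho nb B k l)"
proof -
  have "(\<Sum>k'<K. \<Sum>l'<K. if k' = k \<and> l' = l then rho nb B k' l' else 0)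
     = (\<Sum>k'<K. if k' = k then (\<Sum>l'<K. if l' = l then rho nb B k' l' else 0) else 0)"
    by (intro sum.cong refl) auto
  also have "\<dots> = rho nb B k l" using assms by simp
  finally show ?thesis
    unfolding Cmat_def using assms by (simp add: row_less inblk_row row_eq_iff)
qed

lemma Cmat_canonical: "Cmat K nb B =\<^bsub>n\<^esub> mmult n Q (mmult n (Dmat B) (mtranspose Q))"
proof (rule mat_eqI)
  fix r s assume "r < n" "s < n"
  then obtain k a l b where ka: "k < K" "a < nb k" "r = row_index k a"
    and lb: "l < K" "b < nb l" "s = row_index l b"
    by (metis row_cases)
  define X where "X = mapply n (Dmat B) (\<lambda>d. Q s d)"
  have X_mean: "X k = B k l / sqrt (real (nb l))"
  proof -
    have "X k = (\<Sum>d<K. B k d * Q s d)"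
      using K_le_n ka(1) by (simp add: X_def Dmat_def mapply_block_diag mapply_def[of K])
    also have "\<dots> = (\<Sum>d<K. if d = l then B k d / sqrt (real (nb l)) else 0)"
      using lb by (intro sum.cong refl) (simp add: Q_mean_entry)
    finally have "X k = (\<Sum>d<K. if d = l then B k d / sqrt (real (nb l)) else 0)" .
    then show ?thesis using lb by simp
  qed
  have X_contrast: "X (col_index k i) = (if k = l then lam nb B k * U k b i else 0)"
    if "i < nb k - 1" for i
    unfolding X_def Dmat_def using K_le_n ka lb that
    by (auto simp: mapply_block_diag col_less blockwise_col Q_contrast_entry)
  have "mmult n Q (mmult n (Dmat B) (mtranspose Q)) r s = (\<Sum>c<n. Q (row_index k a) c * X c)"
    by (simp add: X_def mmult_def mapply_def mtranspose_def ka(3))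
  also have "\<dots> = B k l / (sqrt (real (nb k)) * sqrt (real (nb l)))
      + (if k = l then lam nb B k * (\<Sum>i<nb k - 1. U k a i * U k b i) else 0)"
    unfolding sum_Q_row[OF ka(1,2)] by (simp add: X_mean X_contrast sum_distrib_left mult_ac)
  also have "\<dots> = (if k = l \<and> a = b then 1 else rho nb B k l)"
  proof (cases "k = l")
    case True
    then have outer: "(\<Sum>i<nb k - 1. U k a i * U k b i) = (if a = b then 1 else 0) - 1 / real (nb k)"
      using U_outer_product ka lb by simp
    show ?thesis
      unfolding outer using True real_nb_gt_1[OF ka(1)]
      by (auto simp: lam_def rho_def divide_simps) (auto simp: algebra_simps)
  next
    case False
    then show ?thesis by (simp add: rho_def real_sqrt_mult)
  qed
  finally show "Cmat K nb B r s = mmult n Q (mmult n (Dmat B) (mtranspose Q)) r s"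
    using ka lb Cmat_entry[of k a l b B] by simp
qed

definition admissible :: "rmat \<Rightarrow> bool" where
  "admissible B \<longleftrightarrow> spd K B \<and> (\<forall>k<K. lam nb B k > 0)"

lemma admissible_spd: "admissible B \<Longrightarrow> spd K B"
  and admissible_lam_pos: "admissible B \<Longrightarrow> k < K \<Longrightarrow> lam nb B k > 0"
  by (auto simp: admissible_def)

lemma mat_tendsto_lam:
  assumes "mat_tendsto K M A F" "k < K"
  shows "((\<lambda>x. lam nb (M x) k) \<longlongrightarrow> lam nb A k) F"
  unfolding lam_def using real_nb_gt_1[OF assms(2)]
  by (intro tendsto_divide tendsto_diff tendsto_const mat_tendstoD[OF assms(1)] assms(2)) auto

lemma eventually_admissible:
  assumes M: "mat_tendsto K M A F" and A: "admissible A" and sym: "eventually (\<lambda>x. msym K (M x)) F"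
  shows "eventually (\<lambda>x. admissible (M x)) F"
proof -
  have "eventually (\<lambda>x. \<forall>k\<in>{..<K}. lam nb (M x) k > 0) F"
    using admissible_lam_pos[OF A]
    by (intro eventually_ball_finite ballI order_tendstoD(1)[OF mat_tendsto_lam[OF M]]) auto
  with eventually_mpd[OF M admissible_spd[OF A]] sym show ?thesis
    by eventually_elim (auto simp: admissible_def spd_def)
qed

definition Dhalf :: "rmat \<Rightarrow> rmat" where
  "Dhalf B = block_diag K (msqrt K B) (\<lambda>c. sqrt (blockwise (lam nb B) c))"

definition Dhalf_inv :: "rmat \<Rightarrow> rmat" where
  "Dhalf_inv B = block_diag K (minv K (msqrt K B)) (\<lambda>c. 1 / sqrt (blockwise (lam nb B) c))"

context
  fixes B :: rmat
  assumes B: "admissible B"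
begin

lemma blockwise_lam_pos: "K \<le> c \<Longrightarrow> c < n \<Longrightarrow> blockwise (lam nb B) c > 0"
  by (rule blockwise_pos[OF admissible_lam_pos[OF B]])

lemma is_msqrt_Dhalf: "is_msqrt n (Dmat B) (Dhalf B)"
  unfolding Dmat_def Dhalf_def
  by (intro is_msqrt_block_diag K_le_n is_msqrt_msqrt admissible_spd[OF B] blockwise_lam_pos)

lemma inverts_Dhalf: "inverts n (Dhalf B) (Dhalf_inv B)"
  unfolding Dhalf_def Dhalf_inv_def
proof (rule inverts_block_diag[OF K_le_n spd_inverts_minv[OF spd_msqrt[OF admissible_spd[OF B]]]])
  fix c assume "K \<le> c" "c < n"
  then show "sqrt (blockwise (lam nb B) c) * (1 / sqrt (blockwise (lam nb B) c)) = 1"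
    using blockwise_lam_pos[of c] by simp
qed

lemma Lmat_eq_Q_Dhalf: "Lmat K nb U B =\<^bsub>n\<^esub> mmult n Q (Dhalf B)"
proof -
  have "is_msqrt n (Cmat K nb B) (mmult n Q (mmult n (Dhalf B) (mtranspose Q)))"
    using is_msqrt_orthogonal_conj[OF inverts_Q is_msqrt_Dhalf]
      is_msqrt_cong[OF Cmat_canonical mat_eq_refl] by blast
  then have "Lmat K nb U B =\<^bsub>n\<^esub> mmult n (mmult n Q (mmult n (Dhalf B) (mtranspose Q))) Q"
    unfolding Lmat_def by (intro mmult_cong msqrt_eqI mat_eq_refl)
  also have "\<dots> = mmult n Q (mmult n (Dhalf B) (mmult n (mtranspose Q) Q))"
    by (simp add: mmult_assoc)
  also have "\<dots> =\<^bsub>n\<^esub> mmult n Q (mmult n (Dhalf B) (mid n))"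
    using inverts_commute[OF inverts_Q] by (intro mmult_cong mat_eq_refl) (simp add: inverts_def)
  also have "\<dots> =\<^bsub>n\<^esub> mmult n Q (Dhalf B)" by (intro mmult_cong mat_eq_refl mmult_mid_right)
  finally show ?thesis .
qed

lemma minv_Lmat_eq: "minv n (Lmat K nb U B) =\<^bsub>n\<^esub> mmult n (Dhalf_inv B) (mtranspose Q)"
proof (rule minv_eqI)
  have "inverts n (mmult n Q (Dhalf B)) (mmult n (Dhalf_inv B) (mtranspose Q))"
    by (intro inverts_mmult inverts_Q inverts_Dhalf)
  then show "inverts n (Lmat K nb U B) (mmult n (Dhalf_inv B) (mtranspose Q))"
    using inverts_cong[OF Lmat_eq_Q_Dhalf mat_eq_refl] by blast
qed

lemma mdet_Lmat_square: "(mdet n (Lmat K nb U B))\<^sup>2 = mdet K B * (\<Prod>k<K. lam nb B k ^ (nb k - 1))"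
proof -
  have "(mdet n Q)\<^sup>2 = 1"
    using mdet_mult_inverse[OF inverts_Q] by (simp add: mdet_mtranspose power2_eq_square)
  then have "(mdet n (Lmat K nb U B))\<^sup>2 = (mdet n (Dhalf B))\<^sup>2"
    by (simp add: mdet_cong[OF Lmat_eq_Q_Dhalf] mdet_mmult power_mult_distrib)
  also have "\<dots> = mdet n (Dmat B)"
    using mdet_cong[OF is_msqrt_square[OF is_msqrt_Dhalf]]
    by (simp add: mdet_mmult power2_eq_square)
  also have "\<dots> = mdet K B * (\<Prod>i<coff nb K. blockwise (lam nb B) (K + i))"
    unfolding Dmat_def n_eq_coff by (rule mdet_block_diag)
  also have "(\<Prod>i<coff nb K. blockwise (lam nb B) (K + i))
      = (\<Prod>k<K. \<Prod>i<nb k - 1. blockwise (lam nb B) (col_index k i))"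
    by (simp add: coff_eq_block_offset prod.lessThan_block_offset add.assoc)
  also have "\<dots> = (\<Prod>k<K. lam nb B k ^ (nb k - 1))"
    by (intro prod.cong refl) (simp add: blockwise_col)
  finally show ?thesis .
qed

lemma mapply_minv_Lmat:
  assumes "c < n"
  shows "mapply n (minv n (Lmat K nb U B)) z c = mapply n (Dhalf_inv B) (Yv K nb U z) c"
  using mapply_cong[OF minv_Lmat_eq refl assms, of z]
  by (simp add: mapply_mmult mapply_mtranspose_Q)

lemma Yv_Lmat:
  assumes "c < n"
  shows "Yv K nb U (mapply n (Lmat K nb U B) v) c = mapply n (Dhalf B) v c"
proof -
  have "Yv K nb U (mapply n (Lmat K nb U B) v) c
      = mapply n (mtranspose Q) (mapply n (mmult n Q (Dhalf B)) v) c"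
    unfolding mapply_mtranspose_Q[symmetric]
    by (intro mapply_cong mat_eq_refl mapply_cong[OF Lmat_eq_Q_Dhalf] refl assms)
  also have "\<dots> = mapply n (Dhalf B) v c"
    unfolding mapply_mmult by (rule mapply_inverts_cancel[OF inverts_commute[OF inverts_Q] assms])
  finally show ?thesis .
qed

lemma mapply_minv_Lmat_mean: "i < K \<Longrightarrow> mapply n (minv n (Lmat K nb U B)) z i = X0 K nb U B z i"
  using K_le_n by (simp add: mapply_minv_Lmat Dhalf_inv_def mapply_block_diag X0_def
      mapply_def[of K])

lemma lam_powr_minus_half: "k < K \<Longrightarrow> lam nb B k powr - (1 / 2) = 1 / sqrt (lam nb B k)"
  using admissible_lam_pos[OF B, of k] powr_minus_divide[of "lam nb B k" "1 / 2"]
  by (simp add: powr_half_sqrt)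

lemma Xk_eq_Yv: "k < K \<Longrightarrow> Xk K nb U B z k i = Yv K nb U z (col_index k i) / sqrt (lam nb B k)"
  by (simp add: Xk_def lam_powr_minus_half)

lemma mapply_minv_Lmat_contrast:
  "k < K \<Longrightarrow> i < nb k - 1 \<Longrightarrow> mapply n (minv n (Lmat K nb U B)) z (col_index k i) = Xk K nb U B z k i"
  by (simp add: mapply_minv_Lmat Dhalf_inv_def mapply_block_diag K_le_n col_less blockwise_col
      Xk_eq_Yv)

lemma X0_Lmat: "i < K \<Longrightarrow> X0 K nb U B (mapply n (Lmat K nb U B) v) i = v i"
  using mapply_inverts_cancel[OF
      inverts_commute[OF spd_inverts_minv[OF spd_msqrt[OF admissible_spd[OF B]]]], of i v]
    K_le_n
  by (simp add: X0_def Yv_Lmat Dhalf_def mapply_block_diag mapply_def[of K "minv K (msqrt K B)"])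

lemma Xk_Lmat:
  "k < K \<Longrightarrow> i < nb k - 1 \<Longrightarrow> Xk K nb U B (mapply n (Lmat K nb U B) v) k i = v (col_index k i)"
  using admissible_lam_pos[OF B, of k]
  by (simp add: Xk_eq_Yv Yv_Lmat Dhalf_def mapply_block_diag K_le_n col_less blockwise_col)

end

end

section \<open>The score\<close>

locale t_setting = block_setting +
  fixes \<nu>0 :: real and \<nu> :: "nat \<Rightarrow> real"
  assumes nu0_gt_2: "\<nu>0 > 2" and nu_gt_2: "\<And>k. k < K \<Longrightarrow> \<nu> k > 2"
begin

definition Yblock :: "(nat \<Rightarrow> real) \<Rightarrow> nat \<Rightarrow> nat \<Rightarrow> real" where
  "Yblock z k = (\<lambda>i. Yv K nb U z (col_index k i))"

definition lam_mid :: "rmat \<Rightarrow> nat \<Rightarrow> rmat" where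
  "lam_mid B k = scaled_mid (nb k - 1) (lam nb B k)"

lemma spd_lam_mid: "admissible B \<Longrightarrow> k < K \<Longrightarrow> spd (nb k - 1) (lam_mid B k)"
  unfolding lam_mid_def by (rule spd_scaled_mid[OF admissible_lam_pos])

lemma X0_eq_mapply: "X0 K nb U B z = mapply K (minv K (msqrt K B)) (Yv K nb U z)"
  by (simp add: X0_def mapply_def)

lemma X0sq_eq_dot: "X0sq K nb U B z = dot K (X0 K nb U B z) (X0 K nb U B z)"
  by (simp add: X0sq_def dot_def power2_eq_square)

lemma Xksq_eq_dot:
  assumes B: "admissible B" and k: "k < K"
  shows "Xksq K nb U B z k = dot (nb k - 1) (Yblock z k) (Yblock z k) / lam nb B k"
  using admissible_lam_pos[OF assms]
  by (simp add: Xksq_def Xk_eq_Yv[OF assms] Yblock_def dot_def power_divide power2_eq_square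
      sum_divide_distrib)

subsection \<open>Factorization of the density\<close>

lemma fV_eq_prod_tstd_density:
  "fV K nb \<nu>0 \<nu> v = tstd_density \<nu>0 K (mid K) v
     * (\<Prod>k<K. tstd_density (\<nu> k) (nb k - 1) (mid (nb k - 1)) (\<lambda>i. v (col_index k i)))"
  unfolding fV_def by (intro arg_cong2[where f = times] prod.cong refl tstd_density_cong) auto

lemma tstd_density_Yblock:
  assumes B: "admissible B" and k: "k < K"
  shows "tstd_density (\<nu> k) (nb k - 1) (lam_mid B k) (Yblock z k)
    = tstd_density (\<nu> k) (nb k - 1) (mid (nb k - 1)) (Xk K nb U B z k)
      * (lam nb B k ^ (nb k - 1)) powr (- 1 / 2)"
proof -
  let ?m = "nb k - 1" and ?l = "lam nb B k"
  have l: "?l > 0" by (rule admissible_lam_pos[OF assms])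
  have "is_msqrt ?m (lam_mid B k) (scaled_mid ?m (sqrt ?l))"
    unfolding lam_mid_def by (rule is_msqrt_scaled_mid[OF l])
  then have "inverts ?m (msqrt ?m (lam_mid B k)) (scaled_mid ?m (1 / sqrt ?l))"
    using inverts_scaled_mid[of "sqrt ?l" ?m] inverts_cong[OF msqrt_eqI mat_eq_refl] l by auto
  then have "mapply ?m (minv ?m (msqrt ?m (lam_mid B k))) (Yblock z k) i = Xk K nb U B z k i"
    if "i < ?m" for i
    using mapply_cong[OF minv_eqI refl that] that
    by (simp add: mapply_scaled_mid Yblock_def Xk_eq_Yv[OF assms])
  then have "tstd_density (\<nu> k) ?m (mid ?m)
        (mapply ?m (minv ?m (msqrt ?m (lam_mid B k))) (Yblock z k))
      = tstd_density (\<nu> k) ?m (mid ?m) (Xk K nb U B z k)"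
    by (rule tstd_density_cong)
  then show ?thesis
    unfolding tstd_density_standardize[OF spd_lam_mid[OF assms]]
    by (simp add: lam_mid_def mdet_scaled_mid)
qed

lemma inverse_abs_mdet_Lmat:
  assumes B: "admissible B"
  shows "1 / \<bar>mdet n (Lmat K nb U B)\<bar>
    = mdet K B powr (- 1 / 2) * (\<Prod>k<K. (lam nb B k ^ (nb k - 1)) powr (- 1 / 2))"
proof -
  let ?d = "mdet n (Lmat K nb U B)"
  have "1 / \<bar>?d\<bar> = (?d\<^sup>2) powr (- 1 / 2)"
    using powr_minus_divide[of "?d\<^sup>2" "1 / 2"] by (simp add: powr_half_sqrt)
  also have "\<dots> = mdet K B powr (- 1 / 2) * (\<Prod>k<K. lam nb B k ^ (nb k - 1)) powr (- 1 / 2)"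
    unfolding mdet_Lmat_square[OF B] by (rule powr_mult)
  also have "(\<Prod>k<K. lam nb B k ^ (nb k - 1)) powr (- 1 / 2)
      = (\<Prod>k<K. (lam nb B k ^ (nb k - 1)) powr (- 1 / 2))"
    by (rule prod_powr_distrib)
  finally show ?thesis .
qed

lemma fZ_eq_prod_tstd_density:
  assumes B: "admissible B"
  shows "fZ K nb U \<nu>0 \<nu> B z = tstd_density \<nu>0 K B (Yv K nb U z)
    * (\<Prod>k<K. tstd_density (\<nu> k) (nb k - 1) (lam_mid B k) (Yblock z k))"
proof -
  let ?v = "mapply n (minv n (Lmat K nb U B)) z"
  let ?g = "tstd_density \<nu>0 K (mid K) (X0 K nb U B z)"
  let ?f = "\<lambda>k. tstd_density (\<nu> k) (nb k - 1) (mid (nb k - 1)) (Xk K nb U B z k)"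
  have "fV K nb \<nu>0 \<nu> ?v = ?g * (\<Prod>k<K. ?f k)"
    unfolding fV_eq_prod_tstd_density
    by (intro arg_cong2[where f = times] prod.cong refl tstd_density_cong)
       (auto simp: mapply_minv_Lmat_mean[OF B] mapply_minv_Lmat_contrast[OF B])
  then have "fZ K nb U \<nu>0 \<nu> B z = ?g * (\<Prod>k<K. ?f k) * (1 / \<bar>mdet n (Lmat K nb U B)\<bar>)"
    by (simp add: fZ_def)
  also have "\<dots> = (?g * mdet K B powr (- 1 / 2))
      * (\<Prod>k<K. ?f k * (lam nb B k ^ (nb k - 1)) powr (- 1 / 2))"
    unfolding inverse_abs_mdet_Lmat[OF B] prod.distrib by (simp only: mult_ac)
  also have "?g * mdet K B powr (- 1 / 2) = tstd_density \<nu>0 K B (Yv K nb U z)"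
    unfolding tstd_density_standardize[OF admissible_spd[OF B]] X0_eq_mapply ..
  also have "(\<Prod>k<K. ?f k * (lam nb B k ^ (nb k - 1)) powr (- 1 / 2))
      = (\<Prod>k<K. tstd_density (\<nu> k) (nb k - 1) (lam_mid B k) (Yblock z k))"
    by (intro prod.cong refl tstd_density_Yblock[OF B, symmetric]) simp
  finally show ?thesis .
qed

lemma loglik_eq_sum_ln_tstd_density:
  assumes B: "admissible B"
  shows "loglik K nb U \<nu>0 \<nu> B z = ln (tstd_density \<nu>0 K B (Yv K nb U z))
    + (\<Sum>k<K. ln (tstd_density (\<nu> k) (nb k - 1) (lam_mid B k) (Yblock z k)))"
proof -
  let ?g = "tstd_density \<nu>0 K B (Yv K nb U z)"
  let ?f = "\<lambda>k. tstd_density (\<nu> k) (nb k - 1) (lam_mid B k) (Yblock z k)"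
  have g_pos: "?g > 0" by (rule tstd_density_pos[OF nu0_gt_2 admissible_spd[OF B]])
  have f_pos: "?f k > 0" if "k < K" for k
    using that by (intro tstd_density_pos nu_gt_2 spd_lam_mid[OF B])
  have "loglik K nb U \<nu>0 \<nu> B z = ln ?g + ln (\<Prod>k<K. ?f k)"
    unfolding loglik_def fZ_eq_prod_tstd_density[OF B] using g_pos f_pos
    by (intro ln_mult_pos prod_pos) auto
  also have "ln (\<Prod>k<K. ?f k) = (\<Sum>k<K. ln (?f k))"
    using f_pos by (intro ln_prod) (auto simp: less_imp_neq[symmetric])
  finally show ?thesis .
qed

subsection \<open>The score in terms of t scores\<close>

lemma score_vec_index:
  assumes B: "admissible B" and ij: "i < K" "j < K"
  defines "N \<equiv> minv K (msqrt K B)"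
  shows "score K nb U \<nu>0 \<nu> B z (i + K * j) =
    1 / 2 * (\<Sum>a<K. \<Sum>b<K. N i a * N j b *
       (W0 K nb U \<nu>0 B z * (X0 K nb U B z a * X0 K nb U B z b) - mid K a b))
    + 1 / 2 * (if i = j then Svec K nb U \<nu> B z i else 0)"
proof -
  have "(\<Sum>k<K. Ed K k (i + K * j) * Svec K nb U \<nu> B z k)
      = (\<Sum>k<K. if k = i then (if i = j then Svec K nb U \<nu> B z k else 0) else 0)"
    using ij by (intro sum.cong refl) (auto simp: Ed_index)
  also have "\<dots> = (if i = j then Svec K nb U \<nu> B z i else 0)" using ij by simp
  finally have diagonal: "(\<Sum>k<K. Ed K k (i + K * j) * Svec K nb U \<nu> B z k) = \<dots>" .
  have Aot: "Aot_invsqrt K B (i + K * j) (a + K * b) = N j b * N i a" if "a < K" "b < K" for a b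
    using mat_eqD[OF Aot_invsqrt_eq_kron[OF admissible_spd[OF B]]] ij that
    by (simp add: vec_index_less kron_index N_def)
  have "(\<Sum>q<K * K. Aot_invsqrt K B (i + K * j) q *
        (W0 K nb U \<nu>0 B z * vecm K (\<lambda>i j. X0 K nb U B z i * X0 K nb U B z j) q - vecm K (mid K) q))
     = (\<Sum>b<K. \<Sum>a<K. N i a * N j b *
       (W0 K nb U \<nu>0 B z * (X0 K nb U B z a * X0 K nb U B z b) - mid K a b))"
    unfolding sum_vec_index by (intro sum.cong refl) (simp add: Aot vecm_index)
  then show ?thesis unfolding score_def diagonal by (subst sum.swap) simp
qed

lemma score_eq_t_score:
  assumes B: "admissible B" and ij: "i < K" "j < K"
  shows "score K nb U \<nu>0 \<nu> B z (i + K * j)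
    = t_score \<nu>0 K B (Yv K nb U z) i j + (if i = j then 1 / 2 * Svec K nb U \<nu> B z i else 0)"
  unfolding score_vec_index[OF assms] t_score_standardized[OF admissible_spd[OF B] ij]
  by (simp add: W0_def X0sq_eq_dot flip: X0_eq_mapply)

lemma half_Svec_eq_sum_t_score:
  assumes B: "admissible B" and k: "k < K"
  shows "1 / 2 * Svec K nb U \<nu> B z k = - 1 / (real (nb k) - 1)
    * (\<Sum>i<nb k - 1. t_score (\<nu> k) (nb k - 1) (lam_mid B k) (Yblock z k) i i)"
proof -
  have W: "Wk K nb U \<nu> B z k = (\<nu> k + (real (nb k) - 1)) / (\<nu> k - 2 + Xksq K nb U B z k)"
    by (simp add: Wk_def)
  have factor: "1 / 2 * (1 / l - w * x / (l * m)) = - 1 / m * (1 / 2 * (w * x - m) / l)"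
    if "l > 0" "m > 0" for l m w x :: real
    using that by (simp add: field_simps)
  show ?thesis
    unfolding lam_mid_def sum_diag_t_score_scaled_mid[OF admissible_lam_pos[OF assms]]
      Xksq_eq_dot[OF assms, symmetric] real_nb_diff[OF k] Svec_def W
    by (rule factor) (use admissible_lam_pos[OF assms] real_nb_gt_1[OF k] in auto)
qed

lemma score_sym:
  assumes A: "admissible A" and p: "p < K * K"
  shows "score K nb U \<nu>0 \<nu> A z p = score K nb U \<nu>0 \<nu> A z (p div K + K * (p mod K))"
proof -
  obtain i j where "i < K" "j < K" "p = i + K * j" by (rule vec_index_cases[OF p])
  then show ?thesis
    using msymD[OF msym_t_score[OF admissible_spd[OF A]], of i j]
    by (simp add: score_eq_t_score[OF A])
qed

subsection \<open>The gradient of the log-likelihood\<close>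

lemma has_mat_derivative_lam_mid:
  assumes "k < K"
  shows "has_mat_derivative (nb k - 1) (\<lambda>s. lam_mid (mat_segment A B s) k)
    (scaled_mid (nb k - 1) (- (B k k - A k k) / (real (nb k) - 1))) t"
  unfolding has_mat_derivative_def lam_mid_def scaled_mid_def lam_def mat_segment_def
  using real_nb_gt_1[OF assms] by (auto intro!: derivative_eq_intros)

lemma DERIV_ln_tstd_density_Yblock:
  assumes adm: "admissible (mat_segment A B t)" and k: "k < K"
  shows "((\<lambda>s. ln (tstd_density (\<nu> k) (nb k - 1) (lam_mid (mat_segment A B s) k) (Yblock z k)))
    has_real_derivative 1 / 2 * Svec K nb U \<nu> (mat_segment A B t) z k * (B k k - A k k)) (at t)"
proof -
  let ?m = "nb k - 1" and ?h = "- (B k k - A k k) / (real (nb k) - 1)"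
  let ?T = "t_score (\<nu> k) ?m (lam_mid (mat_segment A B t) k) (Yblock z k)"
  have row: "(\<Sum>j<?m. ?T i j * scaled_mid ?m ?h i j) = ?T i i * ?h" if "i < ?m" for i
    using sum_mid_mult[OF that, of "\<lambda>j. ?T i j * ?h"] by (simp add: scaled_mid_def mult_ac)
  have rescale: "x * (- d / m) = - 1 / m * x * d" for x d m :: real by simp
  have "(\<Sum>i<?m. \<Sum>j<?m. ?T i j * scaled_mid ?m ?h i j) = (\<Sum>i<?m. ?T i i) * ?h"
    unfolding sum_distrib_right by (intro sum.cong refl row) simp
  also have "\<dots> = 1 / 2 * Svec K nb U \<nu> (mat_segment A B t) z k * (B k k - A k k)"
    unfolding half_Svec_eq_sum_t_score[OF adm k] by (rule rescale)
  finally have "(\<Sum>i<?m. \<Sum>j<?m. ?T i j * scaled_mid ?m ?h i j) = \<dots>" .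
  then show ?thesis
    by (rule DERIV_cong[OF DERIV_ln_tstd_density[OF nu_gt_2[OF k] has_mat_derivative_lam_mid[OF k]
          spd_lam_mid[OF adm k]]])
qed

lemma DERIV_loglik_segment:
  assumes A: "msym K A" "msym K B" and adm: "admissible (mat_segment A B t)"
  shows "((\<lambda>s. loglik K nb U \<nu>0 \<nu> (mat_segment A B s) z) has_real_derivative
     (\<Sum>p<K * K. score K nb U \<nu>0 \<nu> (mat_segment A B t) z p * (vecm K B p - vecm K A p))) (at t)"
proof -
  let ?M = "mat_segment A B" and ?H = "\<lambda>i j. B i j - A i j"
  let ?T = "t_score \<nu>0 K (?M t) (Yv K nb U z)" and ?S = "Svec K nb U \<nu> (?M t) z"
  let ?ell = "\<lambda>s. ln (tstd_density \<nu>0 K (?M s) (Yv K nb U z))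
    + (\<Sum>k<K. ln (tstd_density (\<nu> k) (nb k - 1) (lam_mid (?M s) k) (Yblock z k)))"
  have "(?ell has_real_derivative (\<Sum>i<K. \<Sum>j<K. ?T i j * ?H i j)
      + (\<Sum>k<K. 1 / 2 * ?S k * ?H k k)) (at t)"
    by (intro DERIV_add DERIV_sum DERIV_ln_tstd_density_Yblock[OF adm]
        DERIV_ln_tstd_density[OF nu0_gt_2 has_mat_derivative_mat_segment
          admissible_spd[OF adm]]) auto
  also have "(\<Sum>k<K. 1 / 2 * ?S k * ?H k k)
      = (\<Sum>i<K. \<Sum>j<K. (if i = j then 1 / 2 * ?S i else 0) * ?H i j)"
    by (simp add: if_distrib[of "\<lambda>x. x * _"] cong: if_cong)
  also have "(\<Sum>i<K. \<Sum>j<K. ?T i j * ?H i j) + \<dots>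
      = (\<Sum>i<K. \<Sum>j<K. score K nb U \<nu>0 \<nu> (?M t) z (i + K * j) * ?H i j)"
    unfolding sum.distrib[symmetric] distrib_right[symmetric]
    by (intro sum.cong refl) (simp add: score_eq_t_score[OF adm])
  also have "\<dots> = (\<Sum>p<K * K. score K nb U \<nu>0 \<nu> (?M t) z p * (vecm K B p - vecm K A p))"
    unfolding sum_vec_index by (subst sum.swap) (simp add: vecm_index)
  finally have ell_deriv: "(?ell has_real_derivative
      (\<Sum>p<K * K. score K nb U \<nu>0 \<nu> (?M t) z p * (vecm K B p - vecm K A p))) (at t)" .
  have "eventually (\<lambda>s. admissible (?M s)) (nhds t)"
    by (rule eventually_admissible[OF
          mat_tendsto_if_has_mat_derivative[OF has_mat_derivative_mat_segment] adm])
       (simp add: msym_mat_segment A)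
  then have "eventually (\<lambda>s. loglik K nb U \<nu>0 \<nu> (?M s) z = ?ell s) (nhds t)"
    by eventually_elim (rule loglik_eq_sum_ln_tstd_density)
  then show ?thesis using ell_deriv by (subst DERIV_cong_ev[OF refl _ refl])
qed

lemma tendsto_score:
  assumes A: "admissible A" and p: "p < K * K"
  shows "((\<lambda>B. score K nb U \<nu>0 \<nu> B z p) \<longlongrightarrow> score K nb U \<nu>0 \<nu> A z p) (sym_nhds K A)"
proof -
  obtain i j where ij: "i < K" "j < K" "p = i + K * j" by (rule vec_index_cases[OF p])
  let ?F = "sym_nhds K A"
  let ?S = "\<lambda>B. - 1 / (real (nb i) - 1)
    * (\<Sum>a<nb i - 1. t_score (\<nu> i) (nb i - 1) (lam_mid B i) (Yblock z i) a a)"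
  let ?s = "\<lambda>B. t_score \<nu>0 K B (Yv K nb U z) i j + (if i = j then ?S B else 0)"
  have score: "score K nb U \<nu>0 \<nu> B z p = ?s B" if "admissible B" for B
    unfolding ij(3) score_eq_t_score[OF that ij(1,2)] half_Svec_eq_sum_t_score[OF that ij(1)] ..
  have lam_mid_lim: "mat_tendsto (nb i - 1) (\<lambda>B. lam_mid B i) (lam_mid A i) ?F"
    unfolding mat_tendsto_def lam_mid_def scaled_mid_def
    by (intro allI impI tendsto_mult tendsto_const mat_tendsto_lam[OF mat_tendsto_sym_nhds ij(1)])
  have "(?S \<longlongrightarrow> ?S A) ?F"
    by (intro tendsto_mult tendsto_const tendsto_sum
        mat_tendstoD[OF mat_tendsto_t_score[OF nu_gt_2[OF ij(1)] lam_mid_lim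
          spd_lam_mid[OF A ij(1)]]]) auto
  then have "((\<lambda>B. if i = j then ?S B else 0) \<longlongrightarrow> (if i = j then ?S A else 0)) ?F"
    by (cases "i = j") (simp_all only: simp_thms if_True if_False tendsto_const)
  then have "(?s \<longlongrightarrow> ?s A) ?F"
    by (intro tendsto_add
        mat_tendstoD[OF mat_tendsto_t_score[OF nu0_gt_2 mat_tendsto_sym_nhds
          admissible_spd[OF A]]] ij)
  moreover have "eventually (\<lambda>B. ?s B = score K nb U \<nu>0 \<nu> B z p) ?F"
    using eventually_admissible[OF mat_tendsto_sym_nhds A eventually_msym_sym_nhds]
    by eventually_elim (rule score[symmetric])
  ultimately show ?thesis unfolding score[OF A] by (rule Lim_transform_eventually)
qed

lemma loglik_has_sym_grad:
  assumes A: "admissible A"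
  shows "has_sym_grad K (\<lambda>B. loglik K nb U \<nu>0 \<nu> B z) A (score K nb U \<nu>0 \<nu> A z)"
proof (rule has_sym_gradI[where g = "\<lambda>B. score K nb U \<nu>0 \<nu> B z" and P = admissible])
  show A_sym: "msym K A" using admissible_spd[OF A] by (simp add: spd_def)
  show "eventually admissible (sym_nhds K A)"
    by (rule eventually_admissible[OF mat_tendsto_sym_nhds A eventually_msym_sym_nhds])
qed (use A in \<open>auto intro: DERIV_loglik_segment tendsto_score simp: admissible_def spd_def\<close>)

end

section \<open>The information matrix\<close>

lemma t_weight_depends_on: "depends_on J (t_weight J \<nu>)"
  and t_density_on_depends_on: "depends_on J (t_density_on J \<nu>)"
  by (simp_all add: depends_on_def t_weight_def t_density_on_def sum_sq_def)

lemma t_form_depends_on: "depends_on J (t_form J \<nu> M)"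
  using t_weight_depends_on[of J \<nu>] by (simp add: depends_on_def t_form_def t_centered_def)

lemma t_form_diagonal:
  assumes "finite J"
  shows "t_form J \<nu> (\<lambda>a b. c * of_bool (a = b)) v
      = c * (t_weight J \<nu> v * sum_sq J v - real (card J))"
proof -
  have "t_form J \<nu> (\<lambda>a b. c * of_bool (a = b)) v
      = (\<Sum>a\<in>J. \<Sum>b\<in>J. c * t_centered J \<nu> a b v * of_bool (a = b))"
    by (simp add: t_form_def mult_ac)
  also have "\<dots> = (\<Sum>a\<in>J. c * t_centered J \<nu> a a v)" by (rule sum_delta_diagonal[OF assms])
  finally show ?thesis
    by (simp add: t_centered_def sum_sq_def sum_distrib_left sum_subtractf right_diff_distrib
        power2_eq_square mult_ac)
qed

lemma t_form_diagonal_variance: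
  assumes J: "finite J" "\<nu> > 2"
  shows "has_t_expectation J \<nu>
     (\<lambda>v. t_form J \<nu> (\<lambda>a b. c * of_bool (a = b)) v * t_form J \<nu> (\<lambda>a b. c * of_bool (a = b)) v)
     ((t_phi J \<nu> - 1) * (c * real (card J))\<^sup>2 + 2 * t_phi J \<nu> * (c\<^sup>2 * real (card J)))"
proof -
  have "(\<Sum>a\<in>J. \<Sum>b\<in>J. c * of_bool (a = b) * (c * of_bool (a = b))) = c\<^sup>2 * real (card J)"
    using sum_delta_diagonal[OF J(1), of "\<lambda>a b. c * c"]
    by (simp add: power2_eq_square of_bool_def if_distrib cong: if_cong)
  then show ?thesis
    using t_form_cov[OF J, of "\<lambda>a b. c * of_bool (a = b)" "\<lambda>a b. c * of_bool (a = b)"]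
    by (simp add: eq_commute power2_eq_square algebra_simps)
qed

context t_setting
begin

text \<open>Block 0 carries the coordinates of \<open>V\<^sub>0\<close>, block \<open>Suc k\<close> those of \<open>V\<^sub>k\<close>.\<close>

definition coords :: "nat \<Rightarrow> nat set" where
  "coords b = (case b of 0 \<Rightarrow> {..<K} | Suc k \<Rightarrow> (\<lambda>i. col_index k i) ` {..<nb k - 1})"

definition dof :: "nat \<Rightarrow> real" where
  "dof b = (case b of 0 \<Rightarrow> \<nu>0 | Suc k \<Rightarrow> \<nu> k)"

lemma dof_simps [simp]: "dof 0 = \<nu>0" "dof (Suc k) = \<nu> k"
  by (simp_all add: dof_def)

lemma dof_gt_2: "b < Suc K \<Longrightarrow> dof b > 2"
  using nu0_gt_2 nu_gt_2 by (cases b) auto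

lemma finite_coords [simp]: "finite (coords b)"
  by (cases b) (auto simp: coords_def)

lemma card_coords [simp]: "card (coords 0) = K" "card (coords (Suc k)) = nb k - 1"
  by (auto simp: coords_def card_image inj_on_def)

lemma sum_coords:
  "sum f (coords 0) = sum f {..<K}"
  "sum f (coords (Suc k)) = (\<Sum>i<nb k - 1. f (col_index k i))"
  by (auto simp: coords_def sum.reindex inj_on_def)

lemma disjoint_family_on_coords: "disjoint_family_on coords {..<Suc K}"
proof -
  have "coords 0 \<inter> coords (Suc k) = {}" for k by (auto simp: coords_def)
  moreover have "coords (Suc k) \<inter> coords (Suc l) = {}" if "k \<noteq> l" for k l
    using that col_eq_iff[of _ k _ l] by (auto simp: coords_def)
  ultimately have "coords b \<inter> coords c = {}" if "b \<noteq> c" for b c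
    using that by (cases b; cases c) (auto simp: Int_commute)
  then show ?thesis by (simp add: disjoint_family_on_def)
qed

lemma UN_coords: "(\<Union>b<Suc K. coords b) = {..<n}"
proof (intro equalityI subsetI)
  fix c assume "c \<in> (\<Union>b<Suc K. coords b)"
  then obtain b where b: "b < Suc K" "c \<in> coords b" by auto
  then show "c \<in> {..<n}" using K_le_n col_less by (cases b) (auto simp: coords_def)
next
  fix c assume "c \<in> {..<n}"
  then have "c < n" by simp
  then show "c \<in> (\<Union>b<Suc K. coords b)"
  proof (cases rule: col_cases)
    case mean then show ?thesis by (intro UN_I[of 0]) (auto simp: coords_def)
  next
    case (contrast k i) then show ?thesis by (intro UN_I[of "Suc k"]) (auto simp: coords_def)
  qed
qed

lemma fV_eq_prod_t_density_on: "fV K nb \<nu>0 \<nu> v = (\<Prod>b<Suc K. t_density_on (coords b) (dof b) v)"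
  unfolding prod.lessThan_Suc_shift fV_eq_prod_tstd_density tstd_density_mid
  by (simp add: t_density_on_def dot_def sum_sq_def sum_coords power2_eq_square del: of_nat_diff)

abbreviation has_expectation :: "((nat \<Rightarrow> real) \<Rightarrow> real) \<Rightarrow> real \<Rightarrow> bool" where
  "has_expectation f x \<equiv> has_bochner_integral (lborel_on {..<n}) (\<lambda>v. f v * fV K nb \<nu>0 \<nu> v) x"

lemma has_expectation_prod_blocks:
  assumes f: "\<And>b. b < Suc K \<Longrightarrow>
      has_t_expectation (coords b) (dof b) (f b) (x b)"
    and dep: "\<And>b. b < Suc K \<Longrightarrow> depends_on (coords b) (f b)"
  shows "has_expectation (\<lambda>v. \<Prod>b<Suc K. f b v) (\<Prod>b<Suc K. x b)"
  unfolding fV_eq_prod_t_density_on prod.distrib[symmetric] UN_coords[symmetric]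
  using f dep
  by (intro lborel_prod.has_bochner_integral_prod_disjoint disjoint_family_on_coords)
     (auto intro: depends_on_mult t_density_on_depends_on)

lemma has_expectation_block:
  assumes b: "b < Suc K"
    and f: "has_t_expectation (coords b) (dof b) f x"
    and dep: "depends_on (coords b) f"
  shows "has_expectation f x"
proof -
  have "has_expectation (\<lambda>v. \<Prod>c<Suc K. if c = b then f v else 1)
      (\<Prod>c<Suc K. if c = b then x else 1)"
    by (rule has_expectation_prod_blocks)
       (use f dep in \<open>auto simp: has_bochner_integral_t_density_on[OF finite_coords dof_gt_2]
          intro: depends_on_if depends_on_const\<close>)
  then show ?thesis using b by (simp only: prod.delta finite_lessThan lessThan_iff if_True)
qed

lemma has_expectation_two_blocks:
  assumes bc: "b < Suc K" "c < Suc K" "b \<noteq> c"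
    and f: "has_t_expectation (coords b) (dof b) f x"
      "depends_on (coords b) f"
    and g: "has_t_expectation (coords c) (dof c) g y"
      "depends_on (coords c) g"
  shows "has_expectation (\<lambda>v. f v * g v) (x * y)"
proof -
  have "has_expectation (\<lambda>v. \<Prod>d<Suc K. (if d = b then f v else 1) * (if d = c then g v else 1))
      (\<Prod>d<Suc K. (if d = b then x else 1) * (if d = c then y else 1))"
    by (rule has_expectation_prod_blocks)
       (use f g bc in \<open>auto simp: has_bochner_integral_t_density_on[OF finite_coords dof_gt_2]
          intro!: depends_on_mult depends_on_if depends_on_const\<close>)
  then show ?thesis using bc
    by (simp only: prod.distrib prod.delta finite_lessThan lessThan_iff if_True)
qed

lemma t_forms_uncorrelated:
  assumes "b < Suc K" "c < Suc K" "b \<noteq> c"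
  shows "has_expectation (\<lambda>v. t_form (coords b) (dof b) M v * t_form (coords c) (dof c) N v) 0"
  using has_expectation_two_blocks[OF assms t_form_mean t_form_depends_on t_form_mean
      t_form_depends_on]
    assms dof_gt_2 by simp

context
  fixes A :: rmat
  assumes A: "admissible A"
begin

definition mean_form :: "nat \<Rightarrow> nat \<Rightarrow> (nat \<Rightarrow> real) \<Rightarrow> real" where
  "mean_form i j = t_form (coords 0) \<nu>0 (\<lambda>a b. minv K (msqrt K A) i a * minv K (msqrt K A) j b)"

definition contrast_form :: "nat \<Rightarrow> (nat \<Rightarrow> real) \<Rightarrow> real" where
  "contrast_form k = t_form (coords (Suc k)) (\<nu> k)
     (\<lambda>a b. - 1 / (lam nb A k * (real (nb k) - 1)) * of_bool (a = b))"

lemma contrast_form_eq_Svec: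
  assumes k: "k < K"
  shows "contrast_form k v = Svec K nb U \<nu> A (mapply n (Lmat K nb U A) v) k"
proof -
  let ?z = "mapply n (Lmat K nb U A) v"
  have Xksq: "Xksq K nb U A ?z k = sum_sq (coords (Suc k)) v"
    unfolding Xksq_def sum_sq_def sum_coords using k
    by (intro sum.cong refl) (simp add: Xk_Lmat[OF A])
  have Wk: "Wk K nb U \<nu> A ?z k = t_weight (coords (Suc k)) (\<nu> k) v"
    unfolding Wk_def t_weight_def Xksq card_coords real_nb_diff[OF k] by (simp add: add_diff_eq)
  have "lam nb A k > 0" "real (nb k) - 1 > 0"
    using admissible_lam_pos[OF A k] real_nb_gt_1[OF k] by auto
  then show ?thesis
    unfolding contrast_form_def t_form_diagonal[OF finite_coords] Svec_def Xksq Wk card_coords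
      real_nb_diff[OF k]
    by (simp add: field_simps)
qed

lemma score_Lmat:
  assumes ij: "i < K" "j < K"
  shows "score K nb U \<nu>0 \<nu> A (mapply n (Lmat K nb U A) v) (i + K * j)
    = 1 / 2 * mean_form i j v + 1 / 2 * (if i = j then contrast_form i v else 0)"
proof -
  let ?z = "mapply n (Lmat K nb U A) v"
  have "X0sq K nb U A ?z = sum_sq (coords 0) v"
    by (simp add: X0sq_def sum_sq_def sum_coords X0_Lmat[OF A])
  then have "W0 K nb U \<nu>0 A ?z = t_weight (coords 0) \<nu>0 v" by (simp add: W0_def t_weight_def)
  then show ?thesis
    unfolding score_vec_index[OF A ij] contrast_form_eq_Svec[OF ij(1)] mean_form_def
      t_form_def t_centered_def sum_coords
    by (simp add: X0_Lmat[OF A] mid_def of_bool_def)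
qed

lemma mean_form_cov:
  assumes idx: "i < K" "j < K" "k < K" "l < K"
  shows "has_expectation (\<lambda>v. mean_form i j v * mean_form k l v)
     (phi0 K \<nu>0 * (minv K A j l * minv K A i k + minv K A j k * minv K A i l)
       + (phi0 K \<nu>0 - 1) * minv K A i j * minv K A k l)"
proof -
  let ?N = "minv K (msqrt K A)" and ?J = "coords 0"
  note N_sym = msymD[OF spd_msym_minv[OF spd_msqrt[OF admissible_spd[OF A]]]]
  have minv_square: "(\<Sum>a<K. ?N p a * ?N q a) = minv K A p q" if "p < K" "q < K" for p q
    using mat_eqD[OF mmult_minv_msqrt[OF admissible_spd[OF A]] that] that N_sym
    by (simp add: mmult_def)
  have trace: "(\<Sum>a\<in>?J. ?N p a * ?N q a) = minv K A p q" if "p < K" "q < K" for p q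
    using minv_square[OF that] by (simp add: sum_coords)
  have "(\<Sum>a\<in>?J. \<Sum>b\<in>?J. ?N i a * ?N j b * (?N p a * ?N q b))
      = (\<Sum>a\<in>?J. ?N i a * ?N p a) * (\<Sum>b\<in>?J. ?N j b * ?N q b)"
    for p q
    unfolding sum_product by (intro sum.cong refl) (simp only: mult_ac)
  then have inner: "(\<Sum>a\<in>?J. \<Sum>b\<in>?J. ?N i a * ?N j b * (?N p a * ?N q b))
      = minv K A i p * minv K A j q"
    if "p < K" "q < K" for p q
    using that idx by (simp add: trace)
  have cross: "(\<Sum>a\<in>?J. \<Sum>b\<in>?J. ?N i a * ?N j b * (?N k b * ?N l a)) = minv K A i l * minv K A j k"
    using inner[OF idx(4,3)] by (simp add: mult.commute[of "?N k _"])
  have "has_t_expectation ?J \<nu>0 (\<lambda>v. mean_form i j v * mean_form k l v)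
      ((phi0 K \<nu>0 - 1) * (minv K A i j * minv K A k l)
        + phi0 K \<nu>0 * (minv K A i k * minv K A j l + minv K A i l * minv K A j k))"
    using t_form_cov[OF finite_coords nu0_gt_2, of 0 "\<lambda>a b. ?N i a * ?N j b"
        "\<lambda>a b. ?N k a * ?N l b"]
    by (simp only: mean_form_def t_phi_def phi0_def card_coords inner[OF idx(3,4)] cross trace idx)
  moreover have "(phi0 K \<nu>0 - 1) * (minv K A i j * minv K A k l)
        + phi0 K \<nu>0 * (minv K A i k * minv K A j l + minv K A i l * minv K A j k)
      = phi0 K \<nu>0 * (minv K A j l * minv K A i k + minv K A j k * minv K A i l)
        + (phi0 K \<nu>0 - 1) * minv K A i j * minv K A k l"
    by (simp add: algebra_simps)
  ultimately show ?thesis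
    by (intro has_expectation_block[of 0])
       (auto simp: mean_form_def intro: depends_on_mult t_form_depends_on)
qed

lemma contrast_form_variance:
  assumes k: "k < K"
  shows "has_expectation (\<lambda>v. contrast_form k v * contrast_form k v)
    (Xi nb \<nu> A k k)"
proof -
  let ?m = "real (nb k) - 1" and ?l = "lam nb A k" and ?J = "coords (Suc k)"
  have pos: "?l > 0" "?m > 0" using admissible_lam_pos[OF A k] real_nb_gt_1[OF k] by auto
  have phi: "t_phi ?J (\<nu> k) = phik nb \<nu> k"
    unfolding t_phi_def phik_def card_coords real_nb_diff[OF k]
    by (simp add: add_diff_eq add.commute)
  have Xi: "(\<phi> - 1) * (- 1 / (?l * ?m) * ?m)\<^sup>2 + 2 * \<phi> * ((- 1 / (?l * ?m))\<^sup>2 * ?m)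
      = (\<phi> - 1) / ?l\<^sup>2 + 2 * \<phi> / (?l\<^sup>2 * ?m)" for \<phi>
    using pos by (simp add: power2_eq_square)
  have "has_t_expectation ?J (\<nu> k) (\<lambda>v. contrast_form k v * contrast_form k v)
    (Xi nb \<nu> A k k)"
    using t_form_diagonal_variance[OF finite_coords nu_gt_2[OF k], of "Suc k" "- 1 / (?l * ?m)"]
    unfolding card_coords real_nb_diff[OF k] phi Xi by (simp add: contrast_form_def Xi_def)
  then show ?thesis
    using k
    by (intro has_expectation_block[of "Suc k"])
       (auto simp: contrast_form_def intro: depends_on_mult t_form_depends_on)
qed

lemma contrast_form_cov:
  assumes "k < K" "l < K"
  shows "has_expectation (\<lambda>v. contrast_form k v * contrast_form l v)
    (Xi nb \<nu> A k l)"
proof (cases "k = l")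
  case True then show ?thesis using contrast_form_variance[OF assms(1)] by simp
next
  case False
  then show ?thesis
    using t_forms_uncorrelated[of "Suc k" "Suc l"] assms by (simp add: contrast_form_def Xi_def)
qed

lemma mean_contrast_form_cov:
  assumes "k < K"
  shows "has_expectation (\<lambda>v. mean_form i j v * contrast_form k v) 0"
  using t_forms_uncorrelated[of 0 "Suc k"] assms by (simp add: mean_form_def contrast_form_def)

lemma info_vec_index:
  assumes idx: "i < K" "j < K" "k < K" "l < K"
  shows "info K nb \<nu>0 \<nu> A (i + K * j) (k + K * l)
    = 1 / 4 * (phi0 K \<nu>0 * (minv K A j l * minv K A i k + minv K A j k * minv K A i l)
       + (phi0 K \<nu>0 - 1) * minv K A i j * minv K A k l
       + of_bool (i = j) * of_bool (k = l) * Xi nb \<nu> A i k)"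
proof -
  have "(\<Sum>a<K. \<Sum>b<K. Ed K a (i + K * j) * Xi nb \<nu> A a b * Ed K b (k + K * l))
      = (\<Sum>a<K. \<Sum>b<K. if b = k then
          (if a = i then of_bool (i = j) * of_bool (k = l) * Xi nb \<nu> A a b else 0) else 0)"
    using idx by (intro sum.cong refl) (auto simp: Ed_index)
  also have "\<dots> = of_bool (i = j) * of_bool (k = l) * Xi nb \<nu> A i k" using idx by simp
  finally have diagonal: "(\<Sum>a<K. \<Sum>b<K. Ed K a (i + K * j) * Xi nb \<nu> A a b * Ed K b (k + K * l))
      = \<dots>" .
  have "Aot_inv K A (i + K * j) (p + K * q) = minv K A j q * minv K A i p"
    if "p < K" "q < K" for p q
    using mat_eqD[OF Aot_inv_eq_kron[OF admissible_spd[OF A]]] idx that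
    by (simp add: vec_index_less kron_index)
  then show ?thesis
    unfolding info_def diagonal mmult_HK[OF idx(3,4)] using idx by (simp add: vecm_index)
qed

lemma score_information:
  assumes p: "p < K * K" and q: "q < K * K"
  shows "has_expectation (\<lambda>v. score K nb U \<nu>0 \<nu> A (mapply n (Lmat K nb U A) v) p
        * score K nb U \<nu>0 \<nu> A (mapply n (Lmat K nb U A) v) q)
     (info K nb \<nu>0 \<nu> A p q)"
proof -
  obtain i j where ij: "i < K" "j < K" "p = i + K * j" by (rule vec_index_cases[OF p])
  obtain k l where kl: "k < K" "l < K" "q = k + K * l" by (rule vec_index_cases[OF q])
  let ?f = "fV K nb \<nu>0 \<nu>" and ?s = "of_bool (i = j) :: real" and ?t = "of_bool (k = l) :: real"
  let ?product = "\<lambda>v. 1 / 4 * (mean_form i j v * mean_form k l v * ?f v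
      + ?t * (mean_form i j v * contrast_form k v * ?f v)
      + ?s * (mean_form k l v * contrast_form i v * ?f v)
      + ?s * ?t * (contrast_form i v * contrast_form k v * ?f v))"
  let ?value = "1 / 4 * (phi0 K \<nu>0 * (minv K A j l * minv K A i k + minv K A j k * minv K A i l)
      + (phi0 K \<nu>0 - 1) * minv K A i j * minv K A k l + ?t * 0 + ?s * 0 + ?s * ?t * Xi nb \<nu> A i k)"
  have "has_bochner_integral (lborel_on {..<n}) ?product ?value"
    by (intro has_bochner_integral_mult_right has_bochner_integral_add mean_form_cov
        mean_contrast_form_cov contrast_form_cov ij kl)
  moreover have "score K nb U \<nu>0 \<nu> A (mapply n (Lmat K nb U A) v) p
      * score K nb U \<nu>0 \<nu> A (mapply n (Lmat K nb U A) v) q * ?f v = ?product v" for v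
    unfolding ij(3) kl(3) score_Lmat[OF ij(1,2)] score_Lmat[OF kl(1,2)]
    by (cases "i = j"; cases "k = l") (simp_all add: algebra_simps)
  moreover have "info K nb \<nu>0 \<nu> A p q = ?value"
    unfolding ij(3) kl(3) info_vec_index[OF ij(1,2) kl(1,2)] by simp
  ultimately show ?thesis by (simp only:)
qed

end

end

theorem theorem6:
  fixes K :: nat and nb :: "nat \<Rightarrow> nat" and U :: "nat \<Rightarrow> rmat"
    and \<nu>0 :: real and \<nu> :: "nat \<Rightarrow> real" and A :: rmat
  assumes K: "K \<ge> 1"
    and nb: "\<forall>k<K. nb k \<ge> 2"
    and U: "\<forall>k<K. is_vperp (nb k) (U k)"
    and Asym: "msym K A" and Apd: "mpd K A"
    and lampos: "\<forall>k<K. lam nb A k > 0"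
    and nu0: "\<nu>0 > 2" and nu: "\<forall>k<K. \<nu> k > 2"
  shows "(\<forall>z. has_sym_grad K (\<lambda>B. loglik K nb U \<nu>0 \<nu> B z) A (score K nb U \<nu>0 \<nu> A z))
    \<and> (\<forall>z. \<forall>p<K*K. score K nb U \<nu>0 \<nu> A z p = score K nb U \<nu>0 \<nu> A z (p div K + K * (p mod K)))
    \<and> (\<forall>p<K*K. \<forall>q<K*K.
         integrable (Pi\<^sub>M {..<ntot K nb} (\<lambda>_. lborel))
           (\<lambda>v. score K nb U \<nu>0 \<nu> A (mapply (ntot K nb) (Lmat K nb U A) v) p
              * score K nb U \<nu>0 \<nu> A (mapply (ntot K nb) (Lmat K nb U A) v) q
              * fV K nb \<nu>0 \<nu> v)
       \<and> (\<integral>v. score K nb U \<nu>0 \<nu> A (mapply (ntot K nb) (Lmat K nb U A) v) p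
              * score K nb U \<nu>0 \<nu> A (mapply (ntot K nb) (Lmat K nb U A) v) q
              * fV K nb \<nu>0 \<nu> v \<partial>(Pi\<^sub>M {..<ntot K nb} (\<lambda>_. lborel)))
         = info K nb \<nu>0 \<nu> A p q)"

proof -
  interpret t_setting K nb U \<nu>0 \<nu>
    by unfold_locales (use nb U nu0 nu in auto)
  have A: "admissible A" using Asym Apd lampos by (simp add: admissible_def spd_def)
  show ?thesis
    using loglik_has_sym_grad[OF A] score_sym[OF A] score_information[OF A]
    by (simp add: has_bochner_integral_iff)
qed

end
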